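(* Let $m,n\ge 1$ be integers, let $1<p_i<\infty$ for $i=1,\dots,m$, and let $\frac1p=\frac1{p_1}+\dots+\frac1{p_m}$; put $\vec P=(p_1,\dots,p_m)$. There is a constant $C_{n,m,\vec P}<\infty$, depending only on $n$, $m$ and $\vec P$, such that for every $\vec w=(w_1,\dots,w_m)\in A_{\vec P}$ and every $\vec f=(f_1,\dots,f_m)$ with measurable entries, $$\|\mathcal M(\vec f\,)\|_{L^p(\nu_{\vec w})}\le C_{n,m,\vec P}\,[\vec w]_{A_{\vec P}}^{\frac1p}\prod_{i=1}^m\big([\sigma_i]_{A_\infty}\big)^{\frac1{p_i}}\prod_{i=1}^m\|f_i\|_{L^{p_i}(w_i)},$$ where $\sigma_i=w_i^{1-p_i'}$, $i=1,\dots,m$. Furthermore, the exponents are sharp in the sense that they cannot be replaced by smaller ones: if $a\le \frac1p$ and $b_i\le\frac1{p_i}$ ($i=1,\dots,m$) are real numbers with at least one of these $m+1$ inequalities strict, then there is no finite constant $C$ such that $\|\mathcal M(\vec f\,)\|_{L^p(\nu_{\vec w})}\le C[\vec w]_{A_{\vec P}}^{a}\prod_{i=1}^m[\sigma_i]_{A_\infty}^{b_i}\prod_{i=1}^m\|f_i\|_{L^{p_i}(w_i)}$ holds for all $\vec w\in A_{\vec P}$ and all $\vec f$.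
   Context: Work in $\mathbb R^n$; cubes have sides parallel to the axes. A weight is a measurable function $w$ on $\mathbb R^n$ with $0<w<\infty$ a.e.; $w(Q)=\int_Q w$, and $\|f\|_{L^q(w)}=(\int_{\mathbb R^n}|f|^q w)^{1/q}$ for $0<q<\infty$. For $1<q<\infty$, $q'=q/(q-1)$. The multi(sub)linear maximal operator is $\mathcal M(\vec f\,)(x)=\sup_{Q\ni x}\prod_{i=1}^m\frac1{|Q|}\int_Q|f_i(y_i)|\,dy_i$, the supremum over all cubes $Q$ containing $x$. For an $m$-tuple of weights $\vec w=(w_1,\dots,w_m)$ put $\nu_{\vec w}=\prod_{i=1}^m w_i^{p/p_i}$ and $$[\vec w]_{A_{\vec P}}=\sup_Q\Big(\frac1{|Q|}\int_Q\nu_{\vec w}\Big)\prod_{i=1}^m\Big(\frac1{|Q|}\int_Q w_i^{1-p_i'}\Big)^{p/p_i'},$$ the supremum over all cubes $Q$; $\vec w\in A_{\vec P}$ means $[\vec w]_{A_{\vec P}}<\infty$. The $A_\infty$ constant of a weight $w$ is $[w]_{A_\infty}=\sup_Q\frac1{w(Q)}\int_Q M(w\chi_Q)$, where $M$ is the Hardy–Littlewood maximal operator $Mf(x)=\sup_{Q\ni x}\frac1{|Q|}\int_Q|f|$. *)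

theory Defs
  imports "HOL-Analysis.Analysis"
begin

(* Weights, maximal functions, norms and weight constants take values in [0,\<infinity>], so that no
   finiteness or integrability has to be presupposed. The library has no real powers on ennreal;
   the conventions here are x^0 = 1, 0^a = \<infinity> and \<infinity>^a = 0 for a < 0. *)
definition epowr :: "ennreal \<Rightarrow> real \<Rightarrow> ennreal"  (infixr "epowr" 80) where
  "x epowr a =
    (if a = 0 then 1
     else if x = 0 then (if 0 < a then 0 else \<infinity>)
     else if x = \<infinity> then (if 0 < a then \<infinity> else 0)
     else ennreal (enn2real x powr a))"

definition conj_exponent :: "real \<Rightarrow> real" where
  "conj_exponent q = q / (q - 1)"

(* Closed, non-degenerate cubes; each supremum below has the same value for open cubes. *)
definition cubes :: "(real^'n) set set" where
  "cubes = {cbox a (\<chi> i. a $ i + h) | a h. 0 < h}"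

definition average :: "(real^'n) set \<Rightarrow> (real^'n \<Rightarrow> ennreal) \<Rightarrow> ennreal" where
  "average Q g = (\<integral>\<^sup>+x\<in>Q. g x \<partial>lebesgue) / emeasure lebesgue Q"

definition weight :: "(real^'n \<Rightarrow> ennreal) \<Rightarrow> bool" where
  "weight w \<longleftrightarrow> w \<in> borel_measurable lebesgue \<and> (AE x in lebesgue. 0 < w x \<and> w x < \<infinity>)"

(* For real-valued f, apply this to the absolute value of f. *)
definition weighted_norm ::
    "real \<Rightarrow> (real^'n \<Rightarrow> ennreal) \<Rightarrow> (real^'n \<Rightarrow> ennreal) \<Rightarrow> ennreal" where
  "weighted_norm q w g = (\<integral>\<^sup>+x. g x epowr q * w x \<partial>lebesgue) epowr (1 / q)"

definition HL_maximal :: "(real^'n \<Rightarrow> ennreal) \<Rightarrow> real^'n \<Rightarrow> ennreal" where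
  "HL_maximal g x = (SUP Q\<in>{Q \<in> cubes. x \<in> Q}. average Q g)"

definition multi_maximal :: "nat \<Rightarrow> (nat \<Rightarrow> real^'n \<Rightarrow> real) \<Rightarrow> real^'n \<Rightarrow> ennreal" where
  "multi_maximal m f x =
    (SUP Q\<in>{Q \<in> cubes. x \<in> Q}. \<Prod>i\<in>{1..m}. average Q (\<lambda>y. ennreal \<bar>f i y\<bar>))"

(* On a cube with w(Q) = \<infinity> the quotient is 0 in ennreal. This does not affect the weights
   occurring in an A_P tuple: a finite A_P constant forces all the integrals in it to be finite. *)
definition A_inf_const :: "(real^'n \<Rightarrow> ennreal) \<Rightarrow> ennreal" where
  "A_inf_const w =
    (SUP Q\<in>cubes. (\<integral>\<^sup>+x\<in>Q. HL_maximal (\<lambda>y. w y * indicator Q y) x \<partial>lebesgue)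
      / (\<integral>\<^sup>+x\<in>Q. w x \<partial>lebesgue))"

definition nu_weight ::
    "nat \<Rightarrow> real \<Rightarrow> (nat \<Rightarrow> real) \<Rightarrow> (nat \<Rightarrow> real^'n \<Rightarrow> ennreal) \<Rightarrow> real^'n \<Rightarrow> ennreal" where
  "nu_weight m p P w x = (\<Prod>i\<in>{1..m}. w i x epowr (p / P i))"

definition sigma_weight :: "real \<Rightarrow> (real^'n \<Rightarrow> ennreal) \<Rightarrow> real^'n \<Rightarrow> ennreal" where
  "sigma_weight q w x = w x epowr (1 - conj_exponent q)"

definition A_P_const ::
    "nat \<Rightarrow> real \<Rightarrow> (nat \<Rightarrow> real) \<Rightarrow> (nat \<Rightarrow> real^'n \<Rightarrow> ennreal) \<Rightarrow> ennreal" where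
  "A_P_const m p P w =
    (SUP Q\<in>cubes. average Q (nu_weight m p P w) *
      (\<Prod>i\<in>{1..m}. average Q (sigma_weight (P i) (w i)) epowr (p / conj_exponent (P i))))"

definition A_P ::
    "nat \<Rightarrow> real \<Rightarrow> (nat \<Rightarrow> real) \<Rightarrow> (nat \<Rightarrow> real^'n \<Rightarrow> ennreal) set" where
  "A_P m p P = {w. (\<forall>i\<in>{1..m}. weight (w i)) \<and> A_P_const m p P w < \<infinity>}"

end

theory Submission
  imports Defs
begin

text \<open>
  The bound and its sharpness are proved separately.

  \<^bold>\<open>The bound.\<close> Every cube lies in a dyadic cube of comparable size from one of finitely many shifted dyadic
  grids (\<open>cube_subset_grid\<close>), so it suffices to consider the maximal operator along a countable, and by monotone
  convergence a finite, family of dyadic cubes. From such a family select principal cubes, those on which the product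
  of the averages of the \<open>\<bar>f\<^sub>i\<bar>\<close> exceeds \<open>(2 m)\<^sup>m\<close> times its value on every larger principal cube. The \<open>p\<close>-th power of
  the maximal function is dominated by the sum over principal cubes \<open>Q\<close> of the \<open>p\<close>-th powers of the products of averages,
  and by the weak type estimate the principal cubes are sparse: those strictly inside \<open>Q\<close> fill at most half of \<open>Q\<close>
  (\<open>principal_cubes_sparse\<close>).

  Write the average of \<open>\<bar>f\<^sub>i\<bar>\<close> as the average of \<open>\<sigma>\<^sub>i\<close> times the \<open>\<sigma>\<^sub>i\<close>-average of \<open>\<bar>f\<^sub>i\<bar> / \<sigma>\<^sub>i\<close>. The multilinear weight condition
  on \<open>Q\<close> absorbs \<open>\<nu>(Q)\<close> and most of the averages of the \<open>\<sigma>\<^sub>i\<close>, and what remains is the product over \<open>i\<close> of the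
  \<open>(p / p\<^sub>i)\<close>-th powers of \<open>\<sigma>\<^sub>i(Q)\<close> times the \<open>p\<^sub>i\<close>-th power of that \<open>\<sigma>\<^sub>i\<close>-average. Hoelder's inequality decouples the sum
  over \<open>Q\<close> into one sum for each \<open>i\<close> (\<open>sparse_form_bound\<close>), and each of them is a Carleson sum: sparseness implies the
  packing condition for \<open>\<sigma>\<^sub>i\<close> with constant \<open>2 [\<sigma>\<^sub>i]\<close>, the bracket being the \<open>A_inf\<close> constant
  (\<open>sparse_Carleson_packing\<close>), and the Carleson embedding theorem (\<open>Carleson_embedding\<close>) bounds the sum by a multiple of
  this constant and of the integral of \<open>\<bar>f\<^sub>i\<bar>\<close> to the power \<open>p\<^sub>i\<close> against \<open>w\<^sub>i\<close>.

  \<^bold>\<open>Sharpness.\<close> A single family of examples shows that no exponent can be decreased. Let \<open>s(x) = \<bar>x\<bar> powr (\<delta> - n)\<close> and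
  \<open>w\<^sub>i = s powr (1 - p\<^sub>i)\<close>, so that \<open>\<sigma>\<^sub>i = s\<close> for all \<open>i\<close>. The weight \<open>s\<close> satisfies an \<open>A\<^sub>1\<close> condition with constant of order \<open>1 / \<delta>\<close>
  (\<open>power_weight_A1\<close>), which bounds the \<open>A_inf\<close> constants by a multiple of \<open>1 / \<delta>\<close> and the multilinear constant by a multiple of
  \<open>(1 / \<delta>)\<close> to the power \<open>m p - 1\<close>. On the other hand the averages over centred cubes are of order \<open>s / \<delta>\<close>
  (\<open>power_weight_reverse\<close>), so for \<open>f\<^sub>i = s\<close> on a cube around the origin the maximal function is of order \<open>(s / \<delta>)\<^sup>m\<close> there, and the ratio
  of its norm to the product of the norms of the \<open>f\<^sub>i\<close> is of order \<open>(1 / \<delta>)\<^sup>m\<close> (\<open>exponents_necessary\<close>). Since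
  \<open>(m p - 1) / p + (1 / p\<^sub>1 + \<dots> + 1 / p\<^sub>m) = m\<close>, the exponents in the bound are exactly large enough, and any smaller choice
  fails as \<open>\<delta> \<rightarrow> 0\<close>.
\<close>

section \<open>Hoelder's inequality for finite sums of products\<close>

text \<open>Convexity of the exponential function, evaluated at the logarithms.\<close>

lemma weighted_arith_geom_mean:
  fixes x \<theta> :: "'i \<Rightarrow> real"
  assumes "finite I" and "\<And>i. i \<in> I \<Longrightarrow> 0 \<le> x i" and "\<And>i. i \<in> I \<Longrightarrow> 0 \<le> \<theta> i"
    and "(\<Sum>i\<in>I. \<theta> i) = 1"
  shows "(\<Prod>i\<in>I. x i powr \<theta> i) \<le> (\<Sum>i\<in>I. \<theta> i * x i)"
proof (cases "\<exists>i\<in>I. x i = 0")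
  case True
  then have "(\<Prod>i\<in>I. x i powr \<theta> i) = 0"
    using assms(1) by auto
  also have "0 \<le> (\<Sum>i\<in>I. \<theta> i * x i)"
    using assms(2,3) by (simp add: sum_nonneg)
  finally show ?thesis .
next
  case False
  then have pos: "x i > 0" if "i \<in> I" for i
    using assms(2) that by (metis less_eq_real_def)
  have "I \<noteq> {}"
    using assms(4) by auto
  then have "exp (\<Sum>i\<in>I. \<theta> i *\<^sub>R ln (x i)) \<le> (\<Sum>i\<in>I. \<theta> i * exp (ln (x i)))"
    using convex_on_sum[OF assms(1) _ exp_convex assms(4), of "\<lambda>i. ln (x i)"] assms(3) by auto
  moreover have "exp (\<Sum>i\<in>I. \<theta> i *\<^sub>R ln (x i)) = (\<Prod>i\<in>I. x i powr \<theta> i)"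
    using assms(1) pos by (simp add: exp_sum powr_def less_imp_neq[THEN not_sym])
  moreover have "(\<Sum>i\<in>I. \<theta> i * exp (ln (x i))) = (\<Sum>i\<in>I. \<theta> i * x i)"
    using pos by (intro sum.cong) auto
  ultimately show ?thesis by simp
qed

lemma Holder_inequality_sum_prod:
  fixes a :: "'i \<Rightarrow> 'q \<Rightarrow> real" and \<theta> :: "'i \<Rightarrow> real"
  assumes I: "finite I" and T: "finite T" and a: "\<And>i q. i \<in> I \<Longrightarrow> q \<in> T \<Longrightarrow> 0 \<le> a i q"
    and \<theta>: "\<And>i. i \<in> I \<Longrightarrow> 0 \<le> \<theta> i" and "(\<Sum>i\<in>I. \<theta> i) = 1"
  shows "(\<Sum>q\<in>T. \<Prod>i\<in>I. a i q powr \<theta> i) \<le> (\<Prod>i\<in>I. (\<Sum>q\<in>T. a i q) powr \<theta> i)"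
proof -
  define A where "A i = (\<Sum>q\<in>T. a i q)" for i
  have A0: "0 \<le> A i" if "i \<in> I" for i
    unfolding A_def using a that by (simp add: sum_nonneg)
  have az: "a i q = 0" if "i \<in> I" "q \<in> T" "A i = 0" for i q
    using that a T unfolding A_def by (simp add: sum_nonneg_eq_0_iff)
  \<comment> \<open>Normalised by their sums, the sequences satisfy the inequality termwise up to
    the weighted arithmetic mean; the division by zero is harmless because then all entries vanish.\<close>
  have "(\<Prod>i\<in>I. a i q powr \<theta> i) \<le> (\<Prod>i\<in>I. A i powr \<theta> i) * (\<Sum>i\<in>I. \<theta> i * (a i q / A i))"
    if q: "q \<in> T" for q
  proof -
    have "a i q powr \<theta> i = A i powr \<theta> i * (a i q / A i) powr \<theta> i" if "i \<in> I" for i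
    proof (cases "A i = 0")
      case True
      then show ?thesis using az[OF that q] by simp
    next
      case False
      then show ?thesis
        using A0[OF that] a[OF that q] by (simp flip: powr_mult)
    qed
    then have "(\<Prod>i\<in>I. a i q powr \<theta> i) = (\<Prod>i\<in>I. A i powr \<theta> i) * (\<Prod>i\<in>I. (a i q / A i) powr \<theta> i)"
      by (simp flip: prod.distrib)
    also have "\<dots> \<le> (\<Prod>i\<in>I. A i powr \<theta> i) * (\<Sum>i\<in>I. \<theta> i * (a i q / A i))"
      using assms q A0
      by (intro mult_left_mono weighted_arith_geom_mean prod_nonneg) auto
    finally show ?thesis .
  qed
  then have "(\<Sum>q\<in>T. \<Prod>i\<in>I. a i q powr \<theta> i)
      \<le> (\<Prod>i\<in>I. A i powr \<theta> i) * (\<Sum>q\<in>T. \<Sum>i\<in>I. \<theta> i * (a i q / A i))"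
    unfolding sum_distrib_left[of _ _ T] by (rule sum_mono)
  also have "(\<Sum>q\<in>T. \<Sum>i\<in>I. \<theta> i * (a i q / A i)) = (\<Sum>i\<in>I. \<theta> i * (A i / A i))"
    unfolding A_def sum_divide_distrib sum_distrib_left by (rule sum.swap)
  also have "\<dots> \<le> (\<Sum>i\<in>I. \<theta> i)"
    using \<theta> by (intro sum_mono) (auto simp: divide_self_if)
  finally show ?thesis
    using assms(5) A0 by (simp add: A_def mult_left_mono prod_nonneg)
qed

section \<open>Laminar families and principal subfamilies\<close>

text \<open>Families in which any two members are nested or disjoint: the only property of dyadic cubes that
the covering and stopping arguments below depend on.\<close>

definition laminar :: "'a set set \<Rightarrow> bool" where
  "laminar F \<longleftrightarrow> (\<forall>Q\<in>F. \<forall>R\<in>F. Q \<subseteq> R \<or> R \<subseteq> Q \<or> Q \<inter> R = {})"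

lemma laminar_subset: "laminar F \<Longrightarrow> G \<subseteq> F \<Longrightarrow> laminar G"
  unfolding laminar_def by blast

text \<open>The stopping construction. Adding the members of \<open>F\<close> in an order in which smaller sets come last,
keep a set only if its value exceeds \<open>a\<close> times the value of every set kept around it. Then every member is
dominated by a kept set containing it, while values jump by the factor \<open>a\<close> between nested kept sets.
The induction removes a minimal member of \<open>F\<close>, which is the one that is examined last.\<close>

lemma principal_subfamily:
  fixes A :: "'a set \<Rightarrow> real"
  assumes "finite F" and "\<And>Q. Q \<in> F \<Longrightarrow> 0 \<le> A Q" and "1 \<le> a"
  obtains G where "G \<subseteq> F" and "\<And>Q. Q \<in> F \<Longrightarrow> \<exists>R\<in>G. Q \<subseteq> R \<and> A Q \<le> a * A R"
    and "\<And>Q R. Q \<in> G \<Longrightarrow> R \<in> G \<Longrightarrow> Q \<subset> R \<Longrightarrow> a * A R < A Q"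
proof -
  have "\<exists>G\<subseteq>F. (\<forall>Q\<in>F. \<exists>R\<in>G. Q \<subseteq> R \<and> A Q \<le> a * A R) \<and>
      (\<forall>Q\<in>G. \<forall>R\<in>G. Q \<subset> R \<longrightarrow> a * A R < A Q)"
    using assms(1,2)
  proof (induction "card F" arbitrary: F)
    case 0
    then show ?case by auto
  next
    case (Suc k)
    then obtain Q0 where Q0: "Q0 \<in> F" "\<And>Q. Q \<in> F \<Longrightarrow> \<not> Q \<subset> Q0"
      using finite_has_minimal[of F] by (metis card.empty nat.distinct(1) psubset_eq)
    have "k = card (F - {Q0})"
      using Suc.hyps(2) Q0(1) Suc.prems by simp
    then obtain G where G: "G \<subseteq> F - {Q0}" "\<forall>Q\<in>F - {Q0}. \<exists>R\<in>G. Q \<subseteq> R \<and> A Q \<le> a * A R"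
      "\<forall>Q\<in>G. \<forall>R\<in>G. Q \<subset> R \<longrightarrow> a * A R < A Q"
      using Suc.hyps(1)[of "F - {Q0}"] Suc.prems by auto
    show ?case
    proof (cases "\<exists>R\<in>G. Q0 \<subseteq> R \<and> A Q0 \<le> a * A R")
      case True
      then show ?thesis using G by (intro exI[of _ G]) auto
    next
      case False
      have "A Q0 \<le> a * A Q0"
        using mult_right_mono[OF assms(3) Suc.prems(2)[OF Q0(1)]] by simp
      then show ?thesis
        using G Q0
      proof (intro exI[of _ "insert Q0 G"] conjI ballI impI)
        show "insert Q0 G \<subseteq> F"
          using G(1) Q0(1) by auto
        show "\<exists>R\<in>insert Q0 G. Q \<subseteq> R \<and> A Q \<le> a * A R" if "Q \<in> F" for Q
          using G(2) that \<open>A Q0 \<le> a * A Q0\<close> by (cases "Q = Q0") auto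
        fix Q R assume QR: "Q \<in> insert Q0 G" "R \<in> insert Q0 G" "Q \<subset> R"
        then have "R \<in> G"
          using Q0(2) G(1) by auto
        show "a * A R < A Q"
        proof (cases "Q = Q0")
          case True
          then show ?thesis using False \<open>R \<in> G\<close> QR(3) by force
        next
          case False
          then show ?thesis using G(3) \<open>R \<in> G\<close> QR by simp
        qed
      qed
    qed
  qed
  then obtain G where G: "G \<subseteq> F" "\<forall>Q\<in>F. \<exists>R\<in>G. Q \<subseteq> R \<and> A Q \<le> a * A R"
      "\<forall>Q\<in>G. \<forall>R\<in>G. Q \<subset> R \<longrightarrow> a * A R < A Q"
    by auto
  show thesis
    by (rule that[of G]) (simp_all add: G)
qed

text \<open>Removing the largest value halves the bound on the remaining ones, so the sum is dominated by the geometric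
series with ratio \<open>2 powr - s\<close>.\<close>

lemma sum_powr_separated_le:
  fixes t :: "'a \<Rightarrow> real"
  assumes "finite X" and "0 < s" and "\<And>x. x \<in> X \<Longrightarrow> 0 \<le> t x \<and> t x \<le> L"
    and "\<And>x y. x \<in> X \<Longrightarrow> y \<in> X \<Longrightarrow> x \<noteq> y \<Longrightarrow> 2 * t x \<le> t y \<or> 2 * t y \<le> t x"
    and "0 \<le> L"
  shows "(\<Sum>x\<in>X. t x powr s) \<le> L powr s / (1 - 2 powr - s)"
  using assms(1,3,4,5)
proof (induction "card X" arbitrary: X L)
  case 0
  have "2 powr - s < (2::real) powr 0"
    using \<open>0 < s\<close> by (intro powr_less_mono) auto
  with 0 show ?case by simp
next
  case (Suc k)
  have c: "2 powr - s < (1::real)"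
    using powr_less_mono[of "-s" 0 "2::real"] \<open>0 < s\<close> by simp
  have ne: "X \<noteq> {}" "finite X" using Suc.hyps(2) by (auto intro: card_ge_0_finite)
  obtain z where z: "z \<in> X" "\<And>x. x \<in> X \<Longrightarrow> t x \<le> t z"
  proof -
    have "Max (t ` X) \<in> t ` X" using ne by auto
    then show ?thesis using that ne by (metis (no_types, lifting) Max_ge finite_imageI image_iff)
  qed
  have half: "t x \<le> t z / 2" if "x \<in> X - {z}" for x
    using Suc.prems(2)[of x] Suc.prems(2)[of z] Suc.prems(3)[of x z] z that by fastforce
  have "(\<Sum>x\<in>X - {z}. t x powr s) \<le> (t z / 2) powr s / (1 - 2 powr - s)"
    using Suc.hyps(2) ne z Suc.prems half by (intro Suc.hyps(1)) auto
  also have "(t z / 2) powr s = t z powr s * 2 powr - s"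
    using Suc.prems(2)[OF z(1)] by (simp add: powr_divide powr_minus_divide)
  finally have "(\<Sum>x\<in>X. t x powr s) \<le> t z powr s * (1 + 2 powr - s / (1 - 2 powr - s))"
    using z ne by (simp add: sum.remove[of X z] algebra_simps)
  also have "1 + 2 powr - s / (1 - 2 powr - s) = 1 / (1 - 2 powr - s)"
  proof -
    have "1 + d / (1 - d) = 1 / (1 - d)" if "d < 1" for d :: real
      using that by (simp add: field_simps)
    then show ?thesis using c .
  qed
  also have "t z powr s * (1 / (1 - 2 powr - s)) \<le> L powr s / (1 - 2 powr - s)"
    using c Suc.prems(2)[OF z(1)] \<open>0 < s\<close> by (simp add: divide_right_mono powr_mono2)
  finally show ?case .
qed

text \<open>The maximal members of a finite laminar family already cover its union.\<close>

lemma laminar_union_maximal: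
  assumes "finite F" and "laminar F"
  obtains D where "D \<subseteq> F" and "disjoint D" and "\<Union>D = \<Union>F"
proof
  let ?D = "{Q\<in>F. \<forall>R\<in>F. \<not> Q \<subset> R}"
  show "?D \<subseteq> F" by auto
  show "disjoint ?D"
  proof (rule disjointI)
    fix Q R assume "Q \<in> ?D" "R \<in> ?D" "Q \<noteq> R"
    moreover from this have "Q \<subseteq> R \<or> R \<subseteq> Q \<or> Q \<inter> R = {}"
      using assms(2) unfolding laminar_def by simp
    ultimately show "Q \<inter> R = {}"
      by auto
  qed
  have "\<exists>R\<in>?D. Q \<subseteq> R" if Q: "Q \<in> F" for Q
  proof -
    obtain R where "R \<in> F" "Q \<subseteq> R" "\<And>S. S \<in> F \<Longrightarrow> R \<subseteq> S \<Longrightarrow> R = S"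
      using finite_has_maximal2[OF assms(1) Q] by auto
    then show ?thesis
      by (intro bexI[of _ R]) auto
  qed
  then show "\<Union>?D = \<Union>F" by blast
qed

section \<open>Sparseness and the Carleson embedding\<close>

text \<open>The weak type estimate of the maximal operator along a laminar family: sum the hypothesis over the disjoint
maximal members.\<close>

lemma laminar_weak_type:
  assumes "finite F" and "laminar F" and F: "F \<subseteq> sets M" and g: "g \<in> borel_measurable M"
    and le: "\<And>Q. Q \<in> F \<Longrightarrow> c * emeasure M Q \<le> (\<integral>\<^sup>+x\<in>Q. g x \<partial>M)"
  shows "c * emeasure M (\<Union>F) \<le> (\<integral>\<^sup>+x\<in>\<Union>F. g x \<partial>M)"
proof -
  obtain D where D: "D \<subseteq> F" "disjoint D" "\<Union>D = \<Union>F"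
    using laminar_union_maximal[OF assms(1,2)] by auto
  have fin: "finite D"
    using D(1) assms(1) finite_subset by auto
  have disj: "disjoint_family_on (\<lambda>Q. Q) D"
    using D(2) by (auto simp: disjoint_family_on_def disjoint_def)
  have meas: "\<Union>F \<in> sets M"
    using assms(1) F by (auto intro: sets.finite_Union)
  have "c * emeasure M (\<Union>F) = (\<Sum>Q\<in>D. c * emeasure M Q)"
    using sum_emeasure[OF _ disj fin, of M] D F by (simp flip: sum_distrib_left)
  also have "\<dots> \<le> (\<Sum>Q\<in>D. \<integral>\<^sup>+x\<in>Q. g x \<partial>M)"
    using D(1) by (auto intro!: sum_mono le)
  also have "\<dots> = (\<Sum>Q\<in>D. emeasure (density M g) Q)"
    using D(1) F g by (intro sum.cong) (auto simp: emeasure_density)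
  also have "\<dots> = emeasure (density M g) (\<Union>F)"
    using sum_emeasure[OF _ disj fin, of "density M g"] D F by simp
  also have "\<dots> = (\<integral>\<^sup>+x\<in>\<Union>F. g x \<partial>M)"
    using g meas by (simp add: emeasure_density)
  finally show ?thesis .
qed

text \<open>The mean as a real number, so that products and real powers of means can be formed without
arithmetic in \<open>[0,\<infinity>]\<close>. It is meaningful when the integral is finite.\<close>

definition mean :: "'a measure \<Rightarrow> 'a set \<Rightarrow> ('a \<Rightarrow> ennreal) \<Rightarrow> real" where
  "mean M Q g = enn2real (\<integral>\<^sup>+x\<in>Q. g x \<partial>M) / measure M Q"

lemma mean_nonneg: "0 \<le> mean M Q g"
  by (simp add: mean_def)

lemma mean_times_emeasure:
  assumes "0 < emeasure M Q" and "emeasure M Q < \<infinity>" and "(\<integral>\<^sup>+x\<in>Q. g x \<partial>M) < \<infinity>"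
  shows "ennreal (mean M Q g) * emeasure M Q = (\<integral>\<^sup>+x\<in>Q. g x \<partial>M)"
proof -
  have "measure M Q > 0"
    using assms by (simp add: measure_def enn2real_positive_iff)
  then have "ennreal (mean M Q g) * ennreal (measure M Q) = ennreal (enn2real (\<integral>\<^sup>+x\<in>Q. g x \<partial>M))"
    by (simp add: mean_def flip: ennreal_mult)
  then show ?thesis
    using assms by (simp add: emeasure_eq_ennreal_measure)
qed

text \<open>Let \<open>m\<close> be the number of functions. For each member strictly inside \<open>R\<close> one of the functions
has a mean more than \<open>2 m\<close> times its mean over \<open>R\<close>; by the weak type estimate the sets selected by one
function have measure at most \<open>\<bar>R\<bar> / (2 m)\<close>, and there are \<open>m\<close> functions.\<close>

lemma principal_cubes_sparse:
  fixes f :: "'i \<Rightarrow> 'a \<Rightarrow> ennreal"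
  assumes "finite I" and "finite S" and "laminar S" and S: "S \<subseteq> sets M"
    and pos: "\<And>Q. Q \<in> S \<Longrightarrow> 0 < emeasure M Q" and fin: "\<And>Q. Q \<in> S \<Longrightarrow> emeasure M Q < \<infinity>"
    and f: "\<And>i. i \<in> I \<Longrightarrow> f i \<in> borel_measurable M"
    and int: "\<And>i Q. i \<in> I \<Longrightarrow> Q \<in> S \<Longrightarrow> (\<integral>\<^sup>+x\<in>Q. f i x \<partial>M) < \<infinity>"
    and R: "R \<in> S" and R0: "0 < (\<Prod>i\<in>I. mean M R (f i))"
    and jump: "\<And>Q. Q \<in> S \<Longrightarrow> Q \<subset> R \<Longrightarrow>
      (2 * real (card I)) ^ card I * (\<Prod>i\<in>I. mean M R (f i)) < (\<Prod>i\<in>I. mean M Q (f i))"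
  shows "2 * emeasure M (\<Union>{Q\<in>S. Q \<subset> R}) \<le> emeasure M R"
proof (cases "I = {}")
  case True
  then have *: "{Q\<in>S. Q \<subset> R} = {}"
    using jump by auto
  show ?thesis
    unfolding * by simp
next
  case False
  define m where "m = real (card I)"
  have m: "m > 0"
    using False \<open>finite I\<close> by (simp add: m_def card_gt_0_iff)
  define T where "T i = {Q\<in>S. Q \<subset> R \<and> 2 * m * mean M R (f i) < mean M Q (f i)}" for i
  have TS: "T i \<subseteq> S" "finite (T i)" for i
    using \<open>finite S\<close> by (auto simp: T_def)
  have TR: "\<Union>(T i) \<subseteq> R" for i
    by (auto simp: T_def)
  have Tm: "\<Union>(T i) \<in> sets M" for i
    using TS S by (intro sets.finite_Union) auto
  \<comment> \<open>A product of means can only jump by the factor \<open>(2 m)\<^sup>m\<close> if one of its factors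
    jumps by \<open>2 m\<close>.\<close>
  have cover: "{Q\<in>S. Q \<subset> R} \<subseteq> (\<Union>i\<in>I. T i)"
  proof
    fix Q assume Q: "Q \<in> {Q\<in>S. Q \<subset> R}"
    have "\<exists>i\<in>I. 2 * m * mean M R (f i) < mean M Q (f i)"
    proof (rule ccontr)
      assume "\<not> ?thesis"
      then have "(\<Prod>i\<in>I. mean M Q (f i)) \<le> (\<Prod>i\<in>I. 2 * m * mean M R (f i))"
        by (intro prod_mono) (auto simp: mean_nonneg not_less)
      also have "\<dots> = (2 * m) ^ card I * (\<Prod>i\<in>I. mean M R (f i))"
        by (simp add: prod.distrib)
      finally show False
        using jump[of Q] Q by (simp add: m_def)
    qed
    then show "Q \<in> (\<Union>i\<in>I. T i)"
      using Q by (auto simp: T_def)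
  qed
  have small: "ennreal (2 * m) * emeasure M (\<Union>(T i)) \<le> emeasure M R" if i: "i \<in> I" for i
  proof -
    let ?a = "mean M R (f i)"
    have a: "?a > 0"
    proof (rule ccontr)
      assume "\<not> ?a > 0"
      then have "?a = 0"
        using mean_nonneg[of M R "f i"] by simp
      then show False
        using R0 i \<open>finite I\<close> by (metis less_irrefl prod_zero)
    qed
    have "ennreal (2 * m * ?a) * emeasure M (\<Union>(T i)) \<le> (\<integral>\<^sup>+x\<in>\<Union>(T i). f i x \<partial>M)"
    proof (rule laminar_weak_type)
      fix Q assume Q: "Q \<in> T i"
      then have "Q \<in> S" using TS by auto
      have "ennreal (2 * m * ?a) * emeasure M Q \<le> ennreal (mean M Q (f i)) * emeasure M Q"
        using Q by (intro mult_right_mono ennreal_leI) (auto simp: T_def)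
      also have "\<dots> = (\<integral>\<^sup>+x\<in>Q. f i x \<partial>M)"
        using \<open>Q \<in> S\<close> i pos fin int by (intro mean_times_emeasure) auto
      finally show "ennreal (2 * m * ?a) * emeasure M Q \<le> (\<integral>\<^sup>+x\<in>Q. f i x \<partial>M)" .
    qed (use TS S f i laminar_subset[OF \<open>laminar S\<close>] in auto)
    also have "\<dots> \<le> (\<integral>\<^sup>+x\<in>R. f i x \<partial>M)"
      using TR[of i] by (intro nn_integral_mono mult_left_mono) (auto simp: indicator_def)
    also have "\<dots> = ennreal ?a * emeasure M R"
      using R pos fin int i by (intro mean_times_emeasure[symmetric]) auto
    finally have "ennreal ?a * (ennreal (2 * m) * emeasure M (\<Union>(T i))) \<le> ennreal ?a * emeasure M R"
      using a m by (simp add: ennreal_mult mult_ac)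
    then show ?thesis
      using a by (subst (asm) ennreal_mult_le_mult_iff) auto
  qed
  have "\<Union>{Q\<in>S. Q \<subset> R} \<subseteq> (\<Union>i\<in>I. \<Union>(T i))"
    using cover by auto
  then have "emeasure M (\<Union>{Q\<in>S. Q \<subset> R}) \<le> emeasure M (\<Union>i\<in>I. \<Union>(T i))"
    using Tm \<open>finite I\<close> by (intro emeasure_mono) auto
  also have "\<dots> \<le> (\<Sum>i\<in>I. emeasure M (\<Union>(T i)))"
    using Tm \<open>finite I\<close> by (intro emeasure_subadditive_finite) auto
  finally have "ennreal (2 * m) * emeasure M (\<Union>{Q\<in>S. Q \<subset> R})
      \<le> ennreal (2 * m) * (\<Sum>i\<in>I. emeasure M (\<Union>(T i)))"
    by (rule mult_left_mono) simp
  also have "\<dots> \<le> (\<Sum>i\<in>I. emeasure M R)"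
    unfolding sum_distrib_left using small by (intro sum_mono) auto
  also have "\<dots> = ennreal m * emeasure M R"
    by (simp add: m_def ennreal_of_nat_eq_real_of_nat)
  finally have "ennreal m * (2 * emeasure M (\<Union>{Q\<in>S. Q \<subset> R})) \<le> ennreal m * emeasure M R"
    using m by (simp add: ennreal_mult mult_ac)
  then show ?thesis
    using m by (subst (asm) ennreal_mult_le_mult_iff) auto
qed

text \<open>The dyadic Carleson embedding theorem, without a maximal theorem. Grouping the sets below their principal
ancestor (for the means of \<open>g\<close>, with jump factor \<open>2\<close>) and using the packing condition reduces the
sum to principal sets. There at least half of the integral of \<open>g\<close> over \<open>R\<close> comes from points where
\<open>2 g\<close> is at least the mean over \<open>R\<close>. After interchanging sum and integral, the principal sets through
a point that satisfy this have geometrically growing means bounded by \<open>2 g\<close>, so that their \<open>(q-1)\<close>-th powers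
sum to a multiple of \<open>g powr (q - 1)\<close>.\<close>

lemma Carleson_embedding:
  fixes g :: "'a \<Rightarrow> real"
  assumes "finite F" and "laminar F" and F: "F \<subseteq> sets M"
    and pos: "\<And>Q. Q \<in> F \<Longrightarrow> 0 < emeasure M Q" and fin: "\<And>Q. Q \<in> F \<Longrightarrow> emeasure M Q < \<infinity>"
    and g[measurable]: "g \<in> borel_measurable M" and g0: "\<And>x. 0 \<le> g x"
    and int: "\<And>Q. Q \<in> F \<Longrightarrow> (\<integral>\<^sup>+x\<in>Q. ennreal (g x) \<partial>M) < \<infinity>"
    and q: "1 < q"
    and Carleson: "\<And>R. R \<in> F \<Longrightarrow> (\<Sum>Q | Q \<in> F \<and> Q \<subseteq> R. emeasure M Q) \<le> K * emeasure M R"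
  shows "(\<Sum>Q\<in>F. ennreal (mean M Q g powr q) * emeasure M Q)
    \<le> ennreal (2 powr (2 * q) / (1 - 2 powr (1 - q))) * K * (\<integral>\<^sup>+x. ennreal (g x powr q) \<partial>M)"
proof -
  let ?a = "\<lambda>Q. mean M Q g"
  obtain G where GF: "G \<subseteq> F" and dom: "\<And>Q. Q \<in> F \<Longrightarrow> \<exists>R\<in>G. Q \<subseteq> R \<and> ?a Q \<le> 2 * ?a R"
    and jump: "\<And>Q R. Q \<in> G \<Longrightarrow> R \<in> G \<Longrightarrow> Q \<subset> R \<Longrightarrow> 2 * ?a R < ?a Q"
    using principal_subfamily[of F ?a 2] assms(1) by (auto simp: mean_nonneg)
  have finG: "finite G"
    using GF assms(1) finite_subset by auto
  have c: "2 powr (1 - q) < (1::real)"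
    using powr_less_mono[of "1 - q" 0 "2::real"] q by simp
  \<comment> \<open>Replace every set by its principal ancestor.\<close>
  have to_principal: "(\<Sum>Q\<in>F. ennreal (?a Q powr q) * emeasure M Q)
      \<le> ennreal (2 powr q) * K * (\<Sum>R\<in>G. ennreal (?a R powr q) * emeasure M R)"
  proof -
    have "(\<Sum>Q\<in>F. ennreal (?a Q powr q) * emeasure M Q)
        \<le> (\<Sum>Q\<in>F. \<Sum>R\<in>G. ennreal ((2 * ?a R) powr q) * (if Q \<subseteq> R then emeasure M Q else 0))"
    proof (rule sum_mono)
      fix Q assume "Q \<in> F"
      then obtain R where R: "R \<in> G" "Q \<subseteq> R" "?a Q \<le> 2 * ?a R"
        using dom by auto
      have "ennreal (?a Q powr q) * emeasure M Q
          \<le> ennreal ((2 * ?a R) powr q) * (if Q \<subseteq> R then emeasure M Q else 0)"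
        using R q mean_nonneg[of M Q g]
        by (auto intro!: mult_right_mono ennreal_leI powr_mono2)
      also have "\<dots> \<le> (\<Sum>R\<in>G. ennreal ((2 * ?a R) powr q) * (if Q \<subseteq> R then emeasure M Q else 0))"
        using R finG by (intro member_le_sum) auto
      finally show "ennreal (?a Q powr q) * emeasure M Q \<le> \<dots>" .
    qed
    also have "\<dots> = (\<Sum>R\<in>G. ennreal ((2 * ?a R) powr q) * (\<Sum>Q | Q \<in> F \<and> Q \<subseteq> R. emeasure M Q))"
      using assms(1)
      by (subst sum.swap) (auto simp: sum_distrib_left sum.inter_filter intro!: sum.cong)
    also have "\<dots> \<le> (\<Sum>R\<in>G. ennreal ((2 * ?a R) powr q) * (K * emeasure M R))"
      using GF by (intro sum_mono mult_left_mono Carleson) auto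
    also have "\<dots> = ennreal (2 powr q) * K * (\<Sum>R\<in>G. ennreal (?a R powr q) * emeasure M R)"
      unfolding sum_distrib_left
      by (intro sum.cong) (auto simp: powr_mult ennreal_mult mean_nonneg mult_ac)
    finally show ?thesis .
  qed
  \<comment> \<open>The part of \<open>R\<close> on which \<open>g\<close> is below half its mean carries at most half of the integral.\<close>
  have half: "ennreal (?a R) * emeasure M R
      \<le> 2 * (\<integral>\<^sup>+x. ennreal (g x) * indicator {x\<in>R. ?a R \<le> 2 * g x} x \<partial>M)" if "R \<in> G" for R
  proof -
    have RF: "R \<in> F" "R \<in> sets M" using that GF F by auto
    let ?I = "\<integral>\<^sup>+x\<in>R. ennreal (g x) \<partial>M"
    let ?H = "\<integral>\<^sup>+x. ennreal (g x) * indicator {x\<in>R. ?a R \<le> 2 * g x} x \<partial>M"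
    have I: "ennreal (?a R) * emeasure M R = ?I"
      using RF pos fin int by (intro mean_times_emeasure) auto
    have [measurable]: "{x\<in>R. ?a R \<le> 2 * g x} \<in> sets M"
    proof -
      have "{x\<in>R. ?a R \<le> 2 * g x} = R \<inter> {x\<in>space M. ?a R \<le> 2 * g x}"
        using sets.sets_into_space[OF RF(2)] by auto
      then show ?thesis using RF(2) by simp
    qed
    have "?I \<le> (\<integral>\<^sup>+x. ennreal (g x) * indicator {x\<in>R. ?a R \<le> 2 * g x} x
        + ennreal (?a R / 2) * indicator R x \<partial>M)"
      by (intro nn_integral_mono) (auto simp: indicator_def intro!: ennreal_leI)
    also have "\<dots> = ?H + ennreal (?a R / 2) * emeasure M R"
      using RF by (subst nn_integral_add) (auto simp: nn_integral_cmult_indicator)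
    finally have "?I \<le> ?H + ennreal (?a R / 2) * emeasure M R" .
    then have "2 * ?I \<le> 2 * (?H + ennreal (?a R / 2) * emeasure M R)"
      by (rule mult_left_mono) simp
    also have "\<dots> = 2 * ?H + 2 * (ennreal (?a R / 2) * emeasure M R)"
      by (rule distrib_left)
    also have "2 * (ennreal (?a R / 2) * emeasure M R) = ennreal (2 * (?a R / 2)) * emeasure M R"
      by (subst ennreal_mult'[of 2]) (auto simp only: ennreal_numeral mult.assoc)
    also have "\<dots> = ?I"
      using I by simp
    finally have "?I + ?I \<le> ?I + 2 * ?H"
      unfolding mult_2[of ?I] add.commute[of "2 * ?H"] .
    then have "?I \<le> 2 * ?H"
      using int[OF RF(1)] by (simp only: ennreal_add_left_cancel_le) auto
    then show ?thesis
      unfolding I .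
  qed
  \<comment> \<open>The principal sets containing a point form a chain along which the means grow geometrically.\<close>
  have chain: "(\<Sum>R | R \<in> G \<and> x \<in> R \<and> ?a R \<le> 2 * g x. ?a R powr (q - 1))
      \<le> (2 * g x) powr (q - 1) / (1 - 2 powr - (q - 1))" for x
  proof (rule sum_powr_separated_le)
    fix Q R assume Q: "Q \<in> {R \<in> G. x \<in> R \<and> ?a R \<le> 2 * g x}"
      and R: "R \<in> {R \<in> G. x \<in> R \<and> ?a R \<le> 2 * g x}" and "Q \<noteq> R"
    have "Q \<subseteq> R \<or> R \<subseteq> Q \<or> Q \<inter> R = {}"
    proof -
      have "Q \<in> F" "R \<in> F"
        using Q R GF by auto
      then show ?thesis
        using assms(2) unfolding laminar_def by simp
    qed
    then have "Q \<subset> R \<or> R \<subset> Q"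
      using Q R \<open>Q \<noteq> R\<close> by auto
    then show "2 * ?a Q \<le> ?a R \<or> 2 * ?a R \<le> ?a Q"
    proof
      assume "Q \<subset> R"
      then show ?thesis using jump[of Q R] Q R by simp
    next
      assume "R \<subset> Q"
      then show ?thesis using jump[of R Q] Q R by simp
    qed
  qed (use finG q g0 in \<open>auto simp: mean_nonneg\<close>)
  have "(\<Sum>R\<in>G. ennreal (?a R powr q) * emeasure M R)
      \<le> (\<Sum>R\<in>G. ennreal (?a R powr (q - 1)) *
          (2 * (\<integral>\<^sup>+x. ennreal (g x) * indicator {x\<in>R. ?a R \<le> 2 * g x} x \<partial>M)))"
  proof (rule sum_mono)
    fix R assume R: "R \<in> G"
    have "?a R powr q = ?a R powr (q - 1) * ?a R"
    proof (cases "?a R = 0")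
      case False
      then have "?a R > 0" using mean_nonneg[of M R g] by simp
      then show ?thesis by (simp add: powr_diff)
    qed simp
    then have "ennreal (?a R powr q) * emeasure M R
        = ennreal (?a R powr (q - 1)) * (ennreal (?a R) * emeasure M R)"
      by (simp add: ennreal_mult mean_nonneg mult_ac)
    then show "ennreal (?a R powr q) * emeasure M R \<le> ennreal (?a R powr (q - 1)) *
          (2 * (\<integral>\<^sup>+x. ennreal (g x) * indicator {x\<in>R. ?a R \<le> 2 * g x} x \<partial>M))"
      using half[OF R] by (simp add: mult_left_mono)
  qed
  also have "\<dots> = (\<integral>\<^sup>+x. (\<Sum>R\<in>G. 2 * ennreal (?a R powr (q - 1)) *
      (ennreal (g x) * indicator {x\<in>R. ?a R \<le> 2 * g x} x)) \<partial>M)"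
  proof -
    have m: "{x\<in>R. ?a R \<le> 2 * g x} \<in> sets M" if "R \<in> G" for R
    proof -
      have "R \<in> sets M" using that GF F by auto
      moreover have "{x\<in>R. ?a R \<le> 2 * g x} = R \<inter> {x\<in>space M. ?a R \<le> 2 * g x}"
        using sets.sets_into_space[OF \<open>R \<in> sets M\<close>] by auto
      ultimately show ?thesis by simp
    qed
    show ?thesis
      using m by (subst nn_integral_sum) (auto simp: nn_integral_cmult mult.assoc mult.left_commute[of _ 2] intro!: sum.cong)
  qed
  also have "\<dots> \<le> (\<integral>\<^sup>+x. ennreal (2 powr q / (1 - 2 powr (1 - q))) * ennreal (g x powr q) \<partial>M)"
  proof (rule nn_integral_mono)
    fix x
    have "(\<Sum>R\<in>G. 2 * ennreal (?a R powr (q - 1)) *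
        (ennreal (g x) * indicator {x\<in>R. ?a R \<le> 2 * g x} x))
      = (\<Sum>R | R \<in> G \<and> x \<in> R \<and> ?a R \<le> 2 * g x. 2 * ennreal (?a R powr (q - 1)) * ennreal (g x))"
      using finG by (subst sum.inter_filter) (auto simp: indicator_def intro!: sum.cong)
    also have "\<dots> = ennreal (2 * g x * (\<Sum>R | R \<in> G \<and> x \<in> R \<and> ?a R \<le> 2 * g x. ?a R powr (q - 1)))"
      unfolding sum_distrib_left using g0
      by (subst sum_ennreal[symmetric]) (auto simp: ennreal_mult mult_ac intro!: sum.cong)
    also have "\<dots> \<le> ennreal (2 * g x * ((2 * g x) powr (q - 1) / (1 - 2 powr - (q - 1))))"
      using chain[of x] g0[of x] by (intro ennreal_leI mult_left_mono) auto
    also have "2 * g x * ((2 * g x) powr (q - 1) / (1 - 2 powr - (q - 1)))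
        = 2 powr q / (1 - 2 powr (1 - q)) * g x powr q"
    proof (cases "g x = 0")
      case False
      then have "g x > 0" using g0[of x] by simp
      then show ?thesis by (simp add: powr_diff powr_mult)
    qed simp
    finally show "(\<Sum>R\<in>G. 2 * ennreal (?a R powr (q - 1)) *
        (ennreal (g x) * indicator {x\<in>R. ?a R \<le> 2 * g x} x))
      \<le> ennreal (2 powr q / (1 - 2 powr (1 - q))) * ennreal (g x powr q)"
      using c by (subst ennreal_mult[symmetric]) auto
  qed
  also have "\<dots> = ennreal (2 powr q / (1 - 2 powr (1 - q))) * (\<integral>\<^sup>+x. ennreal (g x powr q) \<partial>M)"
    by (rule nn_integral_cmult) simp
  finally have "(\<Sum>Q\<in>F. ennreal (?a Q powr q) * emeasure M Q) \<le> ennreal (2 powr q) * K *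
      (ennreal (2 powr q / (1 - 2 powr (1 - q))) * (\<integral>\<^sup>+x. ennreal (g x powr q) \<partial>M))"
    using to_principal by (meson mult_left_mono order_trans zero_le)
  also have "\<dots> = ennreal (2 powr q * (2 powr q / (1 - 2 powr (1 - q)))) * K
      * (\<integral>\<^sup>+x. ennreal (g x powr q) \<partial>M)"
    using c by (subst ennreal_mult) (auto simp: mult_ac)
  also have "2 powr q * (2 powr q / (1 - 2 powr (1 - q))) = 2 powr (2 * q) / (1 - 2 powr (1 - q))"
    by (simp flip: powr_add)
  finally show ?thesis .
qed

section \<open>Real powers of extended nonnegative reals\<close>

lemma epowr_ennreal: "0 < x \<Longrightarrow> ennreal x epowr a = ennreal (x powr a)"
  by (simp add: epowr_def ennreal_eq_0_iff)

lemma epowr_ennreal_pos: "0 \<le> x \<Longrightarrow> 0 < a \<Longrightarrow> ennreal x epowr a = ennreal (x powr a)"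
  by (cases "x = 0") (auto simp: epowr_def ennreal_eq_0_iff)

lemma epowr_0 [simp]: "0 < a \<Longrightarrow> 0 epowr a = 0"
  by (simp add: epowr_def)

lemma epowr_top [simp]: "0 < a \<Longrightarrow> top epowr a = top"
  by (simp add: epowr_def)

lemma epowr_1 [simp]: "1 epowr a = 1"
  by (simp add: epowr_def)

lemma epowr_eq_0_iff: "0 < a \<Longrightarrow> x epowr a = 0 \<longleftrightarrow> x = 0"
  by (auto simp: epowr_def ennreal_eq_0_iff enn2real_eq_0_iff not_le)

lemma epowr_one_right [simp]: "x epowr 1 = x"
  by (cases x) (auto simp: epowr_def ennreal_eq_0_iff)

lemma ennreal_0_top_pos_cases [case_names zero top pos]:
  fixes x :: ennreal
  assumes "x = 0 \<Longrightarrow> P" and "x = top \<Longrightarrow> P" and "\<And>r. 0 < r \<Longrightarrow> x = ennreal r \<Longrightarrow> P"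
  shows P
proof (cases x)
  case (real r)
  then show P using assms by (cases "r = 0") auto
qed (use assms in auto)

text \<open>The conventions at \<open>0\<close> and \<open>\<infinity>\<close> make this law hold for all real exponents. It is what allows
the dual weight of a dual weight to be computed pointwise, with no exceptional null set.\<close>

lemma epowr_epowr: "(x epowr a) epowr b = x epowr (a * b)"
proof (cases x rule: ennreal_0_top_pos_cases)
  case (pos r)
  then show ?thesis
    by (simp add: epowr_ennreal powr_powr)
qed (auto simp: epowr_def zero_less_mult_iff mult_less_0_iff not_less)

lemma epowr_mult:
  assumes "0 \<le> a"
  shows "(x * y) epowr a = x epowr a * y epowr a"
proof (cases "a = 0")
  case True
  then show ?thesis by (simp add: epowr_def)
next
  case False
  then have a: "0 < a" using assms by simp
  show ?thesis
  proof (cases x rule: ennreal_0_top_pos_cases)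
    case top
    then show ?thesis
      using a by (cases "y = 0") (auto simp: ennreal_top_mult epowr_eq_0_iff)
  next
    case (pos r)
    note x = this
    show ?thesis
    proof (cases y rule: ennreal_0_top_pos_cases)
      case top
      then show ?thesis
        using a x by (auto simp: ennreal_mult_top epowr_eq_0_iff)
    next
      case (pos s)
      then show ?thesis
        using x by (simp add: epowr_ennreal powr_mult flip: ennreal_mult)
    qed (use a in auto)
  qed (use a in auto)
qed

lemma epowr_prod:
  "0 \<le> a \<Longrightarrow> (\<Prod>i\<in>I. x i) epowr a = (\<Prod>i\<in>I. x i epowr a)"
  by (induction I rule: infinite_finite_induct) (auto simp: epowr_mult)

lemma epowr_add: "0 \<le> a \<Longrightarrow> 0 \<le> b \<Longrightarrow> x epowr (a + b) = x epowr a * x epowr b"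
proof (cases x rule: ennreal_0_top_pos_cases)
  case (pos r)
  then show ?thesis
    by (simp add: epowr_ennreal powr_add flip: ennreal_mult)
qed (auto simp: epowr_def ennreal_top_mult)

lemma epowr_sum:
  "finite I \<Longrightarrow> (\<And>i. i \<in> I \<Longrightarrow> 0 \<le> a i) \<Longrightarrow> x epowr (\<Sum>i\<in>I. a i) = (\<Prod>i\<in>I. x epowr a i)"
  by (induction I rule: finite_induct) (auto simp: epowr_add sum_nonneg epowr_def[of _ 0])

lemma epowr_mono:
  assumes "0 \<le> a" and "x \<le> y"
  shows "x epowr a \<le> y epowr a"
proof (cases "a = 0")
  case True
  then show ?thesis by (simp add: epowr_def)
next
  case False
  then have a: "0 < a" using assms by simp
  show ?thesis
  proof (cases x rule: ennreal_0_top_pos_cases)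
    case top
    then show ?thesis using assms a by (simp add: top_unique)
  next
    case (pos r)
    note x = this
    show ?thesis
    proof (cases y rule: ennreal_0_top_pos_cases)
      case (pos s)
      then show ?thesis
        using x assms by (auto simp: epowr_ennreal intro!: ennreal_leI powr_mono2)
    qed (use a x assms in auto)
  qed (use a in auto)
qed

lemma epowr_mono_neg:
  assumes "a \<le> 0" and "x \<le> y"
  shows "y epowr a \<le> x epowr a"
proof (cases "a = 0")
  case True
  then show ?thesis by (simp add: epowr_def)
next
  case False
  then have a: "a < 0" using assms by simp
  show ?thesis
  proof (cases x rule: ennreal_0_top_pos_cases)
    case top
    then show ?thesis using assms a by (simp add: top_unique)
  next
    case zero
    then show ?thesis using a by (simp add: epowr_def)
  next
    case (pos r)
    note x = this
    show ?thesis
    proof (cases y rule: ennreal_0_top_pos_cases)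
      case (pos s)
      then show ?thesis
        using x assms by (auto simp: epowr_ennreal intro!: ennreal_leI powr_mono2')
    next
      case top
      then show ?thesis using a by (simp add: epowr_def)
    qed (use a x assms in auto)
  qed
qed

text \<open>Only an inequality, because \<open>0 * \<infinity> = 0\<close>.\<close>

lemma epowr_minus_mult_le_1: "x epowr (- a) * x epowr a \<le> 1"
proof (cases x rule: ennreal_0_top_pos_cases)
  case (pos r)
  then show ?thesis by (simp add: epowr_ennreal flip: ennreal_mult powr_add)
qed (auto simp: epowr_def)

text \<open>Raising to a positive power is an order isomorphism with inverse the power \<open>1 / p\<close>.\<close>

lemma epowr_SUP:
  assumes "0 < p"
  shows "(SUP i\<in>I. f i) epowr p = (SUP i\<in>I. f i epowr p)"
proof (rule antisym)
  have "(SUP i\<in>I. f i) \<le> (SUP i\<in>I. f i epowr p) epowr (1 / p)"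
  proof (rule SUP_least)
    fix i assume "i \<in> I"
    have "f i = (f i epowr p) epowr (1 / p)"
      using assms by (simp add: epowr_epowr)
    also have "\<dots> \<le> (SUP i\<in>I. f i epowr p) epowr (1 / p)"
      using assms \<open>i \<in> I\<close> by (intro epowr_mono SUP_upper) auto
    finally show "f i \<le> \<dots>" .
  qed
  then have "(SUP i\<in>I. f i) epowr p \<le> ((SUP i\<in>I. f i epowr p) epowr (1 / p)) epowr p"
    using assms by (intro epowr_mono) auto
  then show "(SUP i\<in>I. f i) epowr p \<le> (SUP i\<in>I. f i epowr p)"
    using assms by (simp add: epowr_epowr)
  show "(SUP i\<in>I. f i epowr p) \<le> (SUP i\<in>I. f i) epowr p"
    using assms by (intro SUP_least epowr_mono SUP_upper) auto
qed

lemma measurable_epowr [measurable]: "(\<lambda>x. x epowr a) \<in> borel_measurable borel"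
  unfolding epowr_def by measurable

section \<open>Cubes and shifted dyadic grids\<close>

lemma cbox_cube: "cbox (a :: real^'n) (\<chi> i. a $ i + h) = {x. \<forall>i. a $ i \<le> x $ i \<and> x $ i \<le> a $ i + h}"
  by (auto simp: mem_box_cart)

lemma emeasure_cbox_cube:
  fixes a :: "real^'n"
  assumes "0 \<le> h"
  shows "emeasure lebesgue (cbox a (\<chi> i. a $ i + h)) = ennreal (h ^ CARD('n))"
proof -
  have "cbox a (\<chi> i. a $ i + h) \<noteq> {}"
    using assms by (simp add: interval_ne_empty_cart)
  then show ?thesis
    by (simp add: emeasure_lborel_cbox_eq content_cbox_cart emeasure_eq_ennreal_measure
        flip: measure_lborel_cbox_eq)
qed

text \<open>Cubes up to null sets. Dyadic cubes have to be half-open in order to be disjoint, whereas the members of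
\<open>cubes\<close> are closed; averages do not see the difference.\<close>

definition cell :: "(real^'n) set \<Rightarrow> bool" where
  "cell Q \<longleftrightarrow> Q \<in> sets lebesgue \<and>
    (\<exists>R\<in>cubes. Q \<subseteq> R \<and> emeasure lebesgue (R - Q) = 0)"

text \<open>At scale \<open>2 powi k\<close> the shifted grid is translated by one third of the side length, with a sign alternating
in \<open>k\<close>. Since \<open>1/3 = 2 * (- 1/3) + 1\<close>, the alternation is what keeps the grids of consecutive scales nested.
The Boolean chooses between the standard and the shifted grid, separately in each coordinate.\<close>

definition grid_shift :: "bool \<Rightarrow> int \<Rightarrow> real" where
  "grid_shift b k = (if b then if even k then 1/3 else - 1/3 else 0)"

definition grid_index :: "('n \<Rightarrow> bool) \<Rightarrow> int \<Rightarrow> real^'n \<Rightarrow> 'n \<Rightarrow> int" where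
  "grid_index \<alpha> k x i = \<lfloor>x $ i / 2 powi k - grid_shift (\<alpha> i) k\<rfloor>"

text \<open>The cells are the level sets of \<open>grid_index\<close>; cells of equal size are thus disjoint by definition, and nestedness
becomes the statement that the index at a scale determines the index at every coarser scale.\<close>

definition grid :: "('n \<Rightarrow> bool) \<Rightarrow> (real^'n) set set" where
  "grid \<alpha> = {{x. grid_index \<alpha> k x = j} | k j. True} "

lemma grid_index_Suc:
  "grid_index \<alpha> (k + 1) x i = (grid_index \<alpha> k x i + (if \<alpha> i then if even k then 1 else - 1 else 0)) div 2"
proof -
  define e :: int where "e = (if \<alpha> i then if even k then 1 else - 1 else 0)"
  have shift: "grid_shift (\<alpha> i) (k + 1) = - grid_shift (\<alpha> i) k" "of_int e = 3 * grid_shift (\<alpha> i) k"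
    by (auto simp: grid_shift_def e_def)
  have "(2::real) powi (k + 1) = 2 powi k * 2"
    by (rule power_int_add_1) simp
  then have half: "x $ i / 2 powi (k + 1) = (x $ i / 2 powi k) / 2"
    by (simp only: divide_divide_eq_left)
  have *: "x $ i / 2 powi (k + 1) - grid_shift (\<alpha> i) (k + 1)
      = ((x $ i / 2 powi k - grid_shift (\<alpha> i) k) + of_int e) / of_int 2"
    unfolding half shift by (simp add: field_simps)
  show ?thesis
    unfolding grid_index_def * e_def[symmetric]
    using floor_divide_real_eq_div[of 2 "x $ i / 2 powi k - grid_shift (\<alpha> i) k + of_int e"] by simp
qed

lemma grid_index_coarser:
  assumes "grid_index \<alpha> k x = grid_index \<alpha> k y" and "k \<le> l"
  shows "grid_index \<alpha> l x = grid_index \<alpha> l y"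
  using assms(2)
proof (induction l rule: int_ge_induct)
  case base
  show ?case by (rule assms(1))
next
  case (step l)
  then show ?case by (auto simp: grid_index_Suc fun_eq_iff)
qed

text \<open>Two cells with a common point share all coarser indices, so the finer cell lies in the coarser one.\<close>

lemma laminar_grid: "laminar (grid \<alpha>)"
proof -
  have *: "{x. grid_index \<alpha> k x = j} \<subseteq> {x. grid_index \<alpha> l x = i}"
    if "k \<le> l" "grid_index \<alpha> k z = j" "grid_index \<alpha> l z = i" for k l j i z
  proof (rule subsetI, unfold mem_Collect_eq)
    fix x assume "grid_index \<alpha> k x = j"
    then show "grid_index \<alpha> l x = i"
      using grid_index_coarser[of \<alpha> k x z l] that by simp
  qed
  show ?thesis
    unfolding laminar_def
  proof (intro ballI)
    fix Q R assume "Q \<in> grid \<alpha>" "R \<in> grid \<alpha>"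
    then obtain k j l i where Q: "Q = {x. grid_index \<alpha> k x = j}" and R: "R = {x. grid_index \<alpha> l x = i}"
      by (auto simp: grid_def)
    show "Q \<subseteq> R \<or> R \<subseteq> Q \<or> Q \<inter> R = {}"
    proof (cases "Q \<inter> R = {}")
      case False
      then obtain z where z: "grid_index \<alpha> k z = j" "grid_index \<alpha> l z = i"
        unfolding Q R by auto
      have "k \<le> l \<or> l \<le> k" by linarith
      then show ?thesis
        unfolding Q R using *[OF _ z] *[OF _ z(2) z(1)] by meson
    qed simp
  qed
qed

lemma countable_grid: "countable (grid \<alpha> :: (real^'n) set set)"
proof -
  have "grid \<alpha> = (\<lambda>(k, j). {x. grid_index \<alpha> k x = j}) ` (UNIV :: (int \<times> ('n \<Rightarrow> int)) set)"
    by (auto simp: grid_def)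
  then show ?thesis
    by (metis countable_image uncountable_def countableI_type)
qed

lemma grid_index_vimage_eq:
  fixes \<alpha> :: "'n::finite \<Rightarrow> bool" and j :: "'n \<Rightarrow> int" and k :: int
  defines "c \<equiv> (\<chi> i. 2 powi k * (j i + grid_shift (\<alpha> i) k)) :: real^'n"
  shows "{x. grid_index \<alpha> k x = j} = {x. \<forall>i. c $ i \<le> x $ i \<and> x $ i < c $ i + 2 powi k}"
proof -
  have "\<lfloor>y / s - t\<rfloor> = l \<longleftrightarrow> s * (l + t) \<le> y \<and> y < s * (l + t) + s" if "s > 0" for y s t :: real and l
    using that by (auto simp: floor_eq_iff field_simps)
  then show ?thesis
    by (simp add: grid_index_def fun_eq_iff c_def)
qed

lemma cell_grid:
  fixes Q :: "(real^'n) set"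
  assumes "Q \<in> grid \<alpha>"
  shows "cell Q"
proof -
  obtain k j where Q: "Q = {x. grid_index \<alpha> k x = j}"
    using assms by (auto simp: grid_def)
  define h :: real where "h = 2 powi k"
  define a :: "real^'n" where "a = (\<chi> i. h * (j i + grid_shift (\<alpha> i) k))"
  have h: "h > 0" by (simp add: h_def)
  have Q': "Q = {x. \<forall>i. a $ i \<le> x $ i \<and> x $ i < a $ i + h}"
    unfolding Q grid_index_vimage_eq a_def h_def ..
  let ?R = "cbox a (\<chi> i. a $ i + h)"
  have sub: "box a (\<chi> i. a $ i + h) \<subseteq> Q" "Q \<subseteq> ?R"
    unfolding Q' by (auto simp: mem_box_cart less_imp_le)
  have null: "negligible (?R - box a (\<chi> i. a $ i + h))"
    using negligible_frontier_interval by blast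
  have "negligible (?R - Q)"
    using sub(1) by (intro negligible_subset[OF null]) auto
  then have z: "?R - Q \<in> null_sets lebesgue"
    by (simp add: negligible_iff_null_sets)
  have "Q = ?R - (?R - Q)" using sub(2) by auto
  then have "Q \<in> sets lebesgue"
    using z by (metis null_setsD2 sets.Diff lmeasurable_cbox fmeasurableD)
  moreover have "?R \<in> cubes"
    using h by (auto simp: cubes_def)
  ultimately show ?thesis
    unfolding cell_def using sub(2) z by (intro conjI bexI[of _ ?R]) auto
qed

text \<open>If both grids separated \<open>s\<close> from \<open>t\<close>, then the half-open interval from \<open>s\<close> to \<open>t\<close> would contain a point of \<open>\<int>\<close> and a
point of \<open>\<int> + 1/3\<close> or \<open>\<int> - 1/3\<close>. These are at least one third apart, which is too much for a half-open interval
of length at most one third.\<close>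

lemma one_third_trick:
  fixes s t :: real
  assumes "s \<le> t" and "t \<le> s + 1/3"
  shows "\<exists>b. \<lfloor>s - grid_shift b k\<rfloor> = \<lfloor>t - grid_shift b k\<rfloor>"
proof (rule ccontr)
  assume neg: "\<not> ?thesis"
  have "\<lfloor>s - grid_shift b k\<rfloor> < \<lfloor>t - grid_shift b k\<rfloor>" for b
    using neg assms(1) floor_mono[of "s - grid_shift b k" "t - grid_shift b k"]
    by (metis diff_right_mono order_le_less)
  from this[of False] this[of True]
  have "\<lfloor>s\<rfloor> < \<lfloor>t\<rfloor>" "\<lfloor>s - grid_shift True k\<rfloor> < \<lfloor>t - grid_shift True k\<rfloor>"
    by (simp_all add: grid_shift_def)
  define e d where "e = \<lfloor>t\<rfloor>" and "d = \<lfloor>t - grid_shift True k\<rfloor>"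
  have "s < e" "e \<le> t" "s - grid_shift True k < d" "d \<le> t - grid_shift True k"
    using \<open>\<lfloor>s\<rfloor> < \<lfloor>t\<rfloor>\<close> \<open>\<lfloor>s - grid_shift True k\<rfloor> < \<lfloor>t - grid_shift True k\<rfloor>\<close>
    unfolding e_def d_def by (simp_all add: floor_less_iff)
  then have "\<bar>real_of_int (e - d) - grid_shift True k\<bar> < 1/3"
    using assms by linarith
  moreover have "grid_shift True k = 1/3 \<or> grid_shift True k = - 1/3"
    by (simp add: grid_shift_def)
  moreover have "\<bar>3 * X - 1\<bar> < 1" if "\<bar>X - 1/3\<bar> < 1/3" for X :: real
    using that unfolding abs_less_iff by linarith
  moreover have "\<bar>3 * X + 1\<bar> < 1" if "\<bar>X - - 1/3\<bar> < 1/3" for X :: real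
    using that unfolding abs_less_iff by linarith
  ultimately have "\<bar>3 * real_of_int (e - d) - 1\<bar> < 1 \<or> \<bar>3 * real_of_int (e - d) + 1\<bar> < 1"
    by metis
  then have "\<bar>3 * (e - d) - 1\<bar> < 1 \<or> \<bar>3 * (e - d) + 1\<bar> < 1"
    by linarith
  then show False
    by presburger
qed

text \<open>Choose the scale between \<open>3 h\<close> and \<open>6 h\<close> and, in each coordinate, a grid that does not separate the
two faces of the cube.\<close>

lemma cube_subset_grid:
  fixes Q :: "(real^'n) set"
  assumes "Q \<in> cubes"
  obtains \<alpha> R where "R \<in> grid \<alpha>" and "Q \<subseteq> R"
    and "emeasure lebesgue R \<le> 6 ^ CARD('n) * emeasure lebesgue Q"
proof -
  obtain a h where Q: "Q = cbox a (\<chi> i. a $ i + h)" and h: "0 < h"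
    using assms by (auto simp: cubes_def)
  define k where "k = \<lceil>log 2 (3 * h)\<rceil>"
  define s :: real where "s = 2 powi k"
  have s: "s > 0" "s = 2 powr k"
    by (simp_all add: s_def powr_real_of_int')
  have "log 2 (3 * h) \<le> k" "k < log 2 (3 * h) + 1"
    unfolding k_def by linarith+
  then have hs: "3 * h \<le> s" "s < 6 * h"
  proof -
    show "3 * h \<le> s"
      using \<open>log 2 (3 * h) \<le> k\<close> h s(2) by (simp add: log_le_iff)
    have "2 powr (k - 1) < 3 * h"
      using \<open>k < log 2 (3 * h) + 1\<close> h by (subst less_log_iff[symmetric]) auto
    then show "s < 6 * h"
      using s(2) by (simp add: powr_diff)
  qed
  have "\<exists>b. \<lfloor>a $ i / s - grid_shift b k\<rfloor> = \<lfloor>(a $ i + h) / s - grid_shift b k\<rfloor>" for i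
    using s hs h by (intro one_third_trick) (auto simp: field_simps)
  then obtain \<alpha> where \<alpha>: "\<And>i. \<lfloor>a $ i / s - grid_shift (\<alpha> i) k\<rfloor> = \<lfloor>(a $ i + h) / s - grid_shift (\<alpha> i) k\<rfloor>"
    by metis
  let ?R = "{x. grid_index \<alpha> k x = grid_index \<alpha> k a}"
  have R: "?R \<in> grid \<alpha>"
    by (auto simp: grid_def)
  have "Q \<subseteq> ?R"
  proof
    fix x assume x: "x \<in> Q"
    have "grid_index \<alpha> k x i = grid_index \<alpha> k a i" for i
    proof (rule antisym)
      have "a $ i \<le> x $ i" "x $ i \<le> a $ i + h"
        using x unfolding Q cbox_cube by auto
      then have "a $ i / s \<le> x $ i / s" "x $ i / s \<le> (a $ i + h) / s"
        using s(1) by (auto simp: divide_right_mono)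
      then have "\<lfloor>a $ i / s - grid_shift (\<alpha> i) k\<rfloor> \<le> \<lfloor>x $ i / s - grid_shift (\<alpha> i) k\<rfloor>"
        "\<lfloor>x $ i / s - grid_shift (\<alpha> i) k\<rfloor> \<le> \<lfloor>(a $ i + h) / s - grid_shift (\<alpha> i) k\<rfloor>"
        by (auto intro: floor_mono)
      then show "grid_index \<alpha> k a i \<le> grid_index \<alpha> k x i" "grid_index \<alpha> k x i \<le> grid_index \<alpha> k a i"
        using \<alpha>[of i] unfolding grid_index_def s_def[symmetric] by auto
    qed
    then show "x \<in> ?R" by auto
  qed
  moreover have "emeasure lebesgue ?R \<le> 6 ^ CARD('n) * emeasure lebesgue Q"
  proof -
    define c where "c = (\<chi> i. s * (grid_index \<alpha> k a i + grid_shift (\<alpha> i) k))"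
    have "?R \<subseteq> cbox c (\<chi> i. c $ i + s)"
      unfolding cbox_cube grid_index_vimage_eq s_def c_def by (auto intro: less_imp_le)
    then have "emeasure lebesgue ?R \<le> ennreal (s ^ CARD('n))"
      using emeasure_mono[of ?R "cbox c (\<chi> i. c $ i + s)" lebesgue] emeasure_cbox_cube[of s c] s(1)
      by (simp add: less_imp_le)
    also have "\<dots> \<le> ennreal ((6 * h) ^ CARD('n))"
      using hs s by (intro ennreal_leI power_mono) auto
    also have "\<dots> = 6 ^ CARD('n) * emeasure lebesgue Q"
      using h unfolding Q emeasure_cbox_cube[OF less_imp_le[OF h]]
      by (simp add: power_mult_distrib ennreal_mult flip: ennreal_power)
    finally show ?thesis .
  qed
  ultimately show thesis
    using R that by simp
qed

section \<open>Averages over cubes and packing under sparseness\<close>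

lemma cube_measurable: "Q \<in> cubes \<Longrightarrow> Q \<in> sets lebesgue"
  by (auto simp: cubes_def)

lemma cube_emeasure_pos: "Q \<in> cubes \<Longrightarrow> 0 < emeasure lebesgue Q"
  by (auto simp: cubes_def emeasure_cbox_cube less_imp_le simp del: emeasure_completion)

lemma cube_emeasure_finite: "Q \<in> cubes \<Longrightarrow> emeasure lebesgue Q < \<infinity>"
  by (auto simp: cubes_def emeasure_cbox_cube less_imp_le simp del: emeasure_completion)

lemma cellE:
  assumes "cell Q"
  obtains R where "R \<in> cubes" and "Q \<subseteq> R" and "emeasure lebesgue Q = emeasure lebesgue R"
    and "\<And>g. (\<integral>\<^sup>+x\<in>Q. g x \<partial>lebesgue) = (\<integral>\<^sup>+x\<in>R. g x \<partial>lebesgue)"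
    and "\<And>g. average Q g = average R g"
proof -
  obtain R where R: "R \<in> cubes" "Q \<subseteq> R" "emeasure lebesgue (R - Q) = 0" and Q: "Q \<in> sets lebesgue"
    using assms unfolding cell_def by auto
  have null: "R - Q \<in> null_sets lebesgue"
    using R Q by (auto simp: null_sets_def cube_measurable)
  have "emeasure lebesgue R = emeasure lebesgue (Q \<union> (R - Q))"
    using R(2) by (simp add: Un_absorb1)
  also have "\<dots> = emeasure lebesgue Q"
    using Q null by (rule emeasure_Un_null_set)
  finally have e: "emeasure lebesgue Q = emeasure lebesgue R" by simp
  have i: "(\<integral>\<^sup>+x\<in>Q. g x \<partial>lebesgue) = (\<integral>\<^sup>+x\<in>R. g x \<partial>lebesgue)" for g
    using AE_not_in[OF null]
    by (intro nn_integral_cong_AE) (use R(2) in \<open>auto simp: indicator_def elim!: eventually_mono\<close>)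
  show thesis
    using that[OF R(1,2) e i] e i by (simp add: average_def)
qed

lemma cell_measurable: "cell Q \<Longrightarrow> Q \<in> sets lebesgue"
  by (simp add: cell_def)

lemma cell_emeasure_pos: "cell Q \<Longrightarrow> 0 < emeasure lebesgue Q"
  by (metis cellE cube_emeasure_pos)

lemma cell_emeasure_finite: "cell Q \<Longrightarrow> emeasure lebesgue Q < \<infinity>"
  by (metis cellE cube_emeasure_finite)

lemma average_times_emeasure:
  "0 < emeasure lebesgue Q \<Longrightarrow> emeasure lebesgue Q < \<infinity> \<Longrightarrow>
    average Q g * emeasure lebesgue Q = (\<integral>\<^sup>+x\<in>Q. g x \<partial>lebesgue)"
  unfolding average_def by (simp add: ennreal_divide_times)

lemma divide_le_ennreal_of_le_mult:
  fixes a b c :: ennreal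
  assumes "a \<le> c * b"
  shows "a / b \<le> c"
proof (cases "b = 0 \<or> b = top")
  case True
  then show ?thesis using assms by auto
next
  case False
  have "a / b \<le> c * b / b"
    using assms by (rule divide_right_mono_ennreal)
  also have "\<dots> = c"
    using False by (intro mult_divide_eq_ennreal) auto
  finally show ?thesis .
qed

lemma average_eq_mean:
  assumes "0 < emeasure lebesgue Q" and "emeasure lebesgue Q < \<infinity>" and "(\<integral>\<^sup>+x\<in>Q. g x \<partial>lebesgue) < \<infinity>"
  shows "average Q g = ennreal (mean lebesgue Q g)"
proof -
  have "average Q g = ennreal (mean lebesgue Q g) * emeasure lebesgue Q / emeasure lebesgue Q"
    using mean_times_emeasure[OF assms] by (simp add: average_def del: emeasure_completion)
  also have "\<dots> = ennreal (mean lebesgue Q g)"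
    using assms by (intro mult_divide_eq_ennreal) auto
  finally show ?thesis .
qed

lemma average_le_of_subset:
  assumes "Q \<subseteq> R" and "emeasure lebesgue R \<le> ennreal c * emeasure lebesgue Q" and "0 < c"
    and "0 < emeasure lebesgue Q" and "emeasure lebesgue Q < \<infinity>" and "R \<in> sets lebesgue"
  shows "average Q g \<le> ennreal c * average R g"
proof -
  have R: "0 < emeasure lebesgue R" "emeasure lebesgue R < \<infinity>"
  proof -
    have "emeasure lebesgue Q \<le> emeasure lebesgue R"
      using assms by (intro emeasure_mono) auto
    then show "0 < emeasure lebesgue R" using assms(4) by auto
    show "emeasure lebesgue R < \<infinity>"
      using assms(2,5) by (auto simp: ennreal_mult_less_top intro: le_less_trans)
  qed
  have "(\<integral>\<^sup>+x\<in>Q. g x \<partial>lebesgue) \<le> (\<integral>\<^sup>+x\<in>R. g x \<partial>lebesgue)"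
    using assms(1) by (intro nn_integral_mono) (auto simp: indicator_def)
  also have "\<dots> = average R g * emeasure lebesgue R"
    using R by (simp add: average_times_emeasure)
  also have "\<dots> \<le> average R g * (ennreal c * emeasure lebesgue Q)"
    using assms(2) by (rule mult_left_mono) simp
  finally have "average Q g \<le> (ennreal c * average R g * emeasure lebesgue Q) / emeasure lebesgue Q"
    unfolding average_def[of Q] by (intro divide_right_mono_ennreal) (simp add: mult_ac)
  then show ?thesis
    using assms(4,5) by (subst (asm) mult_divide_eq_ennreal) auto
qed

lemma average_le_const:
  assumes "Q \<in> cubes" and "\<And>x. x \<in> Q \<Longrightarrow> g x \<le> c"
  shows "average Q g \<le> c"
  unfolding average_def
proof (rule divide_le_ennreal_of_le_mult)
  have "(\<integral>\<^sup>+x\<in>Q. g x \<partial>lebesgue) \<le> (\<integral>\<^sup>+x\<in>Q. c \<partial>lebesgue)"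
    using assms(2) by (intro nn_integral_mono) (auto simp: indicator_def)
  also have "\<dots> = c * emeasure lebesgue Q"
    using cube_measurable[OF assms(1)] by (intro nn_integral_cmult_indicator)
  finally show "(\<integral>\<^sup>+x\<in>Q. g x \<partial>lebesgue) \<le> c * emeasure lebesgue Q" .
qed

lemma average_cmult:
  assumes "g \<in> borel_measurable lebesgue" and "Q \<in> sets lebesgue"
  shows "average Q (\<lambda>x. c * g x) = c * average Q g"
proof -
  have [measurable]: "g \<in> borel_measurable lebesgue" "Q \<in> sets lebesgue" by fact+
  have "(\<integral>\<^sup>+x\<in>Q. c * g x \<partial>lebesgue) = (\<integral>\<^sup>+x. c * (g x * indicator Q x) \<partial>lebesgue)"
    by (simp only: mult.assoc)
  also have "\<dots> = c * (\<integral>\<^sup>+x\<in>Q. g x \<partial>lebesgue)"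
    by (rule nn_integral_cmult) measurable
  finally show ?thesis
    unfolding average_def by (simp only: ennreal_times_divide)
qed

lemma weight_measurable [measurable_dest]: "weight w \<Longrightarrow> w \<in> borel_measurable lebesgue"
  by (simp add: weight_def)

lemma weight_integral_pos:
  assumes w: "weight w" and Q: "Q \<in> sets lebesgue" "0 < emeasure lebesgue Q"
  shows "0 < (\<integral>\<^sup>+x\<in>Q. w x \<partial>lebesgue)"
proof (rule ccontr)
  have [measurable]: "w \<in> borel_measurable lebesgue" "Q \<in> sets lebesgue"
    using w Q by (auto simp: weight_def)
  assume "\<not> ?thesis"
  then have "(\<integral>\<^sup>+x\<in>Q. w x \<partial>lebesgue) = 0"
    by (simp add: not_less)
  then have "AE x in lebesgue. w x * indicator Q x = 0"
    by (subst (asm) nn_integral_0_iff_AE) auto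
  moreover have "AE x in lebesgue. 0 < w x \<and> w x < \<infinity>"
    using w by (simp add: weight_def)
  ultimately have "AE x in lebesgue. x \<notin> Q"
    by eventually_elim (auto simp: indicator_def split: if_splits)
  then have "Q \<in> null_sets lebesgue"
    using Q AE_iff_null_sets by blast
  then show False
    using Q by auto
qed

lemma average_pos: "weight u \<Longrightarrow> Q \<in> cubes \<Longrightarrow> 0 < average Q u"
  unfolding average_def using cube_emeasure_finite[of Q]
  by (simp add: ennreal_zero_less_divide weight_integral_pos cube_measurable cube_emeasure_pos less_top
      del: emeasure_completion)

lemma weight_epowr: "weight w \<Longrightarrow> weight (\<lambda>x. w x epowr a)"
proof -
  assume w: "weight w"
  have "0 < y epowr a \<and> y epowr a < \<infinity>" if y: "0 < y \<and> y < \<infinity>" for y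
  proof (cases y rule: ennreal_0_top_pos_cases)
    case (pos r)
    then show ?thesis by (simp add: epowr_ennreal)
  qed (use y in auto)
  moreover have "AE x in lebesgue. 0 < w x \<and> w x < \<infinity>"
    using w by (simp only: weight_def)
  ultimately have "AE x in lebesgue. 0 < w x epowr a \<and> w x epowr a < \<infinity>"
    by (elim eventually_mono) blast
  moreover have "(\<lambda>x. w x epowr a) \<in> borel_measurable lebesgue"
    using measurable_compose[OF weight_measurable[OF w] measurable_epowr] .
  ultimately show ?thesis
    unfolding weight_def by simp
qed

lemma weight_prod:
  assumes "\<And>i. i \<in> I \<Longrightarrow> weight (u i)"
  shows "weight (\<lambda>x. \<Prod>i\<in>I. u i x)"
proof (cases "finite I")
  case True
  have "AE x in lebesgue. \<forall>i\<in>I. 0 < u i x \<and> u i x < \<infinity>"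
    using assms True by (intro AE_finite_allI) (auto simp: weight_def)
  then have "AE x in lebesgue. 0 < (\<Prod>i\<in>I. u i x) \<and> (\<Prod>i\<in>I. u i x) < \<infinity>"
  proof eventually_elim
    case (elim x)
    then have "(\<Prod>i\<in>I. u i x) \<noteq> top"
      using True by (simp add: ennreal_prod_eq_top) (metis less_irrefl)
    moreover have "(\<Prod>i\<in>I. u i x) \<noteq> 0"
      using True elim by (simp add: prod_zero_iff) (metis less_irrefl)
    ultimately show ?case
      by (simp add: less_top zero_less_iff_neq_zero)
  qed
  then show ?thesis
    using assms unfolding weight_def by (auto intro!: borel_measurable_prod_ennreal)
qed (simp add: weight_def)

lemma weight_sigma: "weight w \<Longrightarrow> weight (sigma_weight q w)"
  using weight_epowr[of w "1 - conj_exponent q"] unfolding sigma_weight_def[abs_def] .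

lemma weight_nu: "(\<And>i. i \<in> {1..m} \<Longrightarrow> weight (w i)) \<Longrightarrow> weight (nu_weight m p P w)"
  unfolding nu_weight_def[abs_def] by (intro weight_prod weight_epowr) auto

lemma nn_integral_HL_maximal_le:
  assumes "R \<in> cubes" and "0 < (\<integral>\<^sup>+x\<in>R. s x \<partial>lebesgue)" and "(\<integral>\<^sup>+x\<in>R. s x \<partial>lebesgue) < \<infinity>"
  shows "(\<integral>\<^sup>+x\<in>R. HL_maximal (\<lambda>y. s y * indicator R y) x \<partial>lebesgue)
    \<le> A_inf_const s * (\<integral>\<^sup>+x\<in>R. s x \<partial>lebesgue)"
proof -
  let ?H = "\<integral>\<^sup>+x\<in>R. HL_maximal (\<lambda>y. s y * indicator R y) x \<partial>lebesgue"
  let ?s = "\<integral>\<^sup>+x\<in>R. s x \<partial>lebesgue"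
  have "?H = ?H / ?s * ?s"
    using assms(2,3) by (simp add: ennreal_divide_times)
  also have "\<dots> \<le> A_inf_const s * ?s"
    unfolding A_inf_const_def using assms(1) by (intro mult_right_mono SUP_upper) auto
  finally show ?thesis .
qed

lemma one_le_A_inf_const:
  assumes "R \<in> cubes" and "0 < (\<integral>\<^sup>+x\<in>R. s x \<partial>lebesgue)" and "(\<integral>\<^sup>+x\<in>R. s x \<partial>lebesgue) < \<infinity>"
  shows "1 \<le> A_inf_const s"
proof -
  let ?H = "\<integral>\<^sup>+x\<in>R. HL_maximal (\<lambda>y. s y * indicator R y) x \<partial>lebesgue"
  let ?s = "\<integral>\<^sup>+x\<in>R. s x \<partial>lebesgue"
  have R: "0 < emeasure lebesgue R" "emeasure lebesgue R < \<infinity>" "R \<in> sets lebesgue"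
    using assms(1) cube_emeasure_pos cube_emeasure_finite cube_measurable by auto
  have "?s = average R s * emeasure lebesgue R"
    using R by (intro average_times_emeasure[symmetric]) auto
  also have "\<dots> = (\<integral>\<^sup>+x\<in>R. average R s \<partial>lebesgue)"
    using R(3) by (simp add: nn_integral_cmult_indicator del: emeasure_completion)
  also have "\<dots> \<le> ?H"
  proof (intro nn_integral_mono)
    fix x
    have "average R s \<le> HL_maximal (\<lambda>y. s y * indicator R y) x" if "x \<in> R"
      unfolding HL_maximal_def using assms(1) that
      by (intro SUP_upper2[of R]) (auto simp: average_def mult.assoc simp flip: indicator_inter_arith)
    then show "average R s * indicator R x \<le> HL_maximal (\<lambda>y. s y * indicator R y) x * indicator R x"
      by (auto simp: indicator_def)
  qed
  finally have "?s / ?s \<le> ?H / ?s"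
    by (rule divide_right_mono_ennreal)
  also have "?s / ?s = 1"
    using assms by simp
  also have "?H / ?s \<le> A_inf_const s"
    unfolding A_inf_const_def using assms(1) by (intro SUP_upper) auto
  finally show ?thesis .
qed

text \<open>This is where the \<open>A_inf\<close> constant enters. Each \<open>Q\<close> carries a part \<open>E Q\<close> of at least half its measure that
avoids all smaller members; these parts are disjoint. Therefore \<open>s(Q)\<close>, which is the average of \<open>s\<close> times \<open>\<bar>Q\<bar>\<close>,
is at most twice the integral over \<open>E Q\<close> of the maximal function of \<open>s\<close> localised to \<open>R\<close>, and summing over
\<open>Q\<close> produces the integral in the definition of \<open>A_inf_const s\<close>.\<close>

lemma sparse_Carleson_packing:
  fixes s :: "real^'n \<Rightarrow> ennreal"
  assumes "finite S" and cells: "\<And>Q. Q \<in> S \<Longrightarrow> cell Q"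
    and sparse: "\<And>Q. Q \<in> S \<Longrightarrow> 2 * emeasure lebesgue (\<Union>{Q'\<in>S. Q' \<subset> Q}) \<le> emeasure lebesgue Q"
    and "laminar S" and R: "R \<in> S"
    and s: "0 < (\<integral>\<^sup>+x\<in>R. s x \<partial>lebesgue)" "(\<integral>\<^sup>+x\<in>R. s x \<partial>lebesgue) < \<infinity>"
  shows "(\<Sum>Q | Q \<in> S \<and> Q \<subseteq> R. \<integral>\<^sup>+x\<in>Q. s x \<partial>lebesgue)
    \<le> 2 * A_inf_const s * (\<integral>\<^sup>+x\<in>R. s x \<partial>lebesgue)"
proof -
  obtain R' where R': "R' \<in> cubes" "R \<subseteq> R'"
      "\<And>g. (\<integral>\<^sup>+x\<in>R. g x \<partial>lebesgue) = (\<integral>\<^sup>+x\<in>R'. g x \<partial>lebesgue)"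
    by (rule cellE[OF cells[OF R]]) (rule that; assumption)
  define H where "H = HL_maximal (\<lambda>y. s y * indicator R' y)"
  define E where "E Q = Q - \<Union>{Q'\<in>S. Q' \<subset> Q}" for Q
  let ?S = "{Q. Q \<in> S \<and> Q \<subseteq> R}"
  have fin: "finite ?S" using \<open>finite S\<close> by simp
  have U_meas: "\<Union>{Q'\<in>S. Q' \<subset> Q} \<in> sets lebesgue" for Q
    using \<open>finite S\<close> cells by (intro sets.finite_Union) (auto simp: cell_measurable)
  have E_meas: "E Q \<in> sets lebesgue" if "Q \<in> S" for Q
    unfolding E_def using U_meas cells[OF that] by (auto simp: cell_measurable)
  have big: "emeasure lebesgue Q \<le> 2 * emeasure lebesgue (E Q)" if Q: "Q \<in> S" for Q
  proof -
    let ?U = "\<Union>{Q'\<in>S. Q' \<subset> Q}"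
    have "emeasure lebesgue Q \<le> emeasure lebesgue (E Q \<union> ?U)"
      using sets.Un[OF E_meas[OF Q] U_meas[of Q]] by (intro emeasure_mono) (auto simp: E_def)
    also have "\<dots> \<le> emeasure lebesgue (E Q) + emeasure lebesgue ?U"
      using E_meas[OF Q] U_meas by (rule emeasure_subadditive)
    finally have "2 * emeasure lebesgue Q \<le> 2 * (emeasure lebesgue (E Q) + emeasure lebesgue ?U)"
      by (rule mult_left_mono) simp
    also have "\<dots> \<le> 2 * emeasure lebesgue (E Q) + emeasure lebesgue Q"
      unfolding distrib_left using sparse[OF Q] by (rule add_left_mono)
    finally have "emeasure lebesgue Q + emeasure lebesgue Q \<le> emeasure lebesgue Q + 2 * emeasure lebesgue (E Q)"
      unfolding mult_2[of "emeasure lebesgue Q"] add.commute[of "2 * emeasure lebesgue (E Q)"] .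
    then show ?thesis
      using cell_emeasure_finite[OF cells[OF Q]] by (simp only: ennreal_add_left_cancel_le) auto
  qed
  have disj: "E Q \<inter> E Q' = {}" if "Q \<in> S" "Q' \<in> S" "Q \<noteq> Q'" for Q Q'
  proof -
    have "Q \<subseteq> Q' \<or> Q' \<subseteq> Q \<or> Q \<inter> Q' = {}"
      using \<open>laminar S\<close> that unfolding laminar_def by simp
    then show ?thesis
      using that unfolding E_def by auto
  qed
  have max: "average Q s \<le> H x" if Q: "Q \<in> ?S" "x \<in> Q" for Q x
  proof -
    obtain Q' where Q': "Q' \<in> cubes" "Q \<subseteq> Q'" "\<And>g. average Q g = average Q' g"
    proof -
      have "cell Q" using cells Q by simp
      then show ?thesis by (rule cellE) (rule that; assumption)
    qed
    have "average Q s = average Q (\<lambda>y. s y * indicator R' y)"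
      unfolding average_def using Q R'(2)
      by (intro arg_cong2[where f="(/)"] nn_integral_cong) (auto simp: indicator_def)
    also have "\<dots> = average Q' (\<lambda>y. s y * indicator R' y)"
      by (rule Q'(3))
    also have "\<dots> \<le> H x"
      unfolding H_def HL_maximal_def using Q' Q by (intro SUP_upper) auto
    finally show ?thesis .
  qed
  have ptw: "(\<Sum>Q\<in>?S. average Q s * indicator (E Q) x) \<le> H x * indicator R' x" for x
  proof (cases "\<exists>Q\<in>?S. x \<in> E Q")
    case True
    then obtain Q where Q: "Q \<in> ?S" "x \<in> E Q" by auto
    have "x \<notin> E Q'" if "Q' \<in> ?S - {Q}" for Q'
      using disj[of Q Q'] that Q by auto
    then have "(\<Sum>Q\<in>?S. average Q s * indicator (E Q) x) = average Q s * indicator (E Q) x"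
      using fin Q(1) by (subst sum.remove[OF fin Q(1)]) (auto simp: indicator_def intro!: sum.neutral)
    also have "\<dots> \<le> H x * indicator R' x"
      using max[OF Q(1), of x] Q R'(2) by (auto simp: indicator_def E_def)
    finally show ?thesis .
  next
    case False
    then have "(\<Sum>Q\<in>?S. average Q s * indicator (E Q) x) = 0"
      by (intro sum.neutral) (auto simp: indicator_def)
    then show ?thesis by simp
  qed
  have "(\<Sum>Q\<in>?S. \<integral>\<^sup>+x\<in>Q. s x \<partial>lebesgue) \<le> (\<Sum>Q\<in>?S. 2 * (\<integral>\<^sup>+x. average Q s * indicator (E Q) x \<partial>lebesgue))"
  proof (rule sum_mono)
    fix Q assume Q: "Q \<in> ?S"
    have "(\<integral>\<^sup>+x\<in>Q. s x \<partial>lebesgue) = average Q s * emeasure lebesgue Q"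
      using Q cells cell_emeasure_pos cell_emeasure_finite by (intro average_times_emeasure[symmetric]) auto
    also have "\<dots> \<le> average Q s * (2 * emeasure lebesgue (E Q))"
      using Q big by (intro mult_left_mono) auto
    also have "\<dots> = 2 * (\<integral>\<^sup>+x. average Q s * indicator (E Q) x \<partial>lebesgue)"
      using Q E_meas by (simp add: nn_integral_cmult_indicator mult_ac del: emeasure_completion)
    finally show "(\<integral>\<^sup>+x\<in>Q. s x \<partial>lebesgue) \<le> \<dots>" .
  qed
  also have "\<dots> = 2 * (\<integral>\<^sup>+x. (\<Sum>Q\<in>?S. average Q s * indicator (E Q) x) \<partial>lebesgue)"
    using E_meas by (subst nn_integral_sum) (auto simp: sum_distrib_left)
  also have "\<dots> \<le> 2 * (\<integral>\<^sup>+x\<in>R'. H x \<partial>lebesgue)"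
    by (intro mult_left_mono nn_integral_mono ptw) auto
  also have "\<dots> \<le> 2 * (A_inf_const s * (\<integral>\<^sup>+x\<in>R'. s x \<partial>lebesgue))"
    unfolding H_def using R' s by (intro mult_left_mono nn_integral_HL_maximal_le) auto
  finally show ?thesis
    by (simp add: R'(3) mult_ac)
qed

section \<open>The Carleson embedding with respect to a dual weight\<close>

lemma one_minus_conj_exponent: "1 < q \<Longrightarrow> 1 - conj_exponent q = - 1 / (q - 1)"
  by (simp add: conj_exponent_def field_simps)

lemma sigma_weight_ennreal:
  "0 < r \<Longrightarrow> 1 < q \<Longrightarrow> w x = ennreal r \<Longrightarrow> sigma_weight q w x = ennreal (r powr (- 1 / (q - 1)))"
  by (simp add: sigma_weight_def epowr_ennreal one_minus_conj_exponent)

text \<open>Replaces Hoelder's inequality where only finiteness matters.\<close>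

lemma local_integrability:
  fixes f :: "real^'n \<Rightarrow> real"
  assumes w: "weight w" and q: "1 < q" and [measurable]: "f \<in> borel_measurable lebesgue" and Q: "Q \<in> sets lebesgue"
  shows "(\<integral>\<^sup>+x\<in>Q. ennreal \<bar>f x\<bar> \<partial>lebesgue)
    \<le> (\<integral>\<^sup>+x. ennreal \<bar>f x\<bar> epowr q * w x \<partial>lebesgue) + (\<integral>\<^sup>+x\<in>Q. sigma_weight q w x \<partial>lebesgue)"
proof -
  \<comment> \<open>If \<open>\<bar>f\<bar>\<close> exceeds the dual weight, then \<open>\<bar>f\<bar>\<^sup>q w\<close> exceeds \<open>\<bar>f\<bar>\<close>.\<close>
  have ptw: "y \<le> y powr q * r + r powr (- 1 / (q - 1))" if "0 \<le> y" "0 < r" for y r :: real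
  proof (cases "y \<le> r powr (- 1 / (q - 1))")
    case True
    then show ?thesis using that by (simp add: add_increasing)
  next
    case False
    then have "(r powr (- 1 / (q - 1))) powr (q - 1) \<le> y powr (q - 1)"
      using q by (intro powr_mono2) auto
    moreover have "(r powr (- 1 / (q - 1))) powr (q - 1) = 1 / r"
    proof -
      have "(r powr (- 1 / (q - 1))) powr (q - 1) = r powr (- 1)"
        using q unfolding powr_powr by simp
      then show ?thesis
        using that by (simp add: powr_minus_divide)
    qed
    ultimately have "1 / r \<le> y powr (q - 1)"
      by simp
    then have "1 \<le> y powr (q - 1) * r"
      using that by (simp add: field_simps)
    then have "y * 1 \<le> y * (y powr (q - 1) * r)"
      using that by (intro mult_left_mono) auto
    also have "y * (y powr (q - 1) * r) = y powr q * r"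
      using that False by (cases "y = 0") (auto simp: powr_diff)
    finally show ?thesis by (simp add: add_increasing2)
  qed
  have [measurable]: "w \<in> borel_measurable lebesgue" "sigma_weight q w \<in> borel_measurable lebesgue"
    "Q \<in> sets lebesgue"
    using w weight_sigma[OF w] Q by (auto dest: weight_measurable)
  have "(\<integral>\<^sup>+x\<in>Q. ennreal \<bar>f x\<bar> \<partial>lebesgue)
      \<le> (\<integral>\<^sup>+x. ennreal \<bar>f x\<bar> epowr q * w x + sigma_weight q w x * indicator Q x \<partial>lebesgue)"
  proof (rule nn_integral_mono_AE)
    have "AE x in lebesgue. 0 < w x \<and> w x < \<infinity>"
      using w by (simp only: weight_def)
    then show "AE x in lebesgue. ennreal \<bar>f x\<bar> * indicator Q x
      \<le> ennreal \<bar>f x\<bar> epowr q * w x + sigma_weight q w x * indicator Q x"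
    proof eventually_elim
      case (elim x)
      then obtain r where r: "0 < r" "w x = ennreal r"
        by (cases "w x" rule: ennreal_0_top_pos_cases) auto
      have "ennreal \<bar>f x\<bar> \<le> ennreal (\<bar>f x\<bar> powr q * r + r powr (- 1 / (q - 1)))"
        using r by (intro ennreal_leI ptw) auto
      also have "\<dots> = ennreal \<bar>f x\<bar> epowr q * w x + sigma_weight q w x"
        using r q by (simp add: sigma_weight_ennreal epowr_ennreal_pos ennreal_mult)
      finally show ?case by (auto simp: indicator_def)
    qed
  qed
  also have "\<dots> = (\<integral>\<^sup>+x. ennreal \<bar>f x\<bar> epowr q * w x \<partial>lebesgue) + (\<integral>\<^sup>+x\<in>Q. sigma_weight q w x \<partial>lebesgue)"
    by (rule nn_integral_add) measurable
  finally show ?thesis .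
qed

text \<open>The constant of \<open>Carleson_embedding\<close>.\<close>

definition Carleson_const :: "real \<Rightarrow> real" where
  "Carleson_const q = 2 powr (2 * q) / (1 - 2 powr (1 - q))"

lemma Carleson_const_pos: "1 < q \<Longrightarrow> 0 < Carleson_const q"
  using powr_less_mono[of "1 - q" 0 "2::real"] by (simp add: Carleson_const_def)

text \<open>With \<open>\<sigma>\<close> the dual weight of \<open>w\<close>, apply the embedding to the measure \<open>\<sigma> dx\<close> and the function \<open>g = \<bar>f\<bar> / \<sigma>\<close>:
then \<open>g \<sigma> = \<bar>f\<bar>\<close> almost everywhere, so that the \<open>\<sigma>\<close>-mean of \<open>g\<close> over \<open>Q\<close> is \<open>F Q / s Q\<close>, and \<open>g\<^sup>q \<sigma> = \<bar>f\<bar>\<^sup>q w\<close>.\<close>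

lemma weighted_Carleson_embedding:
  fixes f :: "real^'n \<Rightarrow> real" and w :: "real^'n \<Rightarrow> ennreal" and q :: real
  defines "F \<equiv> \<lambda>Q. enn2real (\<integral>\<^sup>+x\<in>Q. ennreal \<bar>f x\<bar> \<partial>lebesgue)"
  defines "s \<equiv> \<lambda>Q. enn2real (\<integral>\<^sup>+x\<in>Q. sigma_weight q w x \<partial>lebesgue)"
  assumes w: "weight w" and q: "1 < q" and [measurable]: "f \<in> borel_measurable lebesgue"
    and "finite S" and "laminar S" and cells: "\<And>Q. Q \<in> S \<Longrightarrow> cell Q"
    and fin: "\<And>Q. Q \<in> S \<Longrightarrow> (\<integral>\<^sup>+x\<in>Q. sigma_weight q w x \<partial>lebesgue) < \<infinity>"
    and ffin: "\<And>Q. Q \<in> S \<Longrightarrow> (\<integral>\<^sup>+x\<in>Q. ennreal \<bar>f x\<bar> \<partial>lebesgue) < \<infinity>"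
    and packing: "\<And>R. R \<in> S \<Longrightarrow> (\<Sum>Q | Q \<in> S \<and> Q \<subseteq> R. \<integral>\<^sup>+x\<in>Q. sigma_weight q w x \<partial>lebesgue)
      \<le> K * (\<integral>\<^sup>+x\<in>R. sigma_weight q w x \<partial>lebesgue)"
  shows "(\<Sum>Q\<in>S. ennreal ((F Q / s Q) powr q * s Q))
    \<le> ennreal (Carleson_const q) * K * (\<integral>\<^sup>+x. ennreal \<bar>f x\<bar> epowr q * w x \<partial>lebesgue)"
proof -
  let ?s = "sigma_weight q w"
  define M where "M = density lebesgue ?s"
  define g where "g x = \<bar>f x\<bar> / enn2real (?s x)" for x
  have s_weight: "weight ?s" using w by (rule weight_sigma)
  have [measurable]: "w \<in> borel_measurable lebesgue" "?s \<in> borel_measurable lebesgue"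
    using w s_weight by (auto dest: weight_measurable)
  have AE_w: "AE x in lebesgue. 0 < w x \<and> w x < \<infinity>"
    using w by (simp only: weight_def)
  have cell_meas: "Q \<in> sets lebesgue" if "Q \<in> S" for Q
    using cells[OF that] by (rule cell_measurable)
  have M_eq: "emeasure M Q = (\<integral>\<^sup>+x\<in>Q. ?s x \<partial>lebesgue)" if "Q \<in> S" for Q
    unfolding M_def using cell_meas[OF that] by (simp add: emeasure_density)
  have M_ne: "0 < emeasure M Q" if "Q \<in> S" for Q
    unfolding M_eq[OF that] using s_weight cells[OF that]
    by (intro weight_integral_pos cell_measurable cell_emeasure_pos)
  have g_meas: "g \<in> borel_measurable lebesgue"
    unfolding g_def by measurable
  have g_int: "(\<integral>\<^sup>+x\<in>Q. ennreal (g x) \<partial>M) = (\<integral>\<^sup>+x\<in>Q. ennreal \<bar>f x\<bar> \<partial>lebesgue)" if "Q \<in> S" for Q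
  proof -
    have "(\<integral>\<^sup>+x\<in>Q. ennreal (g x) \<partial>M) = (\<integral>\<^sup>+x. ?s x * (ennreal (g x) * indicator Q x) \<partial>lebesgue)"
      unfolding M_def using cell_meas[OF that] g_meas by (intro nn_integral_density) auto
    also have "\<dots> = (\<integral>\<^sup>+x\<in>Q. ennreal \<bar>f x\<bar> \<partial>lebesgue)"
    proof (rule nn_integral_cong_AE)
      show "AE x in lebesgue. ?s x * (ennreal (g x) * indicator Q x) = ennreal \<bar>f x\<bar> * indicator Q x"
        using AE_w
      proof eventually_elim
        case (elim x)
        then obtain r where r: "0 < r" "w x = ennreal r"
          by (cases "w x" rule: ennreal_0_top_pos_cases) auto
        then show ?case
          using q by (simp add: sigma_weight_ennreal g_def indicator_def flip: ennreal_mult)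
      qed
    qed
    finally show ?thesis .
  qed
  have g_norm: "(\<integral>\<^sup>+x. ennreal (g x powr q) \<partial>M) = (\<integral>\<^sup>+x. ennreal \<bar>f x\<bar> epowr q * w x \<partial>lebesgue)"
  proof -
    have "(\<integral>\<^sup>+x. ennreal (g x powr q) \<partial>M) = (\<integral>\<^sup>+x. ?s x * ennreal (g x powr q) \<partial>lebesgue)"
      unfolding M_def using g_meas by (intro nn_integral_density) auto
    also have "\<dots> = (\<integral>\<^sup>+x. ennreal \<bar>f x\<bar> epowr q * w x \<partial>lebesgue)"
    proof (rule nn_integral_cong_AE)
      show "AE x in lebesgue. ?s x * ennreal (g x powr q) = ennreal \<bar>f x\<bar> epowr q * w x"
        using AE_w
      proof eventually_elim
        case (elim x)
        then obtain r where r: "0 < r" "w x = ennreal r"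
          by (cases "w x" rule: ennreal_0_top_pos_cases) auto
        define t where "t = r powr (- 1 / (q - 1))"
        have t: "0 < t" using r by (simp add: t_def)
        have "t powr (1 - q) = r powr (- 1 / (q - 1) * (1 - q))"
          unfolding t_def powr_powr ..
        also have "- 1 / (q - 1) * (1 - q) = 1"
          using q by (simp add: field_simps)
        finally have t1: "t * (\<bar>f x\<bar> / t) powr q = \<bar>f x\<bar> powr q * r"
          using r t by (simp add: powr_divide powr_diff field_simps)
        have "?s x * ennreal (g x powr q) = ennreal (t * (\<bar>f x\<bar> / t) powr q)"
          unfolding g_def sigma_weight_ennreal[where w = w, OF r(1) q r(2)] t_def[symmetric]
          using t by (simp add: ennreal_mult)
        also have "\<dots> = ennreal \<bar>f x\<bar> epowr q * w x"
          unfolding t1 using r q by (simp add: epowr_ennreal_pos ennreal_mult)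
        finally show ?case .
      qed
    qed
    finally show ?thesis .
  qed
  have "(\<Sum>Q\<in>S. ennreal (mean M Q g powr q) * emeasure M Q)
    \<le> ennreal (Carleson_const q) * K * (\<integral>\<^sup>+x. ennreal (g x powr q) \<partial>M)"
    unfolding Carleson_const_def
  proof (rule Carleson_embedding)
    show "S \<subseteq> sets M"
      using cell_meas by (auto simp: M_def)
    show "g \<in> borel_measurable M"
      using g_meas by (simp add: M_def)
    show "0 \<le> g x" for x
      by (simp add: g_def)
    show "(\<Sum>Q | Q \<in> S \<and> Q \<subseteq> R. emeasure M Q) \<le> K * emeasure M R" if "R \<in> S" for R
      using packing[OF that] M_eq that by simp
  qed (use assms M_ne M_eq g_int in auto)
  moreover have "ennreal (mean M Q g powr q) * emeasure M Q = ennreal ((F Q / s Q) powr q * s Q)"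
    if Q: "Q \<in> S" for Q
  proof -
    have "mean M Q g = F Q / s Q"
      unfolding mean_def F_def s_def measure_def M_eq[OF Q] g_int[OF Q] ..
    moreover have "emeasure M Q = ennreal (s Q)"
      unfolding s_def M_eq[OF Q] using fin[OF Q] by simp
    ultimately show ?thesis
      by (simp add: ennreal_mult s_def)
  qed
  ultimately show ?thesis
    by (simp add: g_norm)
qed

section \<open>Multilinear weights and sums over sparse families\<close>

text \<open>The form in which the multilinear weight condition on one cube is used; \<open>W\<close> is the weight constant, \<open>V\<close> and \<open>N\<close> the
Lebesgue and the \<open>\<nu>\<close>-measure of the cube, \<open>s i\<close> its \<open>\<sigma>\<^sub>i\<close>-measure and \<open>F i\<close> the integral of \<open>\<bar>f\<^sub>i\<bar>\<close>. Writing
\<open>F i / V = (F i / s i) (s i / V)\<close> splits off the product in the condition; the factor \<open>V\<close> that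
is left over is the product of the \<open>V powr (p / P i)\<close>, as these exponents sum to one.\<close>

lemma weight_condition_product_estimate:
  fixes F s P :: "'i \<Rightarrow> real"
  assumes "finite I" and F: "\<And>i. i \<in> I \<Longrightarrow> 0 \<le> F i" and s: "\<And>i. i \<in> I \<Longrightarrow> 0 < s i" and V: "0 < V"
    and P: "\<And>i. i \<in> I \<Longrightarrow> 0 < P i" and "0 < p" and one: "(\<Sum>i\<in>I. p / P i) = 1"
    and W: "N / V * (\<Prod>i\<in>I. (s i / V) powr (p - p / P i)) \<le> W"
  shows "(\<Prod>i\<in>I. F i / V) powr p * N \<le> W * (\<Prod>i\<in>I. ((F i / s i) powr P i * s i) powr (p / P i))"
proof -
  have "(F i / V) powr p = (F i / s i) powr p * (s i powr (p / P i) / V powr (p / P i) * (s i / V) powr (p - p / P i))"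
    if i: "i \<in> I" for i
  proof -
    have "(F i / V) powr p = ((F i / s i) * (s i / V)) powr p"
      using s[OF i] by simp
    also have "\<dots> = (F i / s i) powr p * (s i / V) powr (p / P i + (p - p / P i))"
      using s[OF i] F[OF i] V by (subst powr_mult) auto
    also have "\<dots> = (F i / s i) powr p * (s i powr (p / P i) / V powr (p / P i) * (s i / V) powr (p - p / P i))"
      using s[OF i] V by (simp only: powr_add powr_divide)
    finally show ?thesis .
  qed
  moreover have "(\<Prod>i\<in>I. F i / V) powr p = (\<Prod>i\<in>I. (F i / V) powr p)"
    by (rule prod_powr_distrib)
  ultimately have "(\<Prod>i\<in>I. F i / V) powr p = (\<Prod>i\<in>I. (F i / s i) powr p) *
      ((\<Prod>i\<in>I. s i powr (p / P i)) / (\<Prod>i\<in>I. V powr (p / P i)) * (\<Prod>i\<in>I. (s i / V) powr (p - p / P i)))"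
    by (simp only: prod.distrib prod_dividef cong: prod.cong)
  also have "(\<Prod>i\<in>I. V powr (p / P i)) = V"
    using powr_sum[of V "\<lambda>i. p / P i" I] V one \<open>finite I\<close> by simp
  finally have "(\<Prod>i\<in>I. F i / V) powr p * N = (\<Prod>i\<in>I. (F i / s i) powr p) * (\<Prod>i\<in>I. s i powr (p / P i)) *
      (N / V * (\<Prod>i\<in>I. (s i / V) powr (p - p / P i)))"
    by simp
  also have "\<dots> \<le> (\<Prod>i\<in>I. (F i / s i) powr p) * (\<Prod>i\<in>I. s i powr (p / P i)) * W"
    using W by (intro mult_left_mono mult_nonneg_nonneg prod_nonneg) auto
  also have "(\<Prod>i\<in>I. (F i / s i) powr p) * (\<Prod>i\<in>I. s i powr (p / P i))
      = (\<Prod>i\<in>I. ((F i / s i) powr P i * s i) powr (p / P i))"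
    unfolding prod.distrib[symmetric]
  proof (rule prod.cong)
    fix i assume i: "i \<in> I"
    have "P i * (p / P i) = p"
      using P[OF i] by simp
    then show "(F i / s i) powr p * s i powr (p / P i) = ((F i / s i) powr P i * s i) powr (p / P i)"
      using s[OF i] F[OF i] by (simp add: powr_mult powr_powr)
  qed simp
  finally show ?thesis
    by (simp add: mult.commute)
qed

locale Hoelder_exponents =
  fixes m :: nat and p :: real and P :: "nat \<Rightarrow> real"
  assumes m_ge_1: "1 \<le> m" and P_gt_1: "\<And>i. i \<in> {1..m} \<Longrightarrow> 1 < P i"
    and p_def: "1 / p = (\<Sum>i\<in>{1..m}. 1 / P i)"
begin

lemma p_pos: "0 < p"
proof -
  have "0 < (\<Sum>i\<in>{1..m}. 1 / P i)"
    using m_ge_1 P_gt_1 by (intro sum_pos) fastforce+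
  then show ?thesis
    using p_def by (metis zero_less_divide_1_iff)
qed

lemma sum_p_div: "(\<Sum>i\<in>{1..m}. p / P i) = 1"
proof -
  have "(\<Sum>i\<in>{1..m}. p / P i) = p * (\<Sum>i\<in>{1..m}. 1 / P i)"
    by (simp add: sum_distrib_left)
  then show ?thesis
    using p_pos p_def by (metis nonzero_mult_div_cancel_left less_irrefl times_divide_eq_right mult.right_neutral)
qed

lemma p_div_conj_exponent: "i \<in> {1..m} \<Longrightarrow> p / conj_exponent (P i) = p - p / P i"
  using P_gt_1[of i] by (simp add: conj_exponent_def field_simps)

lemma p_div_conj_exponent_pos: "i \<in> {1..m} \<Longrightarrow> 0 < p / conj_exponent (P i)"
  using P_gt_1[of i] p_pos by (simp add: conj_exponent_def)

lemma P_pos: "i \<in> {1..m} \<Longrightarrow> 0 < P i"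
  using P_gt_1[of i] by simp

lemma sum_p_div_conj_exponent: "(\<Sum>i\<in>{1..m}. p / conj_exponent (P i)) = m * p - 1"
  using p_div_conj_exponent sum_p_div by (simp add: sum_subtractf)

lemma mp_gt_1: "1 < m * p"
proof -
  have "0 < (\<Sum>i\<in>{1..m}. p / conj_exponent (P i))"
    using m_ge_1 p_div_conj_exponent_pos by (intro sum_pos) auto
  then show ?thesis
    by (simp only: sum_p_div_conj_exponent)
qed

end

locale A_P_tuple = Hoelder_exponents +
  fixes w :: "nat \<Rightarrow> real^'n \<Rightarrow> ennreal"
  assumes A_P: "w \<in> A_P m p P"
begin

abbreviation \<nu> :: "real^'n \<Rightarrow> ennreal" where "\<nu> \<equiv> nu_weight m p P w"
abbreviation \<sigma> :: "nat \<Rightarrow> real^'n \<Rightarrow> ennreal" where "\<sigma> i \<equiv> sigma_weight (P i) (w i)"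
abbreviation means :: "(nat \<Rightarrow> real^'n \<Rightarrow> real) \<Rightarrow> (real^'n) set \<Rightarrow> real" where
  "means f Q \<equiv> \<Prod>i\<in>{1..m}. mean lebesgue Q (\<lambda>x. ennreal \<bar>f i x\<bar>)"
abbreviation energy :: "(nat \<Rightarrow> real^'n \<Rightarrow> real) \<Rightarrow> nat \<Rightarrow> ennreal" where
  "energy f i \<equiv> \<integral>\<^sup>+x. ennreal \<bar>f i x\<bar> epowr P i * w i x \<partial>lebesgue"

lemma weight_w: "i \<in> {1..m} \<Longrightarrow> weight (w i)"
  using A_P by (simp add: A_P_def)

lemma weight_\<sigma>: "i \<in> {1..m} \<Longrightarrow> weight (\<sigma> i)"
  using weight_w by (rule weight_sigma)

lemma weight_\<nu>: "weight \<nu>"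
  using weight_w by (rule weight_nu)

lemma A_P_const_finite: "A_P_const m p P w < \<infinity>"
  using A_P by (simp add: A_P_def)

text \<open>All factors of the finite product are positive, hence each of them is finite.\<close>

lemma cube_averages:
  assumes Q: "Q \<in> cubes"
  shows "average Q \<nu> * (\<Prod>i\<in>{1..m}. average Q (\<sigma> i) epowr (p / conj_exponent (P i))) \<le> A_P_const m p P w"
    and "average Q \<nu> < \<infinity>" and "\<And>i. i \<in> {1..m} \<Longrightarrow> average Q (\<sigma> i) < \<infinity>"
proof -
  let ?\<Pi> = "\<Prod>i\<in>{1..m}. average Q (\<sigma> i) epowr (p / conj_exponent (P i))"
  show le: "average Q \<nu> * ?\<Pi> \<le> A_P_const m p P w"
    unfolding A_P_const_def using Q by (intro SUP_upper)
  then have fin: "average Q \<nu> * ?\<Pi> \<noteq> top"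
    using A_P_const_finite by (auto simp: top_unique)
  have \<nu>0: "average Q \<nu> \<noteq> 0"
    using average_pos[OF weight_\<nu> Q] by simp
  have \<sigma>0: "average Q (\<sigma> i) epowr (p / conj_exponent (P i)) \<noteq> 0" if "i \<in> {1..m}" for i
    using average_pos[OF weight_\<sigma>[OF that] Q] p_div_conj_exponent_pos[OF that] by (simp add: epowr_eq_0_iff)
  then have \<Pi>0: "?\<Pi> \<noteq> 0"
    by simp
  show "average Q \<nu> < \<infinity>"
    using fin \<Pi>0 unfolding ennreal_mult_eq_top_iff by (auto simp: less_top)
  have "?\<Pi> \<noteq> top"
    using fin \<nu>0 unfolding ennreal_mult_eq_top_iff by auto
  then have "average Q (\<sigma> i) epowr (p / conj_exponent (P i)) \<noteq> top" if "i \<in> {1..m}" for i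
    using \<sigma>0 that by (auto simp: ennreal_prod_eq_top)
  then show "average Q (\<sigma> i) < \<infinity>" if "i \<in> {1..m}" for i
    using that p_div_conj_exponent_pos[OF that] by (metis epowr_top infinity_ennreal_def less_top)
qed

lemma cell_integrals:
  assumes "cell Q"
  shows "0 < (\<integral>\<^sup>+x\<in>Q. \<nu> x \<partial>lebesgue)" and "(\<integral>\<^sup>+x\<in>Q. \<nu> x \<partial>lebesgue) < \<infinity>"
    and "\<And>i. i \<in> {1..m} \<Longrightarrow> 0 < (\<integral>\<^sup>+x\<in>Q. \<sigma> i x \<partial>lebesgue)"
    and "\<And>i. i \<in> {1..m} \<Longrightarrow> (\<integral>\<^sup>+x\<in>Q. \<sigma> i x \<partial>lebesgue) < \<infinity>"
proof -
  note Q = cell_measurable[OF assms] cell_emeasure_pos[OF assms] cell_emeasure_finite[OF assms]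
  show "0 < (\<integral>\<^sup>+x\<in>Q. \<nu> x \<partial>lebesgue)"
    using weight_\<nu> Q(1,2) by (rule weight_integral_pos)
  show "0 < (\<integral>\<^sup>+x\<in>Q. \<sigma> i x \<partial>lebesgue)" if "i \<in> {1..m}" for i
    using weight_\<sigma>[OF that] Q(1,2) by (rule weight_integral_pos)
  obtain R where R: "R \<in> cubes" "\<And>g. average Q g = average R g"
    using cellE[OF assms] by metis
  have fin: "(\<integral>\<^sup>+x\<in>Q. g x \<partial>lebesgue) < \<infinity>" if "average Q g < \<infinity>" for g
    using that Q average_times_emeasure[of Q g]
    by (metis ennreal_mult_less_top infinity_ennreal_def)
  show "(\<integral>\<^sup>+x\<in>Q. \<nu> x \<partial>lebesgue) < \<infinity>"
    using cube_averages(2)[OF R(1)] R(2) by (intro fin) simp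
  show "(\<integral>\<^sup>+x\<in>Q. \<sigma> i x \<partial>lebesgue) < \<infinity>" if "i \<in> {1..m}" for i
    using cube_averages(3)[OF R(1) that] R(2) by (intro fin) simp
qed

lemma f_integral_finite:
  assumes "cell Q" and i: "i \<in> {1..m}" and "f i \<in> borel_measurable lebesgue" and "energy f i < \<infinity>"
  shows "(\<integral>\<^sup>+x\<in>Q. ennreal \<bar>f i x\<bar> \<partial>lebesgue) < \<infinity>"
  using local_integrability[OF weight_w[OF i] P_gt_1[OF i] assms(3) cell_measurable[OF assms(1)]]
    cell_integrals(4)[OF assms(1) i] assms(4)
  by (auto simp: ennreal_add_less_top elim: le_less_trans)

text \<open>The weight condition on each cube, Hoelder's inequality with the exponents \<open>P i / p\<close>, and for each \<open>i\<close> the Carleson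
embedding, whose packing constant is \<open>2 * A_inf_const (\<sigma> i)\<close>.\<close>

lemma sparse_form_bound:
  assumes S: "finite S" "laminar S" and cells: "\<And>Q. Q \<in> S \<Longrightarrow> cell Q"
    and sparse: "\<And>Q. Q \<in> S \<Longrightarrow> 2 * emeasure lebesgue (\<Union>{Q'\<in>S. Q' \<subset> Q}) \<le> emeasure lebesgue Q"
    and f: "\<And>i. i \<in> {1..m} \<Longrightarrow> f i \<in> borel_measurable lebesgue"
    and energy: "\<And>i. i \<in> {1..m} \<Longrightarrow> energy f i < \<infinity>"
  shows "(\<Sum>Q\<in>S. ennreal (means f Q powr p) * (\<integral>\<^sup>+x\<in>Q. \<nu> x \<partial>lebesgue))
    \<le> A_P_const m p P w * (\<Prod>i\<in>{1..m}.
        (ennreal (2 * Carleson_const (P i)) * A_inf_const (\<sigma> i) * energy f i) epowr (p / P i))"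
proof -
  define F where "F i Q = enn2real (\<integral>\<^sup>+x\<in>Q. ennreal \<bar>f i x\<bar> \<partial>lebesgue)" for i Q
  define s where "s i Q = enn2real (\<integral>\<^sup>+x\<in>Q. \<sigma> i x \<partial>lebesgue)" for i Q
  define X where "X i Q = (F i Q / s i Q) powr P i * s i Q" for i Q
  define W where "W = enn2real (A_P_const m p P w)"
  have W: "A_P_const m p P w = ennreal W"
    using A_P_const_finite by (simp add: W_def)
  have X0: "0 \<le> X i Q" for i Q
    by (simp add: X_def s_def)
  have single: "ennreal (means f Q powr p) * (\<integral>\<^sup>+x\<in>Q. \<nu> x \<partial>lebesgue)
      \<le> ennreal (W * (\<Prod>i\<in>{1..m}. X i Q powr (p / P i)))" if "Q \<in> S" for Q
  proof -
    note Q = cells[OF that]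
    define N where "N = enn2real (\<integral>\<^sup>+x\<in>Q. \<nu> x \<partial>lebesgue)"
    define V where "V = measure lebesgue Q"
    obtain R where R: "R \<in> cubes" "\<And>g. average Q g = average R g"
      using cellE[OF Q] by metis
    have V: "V > 0"
      using cell_emeasure_pos[OF Q] cell_emeasure_finite[OF Q]
      by (simp add: V_def measure_def enn2real_positive_iff del: emeasure_completion)
    have s: "s i Q > 0" if "i \<in> {1..m}" for i
      using cell_integrals(3,4)[OF Q that] by (simp add: s_def enn2real_positive_iff)
    have a: "average Q \<nu> = ennreal (N / V)"
      unfolding N_def V_def mean_def[symmetric]
      using Q cell_integrals(2)[OF Q] by (intro average_eq_mean cell_emeasure_pos cell_emeasure_finite)
    have b: "average Q (\<sigma> i) epowr (p / conj_exponent (P i)) = ennreal ((s i Q / V) powr (p - p / P i))"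
      if "i \<in> {1..m}" for i
    proof -
      have "average Q (\<sigma> i) = ennreal (s i Q / V)"
        unfolding s_def V_def mean_def[symmetric]
        using Q cell_integrals(4)[OF Q that] by (intro average_eq_mean cell_emeasure_pos cell_emeasure_finite)
      then show ?thesis
        using s[OF that] V by (simp add: epowr_ennreal p_div_conj_exponent[OF that])
    qed
    have "ennreal (N / V * (\<Prod>i\<in>{1..m}. (s i Q / V) powr (p - p / P i))) \<le> ennreal W"
      using cube_averages(1)[OF R(1)] V
      unfolding R(2)[symmetric] a W
      by (subst ennreal_mult) (simp_all add: b prod_ennreal prod_nonneg N_def)
    then have AP: "N / V * (\<Prod>i\<in>{1..m}. (s i Q / V) powr (p - p / P i)) \<le> W"
      by (subst (asm) ennreal_le_iff) (auto simp: W_def)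
    have "means f Q = (\<Prod>i\<in>{1..m}. F i Q / V)"
      unfolding mean_def F_def V_def ..
    moreover have "(\<Prod>i\<in>{1..m}. F i Q / V) powr p * N \<le> W * (\<Prod>i\<in>{1..m}. X i Q powr (p / P i))"
      unfolding X_def using V s p_pos P_pos sum_p_div AP
      by (intro weight_condition_product_estimate) (simp_all add: F_def)
    ultimately have "ennreal (means f Q powr p * N) \<le> ennreal (W * (\<Prod>i\<in>{1..m}. X i Q powr (p / P i)))"
      by (simp only: ennreal_leI)
    moreover have "(\<integral>\<^sup>+x\<in>Q. \<nu> x \<partial>lebesgue) = ennreal N"
      using cell_integrals(2)[OF Q] by (simp add: N_def)
    moreover have "ennreal (means f Q powr p * N) = ennreal (means f Q powr p) * ennreal N"
      by (rule ennreal_mult) (simp_all add: N_def)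
    ultimately show ?thesis
      by (simp only:)
  qed
  have Carleson: "ennreal (\<Sum>Q\<in>S. X i Q) \<le> ennreal (2 * Carleson_const (P i)) * A_inf_const (\<sigma> i) * energy f i"
    if i: "i \<in> {1..m}" for i
  proof -
    have "ennreal (\<Sum>Q\<in>S. X i Q) = (\<Sum>Q\<in>S. ennreal (X i Q))"
      using X0 by (simp add: sum_ennreal)
    also have "\<dots> \<le> ennreal (Carleson_const (P i)) * (2 * A_inf_const (\<sigma> i)) * energy f i"
      unfolding X_def F_def s_def
    proof (rule weighted_Carleson_embedding)
      show "(\<Sum>Q | Q \<in> S \<and> Q \<subseteq> R. \<integral>\<^sup>+x\<in>Q. \<sigma> i x \<partial>lebesgue) \<le> 2 * A_inf_const (\<sigma> i) * (\<integral>\<^sup>+x\<in>R. \<sigma> i x \<partial>lebesgue)"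
        if "R \<in> S" for R
        using S cells sparse that cell_integrals(3,4)[OF cells[OF that] i]
        by (intro sparse_Carleson_packing) auto
    qed (use S cells weight_w[OF i] P_gt_1[OF i] f[OF i] i cell_integrals(4) f_integral_finite energy in auto)
    also have "\<dots> = ennreal (2 * Carleson_const (P i)) * A_inf_const (\<sigma> i) * energy f i"
      using Carleson_const_pos[OF P_gt_1[OF i]] by (simp add: ennreal_mult mult_ac)
    finally show ?thesis .
  qed
  have "(\<Sum>Q\<in>S. ennreal (means f Q powr p) * (\<integral>\<^sup>+x\<in>Q. \<nu> x \<partial>lebesgue))
      \<le> (\<Sum>Q\<in>S. ennreal (W * (\<Prod>i\<in>{1..m}. X i Q powr (p / P i))))"
    by (rule sum_mono) (rule single)
  also have "\<dots> = ennreal (W * (\<Sum>Q\<in>S. \<Prod>i\<in>{1..m}. X i Q powr (p / P i)))"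
    by (subst sum_ennreal) (auto simp: W_def prod_nonneg sum_distrib_left)
  also have "\<dots> \<le> ennreal (W * (\<Prod>i\<in>{1..m}. (\<Sum>Q\<in>S. X i Q) powr (p / P i)))"
    using S X0 sum_p_div p_pos P_pos
    by (intro ennreal_leI mult_left_mono Holder_inequality_sum_prod) (simp_all add: W_def less_imp_le)
  also have "\<dots> = ennreal W * (\<Prod>i\<in>{1..m}. ennreal (\<Sum>Q\<in>S. X i Q) epowr (p / P i))"
  proof -
    have "ennreal (\<Sum>Q\<in>S. X i Q) epowr (p / P i) = ennreal ((\<Sum>Q\<in>S. X i Q) powr (p / P i))" if "i \<in> {1..m}" for i
      using p_pos P_pos[OF that] X0 by (intro epowr_ennreal_pos sum_nonneg) auto
    then show ?thesis
      by (simp add: W_def ennreal_mult prod_nonneg prod_ennreal)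
  qed
  also have "\<dots> \<le> ennreal W * (\<Prod>i\<in>{1..m}.
        (ennreal (2 * Carleson_const (P i)) * A_inf_const (\<sigma> i) * energy f i) epowr (p / P i))"
    using Carleson p_pos P_pos
    by (intro mult_left_mono prod_mono_ennreal epowr_mono) (simp_all add: less_imp_le)
  finally show ?thesis
    unfolding W .
qed

end

section \<open>The bound for the maximal operator\<close>

context Hoelder_exponents
begin

text \<open>The jump that makes the principal cubes sparse, see \<open>principal_cubes_sparse\<close>.\<close>

definition jump_factor :: real where
  "jump_factor = (2 * real m) ^ m"

lemma jump_factor_ge_1: "1 \<le> jump_factor"
  unfolding jump_factor_def using m_ge_1 by (intro one_le_power) simp

text \<open>In dimension \<open>n\<close>, the base of the \<open>(1/p)\<close>-th power collects the loss of \<open>6\<^sup>n\<close> in each of the \<open>m\<close> averages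
from passing to a dyadic cube, the number \<open>2\<^sup>n\<close> of grids and the jump factor.\<close>

definition maximal_const :: "nat \<Rightarrow> real" where
  "maximal_const n = (((6 ^ n) ^ m) powr p * 2 ^ n * jump_factor powr p) powr (1 / p)
     * (\<Prod>i\<in>{1..m}. (2 * Carleson_const (P i)) powr (1 / P i))"

lemma maximal_const_pos: "0 < maximal_const n"
proof -
  have "0 < (\<Prod>i\<in>{1..m}. (2 * Carleson_const (P i)) powr (1 / P i))"
    using Carleson_const_pos[OF P_gt_1] by (intro prod_pos) (auto simp: less_imp_neq[THEN not_sym])
  then show ?thesis
    using jump_factor_ge_1 by (simp add: maximal_const_def)
qed

end

context A_P_tuple
begin

definition sparse_bound :: "(nat \<Rightarrow> real^'n \<Rightarrow> real) \<Rightarrow> ennreal" where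
  "sparse_bound f = A_P_const m p P w * (\<Prod>i\<in>{1..m}.
      (ennreal (2 * Carleson_const (P i)) * A_inf_const (\<sigma> i) * energy f i) epowr (p / P i))"

lemma means_nonneg: "0 \<le> means f Q"
  by (intro prod_nonneg) (simp add: mean_nonneg)

text \<open>With the \<open>p\<close>-th power inside the supremum this is a supremum of multiples of indicator functions, plainly measurable
and monotone in \<open>F\<close>.\<close>

definition power_maximal :: "(nat \<Rightarrow> real^'n \<Rightarrow> real) \<Rightarrow> (real^'n) set set \<Rightarrow> real^'n \<Rightarrow> ennreal" where
  "power_maximal f F x = (SUP Q\<in>F. ennreal (means f Q powr p) * indicator Q x)"

lemma power_maximal_measurable:
  assumes "countable F" and "F \<subseteq> sets lebesgue"
  shows "power_maximal f F \<in> borel_measurable lebesgue"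
  unfolding power_maximal_def[abs_def]
proof (rule borel_measurable_SUP[OF assms(1)])
  fix Q assume "Q \<in> F"
  then have [measurable]: "Q \<in> sets lebesgue"
    using assms(2) by auto
  show "(\<lambda>x. ennreal (means f Q powr p) * indicator Q x) \<in> borel_measurable lebesgue"
    by measurable
qed

text \<open>Every cube of positive value is dominated by a principal cube containing it, so the supremum is at most the sum
over the principal cubes, which form a sparse family.\<close>

lemma finite_family_bound:
  assumes F: "finite F" "laminar F" and cells: "\<And>Q. Q \<in> F \<Longrightarrow> cell Q"
    and f: "\<And>i. i \<in> {1..m} \<Longrightarrow> f i \<in> borel_measurable lebesgue"
    and energy: "\<And>i. i \<in> {1..m} \<Longrightarrow> energy f i < \<infinity>"
  shows "(\<integral>\<^sup>+x. power_maximal f F x * \<nu> x \<partial>lebesgue) \<le> ennreal (jump_factor powr p) * sparse_bound f"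
proof -
  define F' where "F' = {Q \<in> F. 0 < means f Q}"
  have F': "finite F'" "F' \<subseteq> F"
    using F(1) by (auto simp: F'_def)
  obtain S where S: "S \<subseteq> F'" and dom: "\<And>Q. Q \<in> F' \<Longrightarrow> \<exists>R\<in>S. Q \<subseteq> R \<and> means f Q \<le> jump_factor * means f R"
    and jump: "\<And>Q R. Q \<in> S \<Longrightarrow> R \<in> S \<Longrightarrow> Q \<subset> R \<Longrightarrow> jump_factor * means f R < means f Q"
    using principal_subfamily[of F' "\<lambda>Q. means f Q" jump_factor, OF F'(1) means_nonneg jump_factor_ge_1]
    by metis
  have S_fin: "finite S" "laminar S" and S_cell: "\<And>Q. Q \<in> S \<Longrightarrow> cell Q"
    using S F' F cells laminar_subset finite_subset by (metis, metis, auto)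
  have sparse: "2 * emeasure lebesgue (\<Union>{Q'\<in>S. Q' \<subset> Q}) \<le> emeasure lebesgue Q" if "Q \<in> S" for Q
  proof (rule principal_cubes_sparse[where I = "{1..m}" and f = "\<lambda>i x. ennreal \<bar>f i x\<bar>"])
    show "S \<subseteq> sets lebesgue"
      using S_cell by (auto simp: cell_measurable)
    show "0 < means f Q"
      using that S by (auto simp: F'_def)
    show "(\<lambda>x. ennreal \<bar>f i x\<bar>) \<in> borel_measurable lebesgue" if "i \<in> {1..m}" for i
      using f[OF that] by measurable
    show "(\<integral>\<^sup>+x\<in>Q. ennreal \<bar>f i x\<bar> \<partial>lebesgue) < \<infinity>" if "i \<in> {1..m}" "Q \<in> S" for i Q
      using S_cell[OF that(2)] that(1) f[OF that(1)] energy[OF that(1)] by (rule f_integral_finite)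
    show "(2 * real (card {1..m})) ^ card {1..m} * means f Q < means f Q'" if "Q' \<in> S" "Q' \<subset> Q" for Q'
      using jump[OF that(1) \<open>Q \<in> S\<close> that(2)] by (simp add: jump_factor_def)
  qed (use that S_fin S_cell cell_emeasure_pos cell_emeasure_finite in auto)
  have [measurable]: "\<nu> \<in> borel_measurable lebesgue"
    using weight_\<nu> by (rule weight_measurable)
  have S_meas [measurable]: "Q \<in> sets lebesgue" if "Q \<in> S" for Q
    using S_cell[OF that] by (rule cell_measurable)
  have ptw: "power_maximal f F x \<le> (\<Sum>R\<in>S. ennreal (jump_factor powr p) * ennreal (means f R powr p) * indicator R x)" for x
    unfolding power_maximal_def
  proof (rule SUP_least)
    fix Q assume Q: "Q \<in> F"
    show "ennreal (means f Q powr p) * indicator Q x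
      \<le> (\<Sum>R\<in>S. ennreal (jump_factor powr p) * ennreal (means f R powr p) * indicator R x)"
    proof (cases "x \<in> Q \<and> 0 < means f Q")
      case True
      then obtain R where R: "R \<in> S" "Q \<subseteq> R" "means f Q \<le> jump_factor * means f R"
        using dom[of Q] Q by (auto simp: F'_def)
      have "means f Q powr p \<le> (jump_factor * means f R) powr p"
        using R(3) p_pos means_nonneg by (intro powr_mono2) auto
      also have "\<dots> = jump_factor powr p * means f R powr p"
        using jump_factor_ge_1 means_nonneg by (subst powr_mult) auto
      finally have "ennreal (means f Q powr p) * indicator Q x
          \<le> ennreal (jump_factor powr p) * ennreal (means f R powr p) * indicator R x"
        using True R(2) by (auto simp: indicator_def ennreal_leI simp flip: ennreal_mult)
      also have "\<dots> \<le> (\<Sum>R\<in>S. ennreal (jump_factor powr p) * ennreal (means f R powr p) * indicator R x)"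
        using R(1) S_fin(1) by (intro member_le_sum) auto
      finally show ?thesis .
    next
      case False
      then have "ennreal (means f Q powr p) * indicator Q x = 0"
        using means_nonneg[of Q f] p_pos by (auto simp: indicator_def not_less)
      then show ?thesis by (simp only: zero_le)
    qed
  qed
  have "(\<integral>\<^sup>+x. power_maximal f F x * \<nu> x \<partial>lebesgue)
      \<le> (\<integral>\<^sup>+x. (\<Sum>R\<in>S. ennreal (jump_factor powr p) * ennreal (means f R powr p) * (\<nu> x * indicator R x)) \<partial>lebesgue)"
  proof (rule nn_integral_mono)
    fix x
    have "power_maximal f F x * \<nu> x
        \<le> (\<Sum>R\<in>S. ennreal (jump_factor powr p) * ennreal (means f R powr p) * indicator R x) * \<nu> x"
      using ptw by (rule mult_right_mono) simp
    also have "\<dots> = (\<Sum>R\<in>S. ennreal (jump_factor powr p) * ennreal (means f R powr p) * (\<nu> x * indicator R x))"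
      unfolding sum_distrib_right by (intro sum.cong refl) (simp only: mult_ac)
    finally show "power_maximal f F x * \<nu> x
        \<le> (\<Sum>R\<in>S. ennreal (jump_factor powr p) * ennreal (means f R powr p) * (\<nu> x * indicator R x))" .
  qed
  also have "\<dots> = ennreal (jump_factor powr p) * (\<Sum>R\<in>S. ennreal (means f R powr p) * (\<integral>\<^sup>+x\<in>R. \<nu> x \<partial>lebesgue))"
    by (simp add: nn_integral_sum nn_integral_cmult sum_distrib_left mult.assoc)
  also have "\<dots> \<le> ennreal (jump_factor powr p) * sparse_bound f"
    unfolding sparse_bound_def using S_fin S_cell sparse f energy
    by (intro mult_left_mono sparse_form_bound) auto
  finally show ?thesis .
qed

text \<open>Monotone convergence along an exhaustion by finite families.\<close>

lemma countable_family_bound: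
  assumes D: "countable D" "laminar D" and cells: "\<And>Q. Q \<in> D \<Longrightarrow> cell Q"
    and f: "\<And>i. i \<in> {1..m} \<Longrightarrow> f i \<in> borel_measurable lebesgue"
    and energy: "\<And>i. i \<in> {1..m} \<Longrightarrow> energy f i < \<infinity>"
  shows "(\<integral>\<^sup>+x. power_maximal f D x * \<nu> x \<partial>lebesgue) \<le> ennreal (jump_factor powr p) * sparse_bound f"
proof (cases "D = {}")
  case True
  then show ?thesis
    using finite_family_bound[of "{}" f] f energy by (simp add: laminar_def)
next
  case False
  define F where "F N = from_nat_into D ` {..N}" for N :: nat
  have F: "finite (F N)" "F N \<subseteq> D" for N
    using from_nat_into[OF False] by (auto simp: F_def)
  have D_eq: "D = (\<Union>N. F N)"
  proof
    show "D \<subseteq> (\<Union>N. F N)"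
    proof
      fix Q assume "Q \<in> D"
      then obtain N where "from_nat_into D N = Q"
        using from_nat_into_surj[OF D(1)] by auto
      then show "Q \<in> (\<Union>N. F N)"
        by (auto simp: F_def)
    qed
  qed (use F(2) in blast)
  have meas: "power_maximal f (F N) \<in> borel_measurable lebesgue" for N
    using F[of N] cells cell_measurable by (intro power_maximal_measurable) (auto intro: countable_finite)
  have [measurable]: "\<nu> \<in> borel_measurable lebesgue"
    using weight_\<nu> by (rule weight_measurable)
  have mono: "power_maximal f (F N) x \<le> power_maximal f (F N') x" if "N \<le> N'" for N N' x
    unfolding power_maximal_def using that by (intro SUP_subset_mono) (auto simp: F_def)
  have "power_maximal f D x = (SUP N. power_maximal f (F N) x)" for x
    unfolding power_maximal_def D_eq by (rule SUP_UNION)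
  then have "(\<integral>\<^sup>+x. power_maximal f D x * \<nu> x \<partial>lebesgue)
      = (\<integral>\<^sup>+x. (SUP N. power_maximal f (F N) x * \<nu> x) \<partial>lebesgue)"
    by (simp add: SUP_mult_right_ennreal)
  also have "\<dots> = (SUP N. \<integral>\<^sup>+x. power_maximal f (F N) x * \<nu> x \<partial>lebesgue)"
    using meas mono
    by (intro nn_integral_monotone_convergence_SUP) (auto simp: incseq_def le_fun_def intro!: mult_right_mono)
  also have "\<dots> \<le> ennreal (jump_factor powr p) * sparse_bound f"
  proof (rule SUP_least)
    fix N
    show "(\<integral>\<^sup>+x. power_maximal f (F N) x * \<nu> x \<partial>lebesgue) \<le> ennreal (jump_factor powr p) * sparse_bound f"
      using F[of N] cells f energy laminar_subset[OF D(2)] by (intro finite_family_bound) auto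
  qed
  finally show ?thesis .
qed

lemma multi_maximal_le_grids:
  assumes f: "\<And>i. i \<in> {1..m} \<Longrightarrow> f i \<in> borel_measurable lebesgue"
    and energy: "\<And>i. i \<in> {1..m} \<Longrightarrow> energy f i < \<infinity>"
  shows "multi_maximal m f x epowr p
    \<le> ennreal (((6 ^ CARD('n)) ^ m) powr p) * (\<Sum>\<alpha>\<in>UNIV. power_maximal f (grid \<alpha>) x)"
proof -
  have "(\<Prod>i\<in>{1..m}. average Q (\<lambda>y. ennreal \<bar>f i y\<bar>)) epowr p
      \<le> ennreal (((6 ^ CARD('n)) ^ m) powr p) * (\<Sum>\<alpha>\<in>UNIV. power_maximal f (grid \<alpha>) x)"
    if Q: "Q \<in> cubes" "x \<in> Q" for Q
  proof -
    obtain \<alpha> R where R: "R \<in> grid \<alpha>" "Q \<subseteq> R" "emeasure lebesgue R \<le> 6 ^ CARD('n) * emeasure lebesgue Q"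
      using cube_subset_grid[OF Q(1)] by metis
    have cell: "cell R" using R(1) by (rule cell_grid)
    have avg: "average Q (\<lambda>y. ennreal \<bar>f i y\<bar>) \<le> ennreal (6 ^ CARD('n) * mean lebesgue R (\<lambda>y. ennreal \<bar>f i y\<bar>))"
      if i: "i \<in> {1..m}" for i
    proof -
      have "average Q (\<lambda>y. ennreal \<bar>f i y\<bar>) \<le> ennreal (6 ^ CARD('n)) * average R (\<lambda>y. ennreal \<bar>f i y\<bar>)"
        using R Q(1) cell cube_emeasure_pos cube_emeasure_finite cell_measurable
        by (intro average_le_of_subset) (auto simp flip: ennreal_power)
      also have "average R (\<lambda>y. ennreal \<bar>f i y\<bar>) = ennreal (mean lebesgue R (\<lambda>y. ennreal \<bar>f i y\<bar>))"
        using cell f_integral_finite[where f=f, OF cell i f[OF i] energy[OF i]]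
        by (intro average_eq_mean cell_emeasure_pos cell_emeasure_finite)
      finally show ?thesis
        by (simp add: ennreal_mult mean_nonneg)
    qed
    have "(\<Prod>i\<in>{1..m}. average Q (\<lambda>y. ennreal \<bar>f i y\<bar>))
        \<le> (\<Prod>i\<in>{1..m}. ennreal (6 ^ CARD('n) * mean lebesgue R (\<lambda>y. ennreal \<bar>f i y\<bar>)))"
      by (rule prod_mono_ennreal) (rule avg)
    also have "\<dots> = ennreal ((6 ^ CARD('n)) ^ m * means f R)"
      by (subst prod_ennreal) (auto simp: mean_nonneg prod.distrib)
    finally have "(\<Prod>i\<in>{1..m}. average Q (\<lambda>y. ennreal \<bar>f i y\<bar>)) epowr p \<le> ennreal ((6 ^ CARD('n)) ^ m * means f R) epowr p"
      using p_pos by (intro epowr_mono) auto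
    also have "\<dots> = ennreal (((6 ^ CARD('n)) ^ m) powr p) * (ennreal (means f R powr p) * indicator R x)"
      using p_pos R(2) Q(2) means_nonneg
      by (subst epowr_ennreal_pos) (auto simp: powr_mult ennreal_mult)
    also have "\<dots> \<le> ennreal (((6 ^ CARD('n)) ^ m) powr p) * power_maximal f (grid \<alpha>) x"
      unfolding power_maximal_def using R(1) by (intro mult_left_mono SUP_upper) auto
    also have "\<dots> \<le> ennreal (((6 ^ CARD('n)) ^ m) powr p) * (\<Sum>\<alpha>\<in>UNIV. power_maximal f (grid \<alpha>) x)"
      by (intro mult_left_mono member_le_sum) auto
    finally show ?thesis .
  qed
  then show ?thesis
    unfolding multi_maximal_def epowr_SUP[OF p_pos] by (intro SUP_least) auto
qed

lemma maximal_bound_finite_norms: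
  assumes f: "\<And>i. i \<in> {1..m} \<Longrightarrow> f i \<in> borel_measurable lebesgue"
    and energy: "\<And>i. i \<in> {1..m} \<Longrightarrow> energy f i < \<infinity>"
  shows "weighted_norm p \<nu> (multi_maximal m f)
    \<le> ennreal (maximal_const CARD('n)) * A_P_const m p P w epowr (1 / p)
      * (\<Prod>i\<in>{1..m}. A_inf_const (\<sigma> i) epowr (1 / P i))
      * (\<Prod>i\<in>{1..m}. weighted_norm (P i) (w i) (\<lambda>x. ennreal \<bar>f i x\<bar>))"
proof -
  define c where "c = ((6 ^ CARD('n)) ^ m :: real) powr p"
  have c: "c > 0" by (simp add: c_def)
  have meas [measurable]: "power_maximal f (grid \<alpha>) \<in> borel_measurable lebesgue" for \<alpha>
    using cell_measurable[OF cell_grid] by (intro power_maximal_measurable countable_grid) auto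
  have [measurable]: "\<nu> \<in> borel_measurable lebesgue"
    using weight_\<nu> by (rule weight_measurable)
  have "(\<integral>\<^sup>+x. multi_maximal m f x epowr p * \<nu> x \<partial>lebesgue)
      \<le> (\<integral>\<^sup>+x. ennreal c * (\<Sum>\<alpha>\<in>UNIV. power_maximal f (grid \<alpha>) x * \<nu> x) \<partial>lebesgue)"
  proof (rule nn_integral_mono)
    fix x
    have "multi_maximal m f x epowr p * \<nu> x \<le> ennreal c * (\<Sum>\<alpha>\<in>UNIV. power_maximal f (grid \<alpha>) x) * \<nu> x"
      unfolding c_def by (intro mult_right_mono multi_maximal_le_grids f energy) auto
    then show "multi_maximal m f x epowr p * \<nu> x \<le> ennreal c * (\<Sum>\<alpha>\<in>UNIV. power_maximal f (grid \<alpha>) x * \<nu> x)"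
      by (simp add: sum_distrib_right mult.assoc)
  qed
  also have "\<dots> = ennreal c * (\<Sum>\<alpha>\<in>UNIV. \<integral>\<^sup>+x. power_maximal f (grid \<alpha>) x * \<nu> x \<partial>lebesgue)"
    by (simp add: nn_integral_cmult nn_integral_sum)
  also have "\<dots> \<le> ennreal c * (\<Sum>\<alpha>\<in>(UNIV :: ('n \<Rightarrow> bool) set). ennreal (jump_factor powr p) * sparse_bound f)"
    using f energy
    by (intro mult_left_mono sum_mono countable_family_bound countable_grid laminar_grid cell_grid) auto
  also have "\<dots> = ennreal (c * 2 ^ CARD('n) * jump_factor powr p) * sparse_bound f"
    using c by (simp add: card_fun ennreal_mult ennreal_of_nat_eq_real_of_nat mult_ac)
  finally have "weighted_norm p \<nu> (multi_maximal m f)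
      \<le> (ennreal (c * 2 ^ CARD('n) * jump_factor powr p) * sparse_bound f) epowr (1 / p)"
    unfolding weighted_norm_def using p_pos by (intro epowr_mono) auto
  also have "\<dots> = ennreal (c * 2 ^ CARD('n) * jump_factor powr p) epowr (1 / p) *
      (A_P_const m p P w epowr (1 / p) * (\<Prod>i\<in>{1..m}.
        (ennreal (2 * Carleson_const (P i)) * A_inf_const (\<sigma> i) * energy f i) epowr (1 / P i)))"
    using p_pos by (simp add: sparse_bound_def epowr_mult epowr_prod epowr_epowr)
  also have "(\<Prod>i\<in>{1..m}. (ennreal (2 * Carleson_const (P i)) * A_inf_const (\<sigma> i) * energy f i) epowr (1 / P i))
      = (\<Prod>i\<in>{1..m}. ennreal ((2 * Carleson_const (P i)) powr (1 / P i))) *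
        (\<Prod>i\<in>{1..m}. A_inf_const (\<sigma> i) epowr (1 / P i)) *
        (\<Prod>i\<in>{1..m}. weighted_norm (P i) (w i) (\<lambda>x. ennreal \<bar>f i x\<bar>))"
    unfolding prod.distrib[symmetric] weighted_norm_def
  proof (rule prod.cong)
    fix i assume i: "i \<in> {1..m}"
    show "(ennreal (2 * Carleson_const (P i)) * A_inf_const (\<sigma> i) * energy f i) epowr (1 / P i)
      = ennreal ((2 * Carleson_const (P i)) powr (1 / P i)) * A_inf_const (\<sigma> i) epowr (1 / P i)
        * energy f i epowr (1 / P i)"
      using P_pos[OF i] Carleson_const_pos[OF P_gt_1[OF i]] by (simp add: epowr_mult epowr_ennreal)
  qed simp
  also have "(\<Prod>i\<in>{1..m}. ennreal ((2 * Carleson_const (P i)) powr (1 / P i)))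
      = ennreal (\<Prod>i\<in>{1..m}. (2 * Carleson_const (P i)) powr (1 / P i))"
    by (rule prod_ennreal) simp
  also have "ennreal (c * 2 ^ CARD('n) * jump_factor powr p) epowr (1 / p)
      = ennreal ((c * 2 ^ CARD('n) * jump_factor powr p) powr (1 / p))"
    using c jump_factor_ge_1 by (intro epowr_ennreal) simp
  finally show ?thesis
    unfolding maximal_const_def c_def by (simp add: ennreal_mult prod_nonneg mult_ac)
qed

lemma A_P_const_pos: "0 < A_P_const m p P w"
proof -
  have Q: "cbox 0 (\<chi> i. (0::real^'n) $ i + 1) \<in> cubes"
    unfolding cubes_def using zero_less_one by blast
  let ?Q = "cbox 0 (\<chi> i. (0::real^'n) $ i + 1)"
  have "average ?Q \<nu> \<noteq> 0"
    using average_pos[OF weight_\<nu> Q] by simp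
  moreover have "average ?Q (\<sigma> i) epowr (p / conj_exponent (P i)) \<noteq> 0" if "i \<in> {1..m}" for i
    using average_pos[OF weight_\<sigma>[OF that] Q] p_div_conj_exponent_pos[OF that] by (simp add: epowr_eq_0_iff)
  ultimately have "0 < average ?Q \<nu> * (\<Prod>i\<in>{1..m}. average ?Q (\<sigma> i) epowr (p / conj_exponent (P i)))"
    by (simp add: zero_less_iff_neq_zero)
  then show ?thesis
    using cube_averages(1)[OF Q] by (rule less_le_trans)
qed

lemma one_le_A_inf_const_\<sigma>: "i \<in> {1..m} \<Longrightarrow> 1 \<le> A_inf_const (\<sigma> i)"
proof -
  assume i: "i \<in> {1..m}"
  have Q: "cbox 0 (\<chi> i. (0::real^'n) $ i + 1) \<in> cubes"
    unfolding cubes_def using zero_less_one by blast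
  let ?Q = "cbox 0 (\<chi> i. (0::real^'n) $ i + 1)"
  have "?Q - ?Q \<in> null_sets lebesgue" by simp
  then have "cell ?Q"
    using Q unfolding cell_def by (intro conjI bexI[OF _ Q] cube_measurable) auto
  then show ?thesis
    using Q cell_integrals(3,4)[of ?Q i] i by (intro one_le_A_inf_const) auto
qed

lemma multi_maximal_eq_0:
  assumes i: "i \<in> {1..m}" and f: "f i \<in> borel_measurable lebesgue" and "energy f i = 0"
  shows "multi_maximal m f x = 0"
proof -
  have [measurable]: "w i \<in> borel_measurable lebesgue" "f i \<in> borel_measurable lebesgue"
    using weight_w[OF i] f by (auto dest: weight_measurable)
  have "AE x in lebesgue. ennreal \<bar>f i x\<bar> epowr P i * w i x = 0"
    using assms(3) by (subst (asm) nn_integral_0_iff_AE) auto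
  moreover have "AE x in lebesgue. 0 < w i x \<and> w i x < \<infinity>"
    using weight_w[OF i] by (simp only: weight_def)
  ultimately have "AE x in lebesgue. ennreal \<bar>f i x\<bar> = 0"
    by eventually_elim (use P_pos[OF i] in \<open>auto simp: epowr_eq_0_iff\<close>)
  then have "average Q (\<lambda>y. ennreal \<bar>f i y\<bar>) = 0" for Q
  proof -
    have "(\<integral>\<^sup>+x\<in>Q. ennreal \<bar>f i x\<bar> \<partial>lebesgue) = (\<integral>\<^sup>+(x::real^'n). 0 \<partial>lebesgue)"
      using \<open>AE x in lebesgue. ennreal \<bar>f i x\<bar> = 0\<close>
      by (intro nn_integral_cong_AE) (auto elim!: eventually_mono)
    then show ?thesis by (simp add: average_def)
  qed
  then have zero: "(\<Prod>i\<in>{1..m}. average Q (\<lambda>y. ennreal \<bar>f i y\<bar>)) = 0" for Q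
    using i by (intro prod_zero bexI[of _ i]) auto
  show ?thesis
    unfolding multi_maximal_def zero by (simp add: SUP_constant bot_ennreal)
qed

text \<open>If some norm is infinite, then the right-hand side is infinite unless some norm vanishes; in that
case one of the functions is zero almost everywhere and so is the left-hand side.\<close>

theorem maximal_bound:
  assumes f: "\<And>i. i \<in> {1..m} \<Longrightarrow> f i \<in> borel_measurable lebesgue"
  shows "weighted_norm p \<nu> (multi_maximal m f)
    \<le> ennreal (maximal_const CARD('n)) * A_P_const m p P w epowr (1 / p)
      * (\<Prod>i\<in>{1..m}. A_inf_const (\<sigma> i) epowr (1 / P i))
      * (\<Prod>i\<in>{1..m}. weighted_norm (P i) (w i) (\<lambda>x. ennreal \<bar>f i x\<bar>))"
    (is "_ \<le> ?c * ?A * ?I * ?N")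
proof -
  consider "\<forall>i\<in>{1..m}. energy f i < \<infinity>" | "\<exists>i\<in>{1..m}. energy f i = 0"
    | "\<forall>i\<in>{1..m}. energy f i \<noteq> 0" "\<exists>i\<in>{1..m}. energy f i = \<infinity>"
    unfolding infinity_ennreal_def less_top[symmetric] by blast
  then show ?thesis
  proof cases
    case 1
    then show ?thesis using f by (intro maximal_bound_finite_norms) auto
  next
    case 2
    then have "multi_maximal m f x = 0" for x
      using multi_maximal_eq_0 f by blast
    then show ?thesis
      using p_pos by (simp add: weighted_norm_def)
  next
    case 3
    have N: "weighted_norm (P i) (w i) (\<lambda>x. ennreal \<bar>f i x\<bar>) \<noteq> 0" if "i \<in> {1..m}" for i
      using 3(1) that P_pos[OF that] by (simp add: weighted_norm_def epowr_eq_0_iff)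
    obtain j where j: "j \<in> {1..m}" "energy f j = top" using 3(2) by auto
    have "weighted_norm (P j) (w j) (\<lambda>x. ennreal \<bar>f j x\<bar>) = top"
      using j P_pos[OF j(1)] by (simp add: weighted_norm_def)
    then have "?N = top"
      using N j(1) by (auto simp: ennreal_prod_eq_top)
    moreover have "?I \<noteq> 0"
      using one_le_A_inf_const_\<sigma> P_pos by (force simp: epowr_eq_0_iff)
    moreover have "?A \<noteq> 0"
      using A_P_const_pos p_pos by (simp add: epowr_eq_0_iff)
    moreover have "?c \<noteq> 0"
      using maximal_const_pos[of "CARD('n)"] by (simp add: ennreal_eq_0_iff)
    ultimately have "?c * ?A * ?I * ?N = top"
      by simp
    then show ?thesis by simp
  qed
qed

end

section \<open>Multilinear weights made from a single \<open>A\<^sub>1\<close> weight\<close>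

lemma A_inf_const_le:
  assumes s: "s \<in> borel_measurable lebesgue"
    and A1: "\<And>Q x. Q \<in> cubes \<Longrightarrow> x \<in> Q \<Longrightarrow> average Q s \<le> ennreal L * s x"
  shows "A_inf_const s \<le> ennreal L"
  unfolding A_inf_const_def
proof (rule SUP_least, rule divide_le_ennreal_of_le_mult)
  fix R :: "(real^'a) set" assume R: "R \<in> cubes"
  have [measurable]: "s \<in> borel_measurable lebesgue" "R \<in> sets lebesgue"
    using s R by (auto simp: cube_measurable)
  have "HL_maximal (\<lambda>y. s y * indicator R y) x \<le> ennreal L * s x" for x
    unfolding HL_maximal_def
  proof (rule SUP_least)
    fix Q assume Q: "Q \<in> {Q \<in> cubes. x \<in> Q}"
    have "average Q (\<lambda>y. s y * indicator R y) \<le> average Q s"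
      unfolding average_def by (intro divide_right_mono_ennreal nn_integral_mono) (auto simp: indicator_def)
    also have "\<dots> \<le> ennreal L * s x"
      using A1 Q by auto
    finally show "average Q (\<lambda>y. s y * indicator R y) \<le> ennreal L * s x" .
  qed
  then have "(\<integral>\<^sup>+x\<in>R. HL_maximal (\<lambda>y. s y * indicator R y) x \<partial>lebesgue)
      \<le> (\<integral>\<^sup>+x. ennreal L * (s x * indicator R x) \<partial>lebesgue)"
    by (intro nn_integral_mono) (auto simp: indicator_def)
  also have "\<dots> = ennreal L * (\<integral>\<^sup>+x\<in>R. s x \<partial>lebesgue)"
    by (rule nn_integral_cmult) measurable
  finally show "(\<integral>\<^sup>+x\<in>R. HL_maximal (\<lambda>y. s y * indicator R y) x \<partial>lebesgue)
      \<le> ennreal L * (\<integral>\<^sup>+x\<in>R. s x \<partial>lebesgue)" .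
qed

lemma sigma_weight_dual:
  assumes "1 < q"
  shows "sigma_weight q (\<lambda>x. s x epowr (1 - q)) = s"
proof -
  have "(1 - q) * (1 - conj_exponent q) = 1"
    using assms by (simp add: conj_exponent_def field_simps)
  then show ?thesis
    by (simp add: sigma_weight_def fun_eq_iff epowr_epowr)
qed

text \<open>Integrate Young's inequality \<open>1 + s \<le> (c / r)\<^sup>s + s r / c\<close>, where \<open>r\<close> is the value of the weight and \<open>c\<close> its average; the last
term has average \<open>s\<close>.\<close>

lemma average_dual_ge_1:
  assumes w: "weight w" and s: "0 < s" and Q: "Q \<in> cubes"
  shows "1 \<le> average Q (\<lambda>x. w x epowr (- s)) * average Q w epowr s"
proof (cases "average Q w = top")
  case True
  then show ?thesis
    using average_pos[OF weight_epowr[OF w, of "- s"] Q] s by (simp add: ennreal_mult_top)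
next
  note Q' = cube_measurable[OF Q] cube_emeasure_pos[OF Q] cube_emeasure_finite[OF Q]
  case False
  then obtain c where c: "0 < c" "average Q w = ennreal c"
    using average_pos[OF w Q] by (cases "average Q w" rule: ennreal_0_top_pos_cases) auto
  have [measurable]: "w \<in> borel_measurable lebesgue" "(\<lambda>x. w x epowr (- s)) \<in> borel_measurable lebesgue"
      "Q \<in> sets lebesgue"
    using w weight_epowr[OF w] Q' by (auto intro: weight_measurable)
  have young: "1 + s \<le> c powr s * r powr (- s) + s / c * r" if "0 < r" for r
  proof -
    have "1 + (- s) * ln (r / c) \<le> exp ((- s) * ln (r / c))"
      by (rule exp_ge_add_one_self)
    also have "\<dots> = c powr s * r powr (- s)"
      using that c by (simp add: powr_def ln_div algebra_simps flip: exp_add)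
    finally have "1 - s * ln (r / c) \<le> c powr s * r powr (- s)" by simp
    moreover have "s * ln (r / c) \<le> s * (r / c - 1)"
      using that c s by (intro mult_left_mono ln_le_minus_one) auto
    ultimately show ?thesis
      by (simp add: algebra_simps)
  qed
  have "ennreal (1 + s) * emeasure lebesgue Q = (\<integral>\<^sup>+x\<in>Q. ennreal (1 + s) \<partial>lebesgue)"
    using Q' by (intro nn_integral_cmult_indicator[symmetric])
  also have "\<dots> \<le> (\<integral>\<^sup>+x. (ennreal (c powr s) * w x epowr (- s)) * indicator Q x
      + (ennreal (s / c) * w x) * indicator Q x \<partial>lebesgue)"
  proof (rule nn_integral_mono_AE)
    have "AE x in lebesgue. 0 < w x \<and> w x < \<infinity>"
      using w by (simp only: weight_def)
    then show "AE x in lebesgue. ennreal (1 + s) * indicator Q x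
      \<le> (ennreal (c powr s) * w x epowr (- s)) * indicator Q x + (ennreal (s / c) * w x) * indicator Q x"
    proof eventually_elim
      case (elim x)
      then obtain r where r: "0 < r" "w x = ennreal r"
        by (cases "w x" rule: ennreal_0_top_pos_cases) auto
      have "ennreal (1 + s) \<le> ennreal (c powr s * r powr (- s) + s / c * r)"
        using young[OF r(1)] by (rule ennreal_leI)
      also have "\<dots> = ennreal (c powr s) * w x epowr (- s) + ennreal (s / c) * w x"
      proof -
        have "ennreal (s / c * r) = ennreal (s / c) * ennreal r"
          using r c s by (intro ennreal_mult) auto
        then show ?thesis
          using r c s by (simp add: epowr_ennreal ennreal_mult del: times_divide_eq_left)
      qed
      finally show ?case by (auto simp: indicator_def)
    qed
  qed
  also have "\<dots> = (\<integral>\<^sup>+x\<in>Q. ennreal (c powr s) * w x epowr (- s) \<partial>lebesgue) + (\<integral>\<^sup>+x\<in>Q. ennreal (s / c) * w x \<partial>lebesgue)"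
    by (rule nn_integral_add) measurable
  finally have "ennreal (1 + s) * emeasure lebesgue Q / emeasure lebesgue Q
      \<le> average Q (\<lambda>x. ennreal (c powr s) * w x epowr (- s)) + average Q (\<lambda>x. ennreal (s / c) * w x)"
    unfolding average_def add_divide_distrib_ennreal[symmetric] by (rule divide_right_mono_ennreal)
  moreover have "ennreal (1 + s) * emeasure lebesgue Q / emeasure lebesgue Q = ennreal (1 + s)"
    using Q' by (intro mult_divide_eq_ennreal) auto
  moreover have "average Q (\<lambda>x. ennreal (s / c) * w x) = ennreal s"
  proof -
    have "average Q (\<lambda>x. ennreal (s / c) * w x) = ennreal (s / c) * ennreal c"
      unfolding c(2)[symmetric] by (rule average_cmult) measurable
    also have "\<dots> = ennreal s"
      using c s by (simp flip: ennreal_mult)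
    finally show ?thesis .
  qed
  moreover have "average Q (\<lambda>x. ennreal (c powr s) * w x epowr (- s)) = average Q w epowr s * average Q (\<lambda>x. w x epowr (- s))"
    using c by (subst average_cmult) (auto simp: epowr_ennreal)
  ultimately have "ennreal s + 1 \<le> ennreal s + average Q (\<lambda>x. w x epowr (- s)) * average Q w epowr s"
    using s by (simp add: ac_simps ennreal_plus)
  then show ?thesis
    by (simp add: ennreal_add_left_cancel_le)
qed

text \<open>For a single weight \<open>s\<close> put \<open>w\<^sub>i = s powr (1 - P i)\<close>. Then all dual weights equal \<open>s\<close>, the weight \<open>\<nu>\<close> is
\<open>s powr - (m p - 1)\<close>, and the multilinear constant becomes a quantity that the \<open>A\<^sub>1\<close> constant controls:
if the average of \<open>s\<close> over every cube is at most \<open>L\<close> times each value on it, then the constant is at most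
\<open>L powr (m p - 1)\<close>.\<close>

context Hoelder_exponents
begin

lemma nu_weight_dual:
  "nu_weight m p P (\<lambda>i x. s x epowr (1 - P i)) x = s x epowr (- (m * p - 1))"
proof -
  have "(s x epowr (1 - P i)) epowr (p / P i) = (s x epowr (- 1)) epowr (p / conj_exponent (P i))"
    if "i \<in> {1..m}" for i
  proof -
    have "(1 - P i) * (p / P i) = - 1 * (p - p / P i)"
      using P_gt_1[OF that] by (simp add: field_simps)
    then show ?thesis
      by (simp only: epowr_epowr p_div_conj_exponent[OF that])
  qed
  then have "nu_weight m p P (\<lambda>i x. s x epowr (1 - P i)) x
      = (\<Prod>i\<in>{1..m}. (s x epowr (- 1)) epowr (p / conj_exponent (P i)))"
    by (simp add: nu_weight_def)
  also have "\<dots> = (s x epowr (- 1)) epowr (m * p - 1)"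
    unfolding sum_p_div_conj_exponent[symmetric]
    using p_div_conj_exponent_pos by (intro epowr_sum[symmetric]) (auto intro: less_imp_le)
  finally show ?thesis
    by (simp add: epowr_epowr)
qed

lemma A_P_const_dual:
  "A_P_const m p P (\<lambda>i x. s x epowr (1 - P i))
    = (SUP Q\<in>cubes. average Q (\<lambda>x. s x epowr (- (m * p - 1))) * average Q s epowr (m * p - 1))"
proof -
  have "(\<Prod>i\<in>{1..m}. average Q (sigma_weight (P i) (\<lambda>x. s x epowr (1 - P i))) epowr (p / conj_exponent (P i)))
      = average Q s epowr (m * p - 1)" for Q
  proof -
    have "(\<Prod>i\<in>{1..m}. average Q (sigma_weight (P i) (\<lambda>x. s x epowr (1 - P i))) epowr (p / conj_exponent (P i)))
        = (\<Prod>i\<in>{1..m}. average Q s epowr (p / conj_exponent (P i)))"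
      using P_gt_1 by (simp add: sigma_weight_dual)
    also have "\<dots> = average Q s epowr (m * p - 1)"
      unfolding sum_p_div_conj_exponent[symmetric]
      using p_div_conj_exponent_pos by (intro epowr_sum[symmetric]) (auto intro: less_imp_le)
    finally show ?thesis .
  qed
  then show ?thesis
    unfolding A_P_const_def nu_weight_dual[abs_def] by simp
qed

lemma A_P_const_dual_le:
  assumes w: "weight s" and L: "0 < L"
    and A1: "\<And>Q x. Q \<in> cubes \<Longrightarrow> x \<in> Q \<Longrightarrow> average Q s \<le> ennreal L * s x"
  shows "A_P_const m p P (\<lambda>i x. s x epowr (1 - P i)) \<le> ennreal (L powr (m * p - 1))"
  unfolding A_P_const_dual
proof (rule SUP_least)
  let ?e = "m * p - 1"
  have e: "0 < ?e" using mp_gt_1 by simp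
  fix Q :: "(real^'a) set" assume Q: "Q \<in> cubes"
  have meas: "(\<lambda>x. s x epowr (- ?e)) \<in> borel_measurable lebesgue"
    using weight_epowr[OF w] by (rule weight_measurable)
  have "average Q (\<lambda>x. s x epowr (- ?e)) * average Q s epowr ?e = average Q (\<lambda>x. average Q s epowr ?e * s x epowr (- ?e))"
    unfolding average_cmult[OF meas cube_measurable[OF Q]] by (rule mult.commute)
  also have "\<dots> \<le> ennreal (L powr ?e)"
  proof (rule average_le_const[OF Q])
    fix x assume x: "x \<in> Q"
    have "average Q s epowr ?e * s x epowr (- ?e) \<le> (ennreal L * s x) epowr ?e * s x epowr (- ?e)"
      using A1[OF Q x] e by (intro mult_right_mono epowr_mono) auto
    also have "\<dots> = ennreal (L powr ?e) * (s x epowr (- ?e) * s x epowr ?e)"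
      using e L by (subst epowr_mult) (auto simp: epowr_ennreal mult_ac)
    also have "\<dots> \<le> ennreal (L powr ?e) * 1"
      by (intro mult_left_mono epowr_minus_mult_le_1) auto
    finally show "average Q s epowr ?e * s x epowr (- ?e) \<le> ennreal (L powr ?e)" by simp
  qed
  finally show "average Q (\<lambda>x. s x epowr (- ?e)) * average Q s epowr ?e \<le> ennreal (L powr ?e)" .
qed

lemma one_le_A_P_const_dual:
  fixes s :: "real^'n \<Rightarrow> ennreal"
  assumes "weight s"
  shows "1 \<le> A_P_const m p P (\<lambda>i x. s x epowr (1 - P i))"
proof -
  obtain Q :: "(real^'n) set" where Q: "Q \<in> cubes"
    unfolding cubes_def using zero_less_one by blast
  have "1 \<le> average Q (\<lambda>x. s x epowr (- (m * p - 1))) * average Q s epowr (m * p - 1)"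
    using assms mp_gt_1 Q by (intro average_dual_ge_1) auto
  also have "\<dots> \<le> A_P_const m p P (\<lambda>i x. s x epowr (1 - P i))"
    unfolding A_P_const_dual using Q by (intro SUP_upper)
  finally show ?thesis .
qed

text \<open>Testing an inequality with exponents \<open>a\<close> and \<open>b\<close> on an \<open>A\<^sub>1\<close> weight \<open>s\<close> and the functions
\<open>f\<^sub>i = s\<close> on a cube \<open>B\<close>. All norms are powers of the integral of \<open>s\<close> over \<open>B\<close>. If almost every point of \<open>B\<close> lies in a
subcube with average at least \<open>l s\<close>, then the maximal function is at least \<open>(l s)\<^sup>m\<close> on \<open>B\<close>, whose norm is \<open>l\<^sup>m\<close> times
the same power of that integral. The integral cancels, and \<open>l\<^sup>m\<close> is left to be compared with the weight constants.
The positive parts of the exponents are taken because the weight constants are at least \<open>1\<close>.\<close>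

lemma exponents_necessary:
  fixes s :: "real^'n \<Rightarrow> ennreal" and a :: real and b :: "nat \<Rightarrow> real"
  assumes w: "weight s" and L: "1 \<le> L" and l: "0 < l"
    and A1: "\<And>Q x. Q \<in> cubes \<Longrightarrow> x \<in> Q \<Longrightarrow> average Q s \<le> ennreal L * s x"
    and B: "B \<in> cubes" and B_fin: "(\<integral>\<^sup>+x\<in>B. s x \<partial>lebesgue) < \<infinity>"
    and reverse: "AE x in lebesgue. x \<in> B \<longrightarrow>
      (\<exists>Q\<in>cubes. x \<in> Q \<and> Q \<subseteq> B \<and> ennreal l * s x \<le> average Q s)"
    and bound: "\<And>(w :: nat \<Rightarrow> real^'n \<Rightarrow> ennreal) f. w \<in> A_P m p P \<Longrightarrow>
        (\<And>i. i \<in> {1..m} \<Longrightarrow> f i \<in> borel_measurable lebesgue) \<Longrightarrow>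
        weighted_norm p (nu_weight m p P w) (multi_maximal m f)
          \<le> ennreal C * A_P_const m p P w epowr a
            * (\<Prod>i\<in>{1..m}. A_inf_const (sigma_weight (P i) (w i)) epowr b i)
            * (\<Prod>i\<in>{1..m}. weighted_norm (P i) (w i) (\<lambda>x. ennreal \<bar>f i x\<bar>))"
  shows "l ^ m \<le> max C 0 * L powr ((m * p - 1) * max a 0 + (\<Sum>i\<in>{1..m}. max (b i) 0))"
proof -
  define w' where "w' = (\<lambda>(i::nat) x. s x epowr (1 - P i))"
  \<comment> \<open>The conversion to a real number alters \<open>s\<close> only on the null set where it is infinite.\<close>
  define f where "f = (\<lambda>(i::nat) x. enn2real (s x) * indicator B x :: real)"
  let ?e = "m * p - 1"
  have e: "0 < ?e" using mp_gt_1 by simp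
  have [measurable]: "s \<in> borel_measurable lebesgue" "B \<in> sets lebesgue"
    using w B by (auto intro: weight_measurable cube_measurable)
  have f_meas: "f i \<in> borel_measurable lebesgue" for i
    unfolding f_def by measurable
  define I where "I = (\<integral>\<^sup>+x\<in>B. s x \<partial>lebesgue)"
  have I: "0 < I" "I < top"
    using weight_integral_pos[OF w] cube_emeasure_pos[OF B] B_fin by (auto simp: I_def)
  have AE_s: "AE x in lebesgue. 0 < s x \<and> s x < \<infinity>"
    using w by (simp only: weight_def)
  have \<sigma>_eq: "sigma_weight (P i) (w' i) = s" if "i \<in> {1..m}" for i
    unfolding w'_def using P_gt_1[OF that] by (rule sigma_weight_dual)
  have A_P_le: "A_P_const m p P w' \<le> ennreal (L powr ?e)"
    unfolding w'_def using L by (intro A_P_const_dual_le w A1) auto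
  have A_P_ge: "1 \<le> A_P_const m p P w'"
    unfolding w'_def using w by (rule one_le_A_P_const_dual)
  have A_inf_le: "A_inf_const s \<le> ennreal L"
    using A1 by (intro A_inf_const_le) auto
  have A_inf_ge: "1 \<le> A_inf_const s"
    using B I by (intro one_le_A_inf_const[of B]) (auto simp: I_def)
  have "w' \<in> A_P m p P"
    using A_P_le weight_epowr[OF w] by (auto simp: A_P_def w'_def elim: le_less_trans)
  note main = bound[OF this f_meas]
  have abs_f: "ennreal \<bar>f i x\<bar> = s x * indicator B x" if "s x < \<infinity>" for i x
    using that by (auto simp: f_def indicator_def less_top)
  have f_norm: "weighted_norm (P i) (w' i) (\<lambda>x. ennreal \<bar>f i x\<bar>) = I epowr (1 / P i)" if i: "i \<in> {1..m}" for i
  proof -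
    have "(\<integral>\<^sup>+x. ennreal \<bar>f i x\<bar> epowr P i * w' i x \<partial>lebesgue) = I"
      unfolding I_def
    proof (rule nn_integral_cong_AE)
      show "AE x in lebesgue. ennreal \<bar>f i x\<bar> epowr P i * w' i x = s x * indicator B x"
        using AE_s
      proof eventually_elim
        case (elim x)
        then obtain r where r: "0 < r" "s x = ennreal r"
          by (cases "s x" rule: ennreal_0_top_pos_cases) auto
        have "r powr P i * r powr (1 - P i) = r"
          using r by (simp flip: powr_add)
        then show ?case
          using r elim P_gt_1[OF i] by (auto simp: abs_f w'_def indicator_def epowr_ennreal simp flip: ennreal_mult)
      qed
    qed
    then show ?thesis by (simp add: weighted_norm_def)
  qed
  have average_f: "average Q (\<lambda>y. ennreal \<bar>f i y\<bar>) = average Q s" if "Q \<subseteq> B" for Q i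
  proof -
    have "(\<integral>\<^sup>+x\<in>Q. ennreal \<bar>f i x\<bar> \<partial>lebesgue) = (\<integral>\<^sup>+x\<in>Q. s x \<partial>lebesgue)"
    proof (rule nn_integral_cong_AE)
      show "AE x in lebesgue. ennreal \<bar>f i x\<bar> * indicator Q x = s x * indicator Q x"
        using AE_s by eventually_elim (use that in \<open>auto simp: abs_f indicator_def\<close>)
    qed
    then show ?thesis by (simp add: average_def)
  qed
  \<comment> \<open>On \<open>B\<close> the integrand is \<open>(l s)\<^sup>m\<^sup>p \<nu> = l\<^sup>m\<^sup>p s\<close>, because \<open>\<nu> = s powr (1 - m p)\<close>.\<close>
  have "ennreal (l ^ m) * I epowr (1 / p) \<le> weighted_norm p (nu_weight m p P w') (multi_maximal m f)"
  proof -
    have "ennreal ((l ^ m) powr p) * I = (\<integral>\<^sup>+x. ennreal ((l ^ m) powr p) * (s x * indicator B x) \<partial>lebesgue)"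
      unfolding I_def by (rule nn_integral_cmult[symmetric]) measurable
    also have "\<dots> \<le> (\<integral>\<^sup>+x. multi_maximal m f x epowr p * nu_weight m p P w' x \<partial>lebesgue)"
    proof (rule nn_integral_mono_AE)
      show "AE x in lebesgue. ennreal ((l ^ m) powr p) * (s x * indicator B x)
          \<le> multi_maximal m f x epowr p * nu_weight m p P w' x"
        using AE_s reverse
      proof eventually_elim
        case (elim x)
        show ?case
        proof (cases "x \<in> B")
          case True
          obtain r where r: "0 < r" "s x = ennreal r"
            using elim by (cases "s x" rule: ennreal_0_top_pos_cases) auto
          obtain Q where Q: "Q \<in> cubes" "x \<in> Q" "Q \<subseteq> B" "ennreal l * s x \<le> average Q s"
            using elim True by auto
          have "ennreal ((l * r) ^ m) = (ennreal l * s x) ^ m"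
            using r l by (simp add: ennreal_power flip: ennreal_mult)
          also have "\<dots> \<le> average Q s ^ m"
            using Q(4) by (intro power_mono) auto
          also have "\<dots> = (\<Prod>i\<in>{1..m}. average Q (\<lambda>y. ennreal \<bar>f i y\<bar>))"
            by (simp add: average_f[OF Q(3)])
          also have "\<dots> \<le> multi_maximal m f x"
            unfolding multi_maximal_def using Q by (intro SUP_upper) auto
          finally have "ennreal ((l * r) ^ m) epowr p \<le> multi_maximal m f x epowr p"
            using p_pos by (intro epowr_mono) auto
          then have "ennreal ((l * r) ^ m) epowr p * nu_weight m p P w' x
              \<le> multi_maximal m f x epowr p * nu_weight m p P w' x"
            by (rule mult_right_mono) simp
          moreover have "ennreal ((l * r) ^ m) epowr p * nu_weight m p P w' x = ennreal ((l ^ m) powr p) * (s x * indicator B x)"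
          proof -
            have "((l * r) ^ m) powr p * r powr (- ?e) = (l ^ m) powr p * (r powr (m * p) * r powr (- ?e))"
              using r l by (simp add: power_mult_distrib powr_mult powr_powr flip: powr_realpow)
            also have "r powr (m * p) * r powr (- ?e) = r"
              using r by (simp flip: powr_add)
            finally show ?thesis
              unfolding w'_def nu_weight_dual using r l True
              by (simp add: epowr_ennreal flip: ennreal_mult)
          qed
          ultimately show ?thesis by simp
        qed simp
      qed
    qed
    finally have "(ennreal ((l ^ m) powr p) * I) epowr (1 / p) \<le> weighted_norm p (nu_weight m p P w') (multi_maximal m f)"
      unfolding weighted_norm_def using p_pos by (intro epowr_mono) auto
    then show ?thesis
      using p_pos l by (simp add: epowr_mult epowr_ennreal powr_powr)
  qed
  also note main
  also have "(\<Prod>i\<in>{1..m}. weighted_norm (P i) (w' i) (\<lambda>x. ennreal \<bar>f i x\<bar>)) = I epowr (1 / p)"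
    unfolding p_def using f_norm P_pos by (subst epowr_sum) (auto intro: less_imp_le)
  also have "(\<Prod>i\<in>{1..m}. A_inf_const (sigma_weight (P i) (w' i)) epowr b i)
      = (\<Prod>i\<in>{1..m}. A_inf_const s epowr b i)"
    using \<sigma>_eq by simp
  finally have le: "I epowr (1 / p) * ennreal (l ^ m)
      \<le> I epowr (1 / p) * (ennreal C * A_P_const m p P w' epowr a * (\<Prod>i\<in>{1..m}. A_inf_const s epowr b i))"
    by (simp add: mult_ac)
  obtain t where t: "0 < t" "I epowr (1 / p) = ennreal t"
  proof (cases I rule: ennreal_0_top_pos_cases)
    case (pos r)
    then show ?thesis using that[of "r powr (1 / p)"] by (simp add: epowr_ennreal)
  qed (use I in auto)
  have "ennreal (l ^ m) \<le> ennreal C * A_P_const m p P w' epowr a * (\<Prod>i\<in>{1..m}. A_inf_const s epowr b i)"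
    using le t by (simp only:) (subst (asm) ennreal_mult_le_mult_iff, auto)
  also have "\<dots> \<le> ennreal (max C 0) * ennreal (L powr (?e * max a 0)) * (\<Prod>i\<in>{1..m}. ennreal (L powr max (b i) 0))"
  proof -
    have up: "x epowr c \<le> ennreal (y powr (max c 0))" if "1 \<le> x" "x \<le> ennreal y" for x c y
    proof (cases "0 \<le> c")
      case True
      have "1 \<le> ennreal y" using that by (rule order_trans)
      then have "1 \<le> y" by simp
      then show ?thesis
        using True epowr_mono[OF True that(2)] by (simp add: epowr_ennreal)
    next
      case False
      have "1 \<le> ennreal y" using that by (rule order_trans)
      then have "1 \<le> y" by simp
      then show ?thesis
        using False epowr_mono_neg[of c 1 x] that by simp
    qed
    have "A_P_const m p P w' epowr a \<le> ennreal ((L powr ?e) powr max a 0)"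
      using A_P_ge A_P_le by (rule up)
    then show ?thesis
      using up[OF A_inf_ge A_inf_le]
      by (intro mult_mono prod_mono_ennreal) (auto simp: powr_powr intro: ennreal_leI)
  qed
  also have "\<dots> = ennreal (max C 0 * L powr (?e * max a 0 + (\<Sum>i\<in>{1..m}. max (b i) 0)))"
    using L by (simp add: prod_ennreal powr_add powr_sum ennreal_mult prod_nonneg mult.assoc)
  finally show ?thesis
    by (subst (asm) ennreal_le_iff) auto
qed

end

section \<open>Power weights\<close>

text \<open>The weight \<open>\<bar>x\<bar> powr (\<delta> - n)\<close>, for the maximum norm in order that its balls are cubes. For \<open>\<delta> < n\<close> it is \<open>\<infinity>\<close> at the
origin, so that the \<open>A\<^sub>1\<close> inequality below holds at every point.\<close>

definition power_weight :: "real \<Rightarrow> real^'n \<Rightarrow> ennreal" where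
  "power_weight \<delta> x = ennreal (infnorm x) epowr (\<delta> - real CARD('n))"

definition centered_cube :: "real \<Rightarrow> (real^'n) set" where
  "centered_cube t = {x. infnorm x \<le> t}"

lemma infnorm_le_iff: "infnorm (x :: real^'n) \<le> t \<longleftrightarrow> (\<forall>i. \<bar>x $ i\<bar> \<le> t)"
proof
  assume "infnorm x \<le> t"
  then show "\<forall>i. \<bar>x $ i\<bar> \<le> t"
    using component_le_infnorm_cart order_trans by blast
next
  assume *: "\<forall>i. \<bar>x $ i\<bar> \<le> t"
  show "infnorm x \<le> t"
    unfolding infnorm_cart by (rule cSup_least) (use * in auto)
qed

lemma centered_cube_eq:
  "centered_cube t = cbox (\<chi> i. - t) (\<chi> i. (\<chi> i. - t :: real^'n) $ i + 2 * t)"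
  unfolding centered_cube_def infnorm_le_iff cbox_cube by (auto simp: abs_le_iff minus_le_iff)

lemma centered_cube_in_cubes: "0 < t \<Longrightarrow> (centered_cube t :: (real^'n) set) \<in> cubes"
  unfolding centered_cube_eq cubes_def by (intro CollectI exI[of _ "\<chi> i. - t"] exI[of _ "2 * t"]) auto

lemma emeasure_centered_cube:
  "0 \<le> t \<Longrightarrow> emeasure lebesgue (centered_cube t :: (real^'n) set) = ennreal ((2 * t) ^ CARD('n))"
  unfolding centered_cube_eq by (rule emeasure_cbox_cube) simp

lemma centered_cube_measurable [measurable]: "centered_cube t \<in> sets lebesgue"
  unfolding centered_cube_eq by simp

lemma infnorm_measurable [measurable]: "(infnorm :: real^'n \<Rightarrow> real) \<in> borel_measurable lebesgue"
proof -
  have "(infnorm :: real^'n \<Rightarrow> real) \<in> borel_measurable borel"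
    by (intro borel_measurable_continuous_onI continuous_on_infnorm continuous_on_id)
  then show ?thesis
    by (intro measurable_completion) simp
qed

lemma weight_power_weight: "weight (power_weight \<delta> :: real^'n \<Rightarrow> ennreal)"
proof -
  have [measurable]: "(power_weight \<delta> :: real^'n \<Rightarrow> ennreal) \<in> borel_measurable lebesgue"
    unfolding power_weight_def[abs_def] by measurable
  have "{0 :: real^'n} \<in> null_sets lebesgue"
    by (auto intro: null_sets_completionI)
  from AE_not_in[OF this] have "AE x in lebesgue. 0 < power_weight \<delta> (x :: real^'n) \<and> power_weight \<delta> x < \<infinity>"
  proof eventually_elim
    case (elim x)
    then have "0 < infnorm x"
      by (simp add: infnorm_pos_lt)
    then show ?case
      by (simp add: power_weight_def epowr_ennreal)
  qed
  then show ?thesis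
    unfolding weight_def by simp
qed

definition annulus :: "real \<Rightarrow> (real^'n) set" where
  "annulus t = centered_cube t - centered_cube (t / 2)"

lemma emeasure_annulus:
  assumes "0 < t"
  shows "emeasure lebesgue (annulus t :: (real^'n) set) = ennreal ((2 ^ CARD('n) - 1) * t ^ CARD('n))"
proof -
  have "emeasure lebesgue (annulus t :: (real^'n) set)
      = emeasure lebesgue (centered_cube t :: (real^'n) set) - emeasure lebesgue (centered_cube (t / 2) :: (real^'n) set)"
    unfolding annulus_def
  proof (rule emeasure_Diff)
    show "emeasure lebesgue (centered_cube (t / 2) :: (real^'n) set) \<noteq> \<infinity>"
      using assms emeasure_centered_cube[of "t / 2", where 'n = 'n] by simp
    show "centered_cube (t / 2) \<subseteq> (centered_cube t :: (real^'n) set)"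
      using assms by (auto simp: centered_cube_def)
  qed (rule centered_cube_measurable)+
  also have "\<dots> = ennreal ((2 * t) ^ CARD('n) - t ^ CARD('n))"
    using assms emeasure_centered_cube[of t, where 'n = 'n] emeasure_centered_cube[of "t / 2", where 'n = 'n]
    by (simp add: ennreal_minus del: emeasure_completion)
  finally show ?thesis
    by (simp add: power_mult_distrib algebra_simps)
qed

text \<open>On a dyadic annulus the weight is constant up to the factor \<open>2\<^sup>n\<close>.\<close>

lemma power_weight_annulus:
  fixes x :: "real^'n"
  assumes "x \<in> annulus t" and "0 < t" and "0 \<le> \<delta>" and "\<delta> \<le> 1"
  shows "ennreal (t powr (\<delta> - real CARD('n))) \<le> power_weight \<delta> x"
    and "power_weight \<delta> x \<le> ennreal (2 ^ CARD('n) * t powr (\<delta> - real CARD('n)))"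
proof -
  let ?e = "\<delta> - real CARD('n)"
  have r: "t / 2 < infnorm x" "infnorm x \<le> t"
    using assms(1) by (auto simp: annulus_def centered_cube_def)
  have "1 \<le> CARD('n)"
    by (simp add: Suc_leI)
  then have e: "?e \<le> 0"
    using assms(4) by linarith
  have r0: "0 < infnorm x" using r assms(2) by linarith
  then have eq: "power_weight \<delta> x = ennreal (infnorm x powr ?e)"
    by (simp add: power_weight_def epowr_ennreal)
  show "ennreal (t powr ?e) \<le> power_weight \<delta> x"
    unfolding eq using r r0 e by (intro ennreal_leI powr_mono2') auto
  have "infnorm x powr ?e \<le> (t / 2) powr ?e"
    using r e assms(2) by (intro powr_mono2') auto
  also have "\<dots> = 2 powr (real CARD('n) - \<delta>) * t powr ?e"
    using assms(2) by (simp add: powr_divide powr_diff)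
  also have "\<dots> \<le> 2 powr (real CARD('n)) * t powr ?e"
    using assms(3) by (intro mult_right_mono powr_mono) auto
  finally show "power_weight \<delta> x \<le> ennreal (2 ^ CARD('n) * t powr ?e)"
    unfolding eq by (intro ennreal_leI) (simp add: powr_realpow)
qed

lemma annulus_cover:
  assumes "0 < t"
  shows "(\<Union>k. annulus (t / 2 ^ k)) = (centered_cube t - {0} :: (real^'n) set)"
proof -
  have "x \<in> (\<Union>k. annulus (t / 2 ^ k)) \<longleftrightarrow> infnorm x \<le> t \<and> x \<noteq> 0" for x :: "real^'n"
  proof
    assume "x \<in> (\<Union>k. annulus (t / 2 ^ k))"
    then obtain k where "x \<in> annulus (t / 2 ^ k)"
      by auto
    then have k: "t / 2 ^ k / 2 < infnorm x" "infnorm x \<le> t / 2 ^ k"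
      by (simp_all add: annulus_def centered_cube_def)
    have "0 < infnorm x"
      using k(1) assms by (smt (verit) divide_pos_pos zero_less_power)
    moreover have "t / 2 ^ k \<le> t"
      using assms by (simp add: field_simps)
    ultimately show "infnorm x \<le> t \<and> x \<noteq> 0"
      using k(2) by (auto simp: infnorm_0)
  next
    assume x: "infnorm x \<le> t \<and> x \<noteq> 0"
    then have pos: "0 < infnorm x" by (simp add: infnorm_pos_lt)
    obtain N where N: "t / infnorm x < 2 ^ N"
      using real_arch_pow[of 2 "t / infnorm x"] by auto
    define k where "k = (LEAST k. t / 2 ^ k < infnorm x)"
    have "t / 2 ^ N < infnorm x"
      using N pos by (simp add: field_simps)
    then have k: "t / 2 ^ k < infnorm x"
      unfolding k_def by (rule LeastI)
    then have "k \<noteq> 0"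
      using x by (intro notI) simp
    then obtain j where j: "k = Suc j"
      using not0_implies_Suc by blast
    then have "\<not> t / 2 ^ j < infnorm x"
      unfolding k_def by (metis lessI not_less_Least)
    then have "x \<in> annulus (t / 2 ^ j)"
      using k j by (simp add: annulus_def centered_cube_def field_simps)
    then show "x \<in> (\<Union>k. annulus (t / 2 ^ k))" by auto
  qed
  then show ?thesis
    by (auto simp: centered_cube_def)
qed

lemma disjoint_annuli:
  assumes "0 < t"
  shows "disjoint_family (\<lambda>k. annulus (t / 2 ^ k) :: (real^'n) set)"
proof -
  have "annulus (t / 2 ^ k) \<inter> annulus (t / 2 ^ l) = ({} :: (real^'n) set)" if "k < l" for k l :: nat
  proof -
    have "2 ^ Suc k \<le> (2::real) ^ l"
      using that by (intro power_increasing) auto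
    then have "t / 2 ^ l \<le> t / 2 ^ Suc k"
      using assms by (intro divide_left_mono) auto
    then have "t / 2 ^ l \<le> t / 2 ^ k / 2"
      by simp
    then show ?thesis
      by (auto simp: annulus_def centered_cube_def)
  qed
  then show ?thesis
    unfolding disjoint_family_on_def by (metis Int_commute linorder_neqE_nat)
qed

text \<open>The sum of the geometric series of the integrals over dyadic annuli. It plays the role of \<open>1 / \<delta>\<close>, is comparable
with it for small \<open>\<delta>\<close>, and takes every value in \<open>[2, \<infinity>)\<close> for \<open>\<delta> \<le> 1\<close>.\<close>

definition blowup :: "real \<Rightarrow> real" where
  "blowup \<delta> = 1 / (1 - 2 powr - \<delta>)"

text \<open>The annulus with outer radius \<open>t / 2\<^sup>k\<close> contributes \<open>(2\<^sup>n - 1) t\<^sup>\<delta> (2 powr - \<delta>)\<^sup>k\<close>, up to the factor \<open>2\<^sup>n\<close>.\<close>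

lemma power_weight_integral:
  fixes t \<delta> :: real
  assumes t: "0 < t" and \<delta>: "0 < \<delta>" "\<delta> \<le> 1"
  defines "c \<equiv> (2 ^ CARD('n) - 1) * blowup \<delta> * t powr \<delta>"
  shows "ennreal c \<le> (\<integral>\<^sup>+x\<in>centered_cube t. power_weight \<delta> (x :: real^'n) \<partial>lebesgue)"
    and "(\<integral>\<^sup>+x\<in>centered_cube t. power_weight \<delta> (x :: real^'n) \<partial>lebesgue) \<le> ennreal (2 ^ CARD('n) * c)"
proof -
  let ?s = "power_weight \<delta> :: real^'n \<Rightarrow> ennreal" and ?n = "CARD('n)"
  let ?A = "\<lambda>k. annulus (t / 2 ^ k) :: (real^'n) set"
  have [measurable]: "?s \<in> borel_measurable lebesgue"
    using weight_power_weight by (rule weight_measurable)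
  have A_meas [measurable]: "annulus r \<in> sets (lebesgue :: (real^'n) measure)" for r
    unfolding annulus_def by measurable
  have "{0 :: real^'n} \<in> null_sets lebesgue"
    by (auto intro: null_sets_completionI)
  from AE_not_in[OF this]
  have "(\<integral>\<^sup>+x\<in>centered_cube t. ?s x \<partial>lebesgue) = (\<integral>\<^sup>+x\<in>(\<Union>k. ?A k). ?s x \<partial>lebesgue)"
    unfolding annulus_cover[OF t]
    by (intro nn_integral_cong_AE) (auto simp: indicator_def elim!: eventually_mono)
  also have "\<dots> = emeasure (density lebesgue ?s) (\<Union>k. ?A k)"
    by (simp add: emeasure_density)
  also have "\<dots> = (\<Sum>k. emeasure (density lebesgue ?s) (?A k))"
    using disjoint_annuli[OF t] by (intro suminf_emeasure[symmetric]) auto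
  also have "\<dots> = (\<Sum>k. \<integral>\<^sup>+x\<in>?A k. ?s x \<partial>lebesgue)"
    by (simp add: emeasure_density)
  finally have I: "(\<integral>\<^sup>+x\<in>centered_cube t. ?s x \<partial>lebesgue) = (\<Sum>k. \<integral>\<^sup>+x\<in>?A k. ?s x \<partial>lebesgue)" .
  define d where "d k = (2 ^ ?n - 1) * t powr \<delta> * (2 powr - \<delta>) ^ k" for k :: nat
  have d0: "0 \<le> d k" for k by (simp add: d_def)
  have d_eq: "(t / 2 ^ k) powr (\<delta> - real ?n) * ((2 ^ ?n - 1) * (t / 2 ^ k) ^ ?n) = d k" for k
  proof -
    have "(t / 2 ^ k) powr (\<delta> - real ?n) * (t / 2 ^ k) ^ ?n = (t / 2 ^ k) powr \<delta>"
      using t by (simp add: powr_diff powr_realpow)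
    also have "\<dots> = t powr \<delta> * (2 powr - \<delta>) ^ k"
      using t by (simp add: powr_divide powr_minus powr_powr powr_realpow[symmetric] field_simps)
    finally show ?thesis by (simp add: d_def)
  qed
  have ann: "emeasure lebesgue (?A k) = ennreal ((2 ^ ?n - 1) * (t / 2 ^ k) ^ ?n)" for k
    using t by (intro emeasure_annulus) simp
  have lower: "ennreal (d k) \<le> (\<integral>\<^sup>+x\<in>?A k. ?s x \<partial>lebesgue)" for k
  proof -
    have "ennreal (d k) = ennreal ((t / 2 ^ k) powr (\<delta> - real ?n)) * emeasure lebesgue (?A k)"
      unfolding ann d_eq[symmetric] by (rule ennreal_mult) (use t in auto)
    also have "\<dots> = (\<integral>\<^sup>+x\<in>?A k. ennreal ((t / 2 ^ k) powr (\<delta> - real ?n)) \<partial>lebesgue)"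
      by (intro nn_integral_cmult_indicator[symmetric]) measurable
    also have "\<dots> \<le> (\<integral>\<^sup>+x\<in>?A k. ?s x \<partial>lebesgue)"
      using power_weight_annulus(1)[of _ "t / 2 ^ k" \<delta>] t \<delta>
      by (intro nn_integral_mono) (auto simp: indicator_def)
    finally show ?thesis .
  qed
  have upper: "(\<integral>\<^sup>+x\<in>?A k. ?s x \<partial>lebesgue) \<le> ennreal (2 ^ ?n * d k)" for k
  proof -
    have "(\<integral>\<^sup>+x\<in>?A k. ?s x \<partial>lebesgue) \<le> (\<integral>\<^sup>+x\<in>?A k. ennreal (2 ^ ?n * (t / 2 ^ k) powr (\<delta> - real ?n)) \<partial>lebesgue)"
      using power_weight_annulus(2)[of _ "t / 2 ^ k" \<delta>] t \<delta>
      by (intro nn_integral_mono) (auto simp: indicator_def)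
    also have "\<dots> = ennreal (2 ^ ?n * (t / 2 ^ k) powr (\<delta> - real ?n)) * emeasure lebesgue (?A k)"
      by (intro nn_integral_cmult_indicator) measurable
    also have "\<dots> = ennreal (2 ^ ?n * d k)"
    proof -
      have "2 ^ ?n * d k = (2 ^ ?n * (t / 2 ^ k) powr (\<delta> - real ?n)) * ((2 ^ ?n - 1) * (t / 2 ^ k) ^ ?n)"
        unfolding d_eq[symmetric] by (rule mult.assoc[symmetric])
      then show ?thesis
        unfolding ann by (simp only:) (rule ennreal_mult[symmetric], use t in auto)
    qed
    finally show ?thesis .
  qed
  have "2 powr - \<delta> < (1::real)"
    using powr_less_mono[of "- \<delta>" 0 "2::real"] \<delta> by simp
  then have "(\<lambda>k. (2 powr - \<delta>) ^ k) sums blowup \<delta>"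
    unfolding blowup_def by (intro geometric_sums) simp
  then have sums: "d sums c"
    using sums_mult[of "\<lambda>k. (2 powr - \<delta>) ^ k" "blowup \<delta>" "(2 ^ ?n - 1) * t powr \<delta>"]
    unfolding d_def[abs_def] c_def by (simp only: mult_ac)
  have "ennreal c = (\<Sum>k. ennreal (d k))"
    using sums d0 by (intro suminf_ennreal_eq[symmetric]) auto
  also have "\<dots> \<le> (\<Sum>k. \<integral>\<^sup>+x\<in>?A k. ?s x \<partial>lebesgue)"
    using lower by (intro suminf_le) auto
  finally show "ennreal c \<le> (\<integral>\<^sup>+x\<in>centered_cube t. ?s x \<partial>lebesgue)"
    unfolding I .
  have "(\<Sum>k. \<integral>\<^sup>+x\<in>?A k. ?s x \<partial>lebesgue) \<le> (\<Sum>k. ennreal (2 ^ ?n * d k))"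
    using upper by (intro suminf_le) auto
  also have "\<dots> = ennreal (2 ^ ?n * c)"
    using sums_mult[OF sums, of "2 ^ ?n"] d0 by (intro suminf_ennreal_eq) auto
  finally show "(\<integral>\<^sup>+x\<in>centered_cube t. ?s x \<partial>lebesgue) \<le> ennreal (2 ^ ?n * c)"
    unfolding I .
qed

lemma blowup_ge_1: "0 < \<delta> \<Longrightarrow> 1 \<le> blowup \<delta>"
  using powr_less_mono[of "- \<delta>" 0 "2::real"] by (simp add: blowup_def)

text \<open>The \<open>A\<^sub>1\<close> constant is of order \<open>blowup \<delta>\<close>: only cubes whose distance to the origin is at most of the order
of their side length see the singularity. The constant \<open>24 = 4 * 2 * 3\<close> comes from the integral over a centred
cube, the passage from \<open>2 h\<close> to \<open>h\<close> and the passage from \<open>3 h\<close> to \<open>h\<close>.\<close>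

lemma power_weight_A1:
  fixes x :: "real^'n"
  assumes \<delta>: "0 < \<delta>" "\<delta> \<le> 1" and Q: "Q \<in> cubes" and x: "x \<in> Q"
  shows "average Q (power_weight \<delta>) \<le> ennreal (24 ^ CARD('n) * blowup \<delta>) * power_weight \<delta> x"
proof (cases "x = 0 \<and> \<delta> - real CARD('n) < 0")
  case True
  have "0 < 24 ^ CARD('n) * blowup \<delta>"
    using blowup_ge_1[OF \<delta>(1)] by simp
  then have "ennreal (24 ^ CARD('n) * blowup \<delta>) \<noteq> 0"
    by (simp only: ennreal_eq_0_iff not_le)
  moreover have "power_weight \<delta> x = top"
    using True by (simp add: power_weight_def infnorm_0 epowr_def)
  ultimately show ?thesis
    by (metis ennreal_top_mult_left top_greatest)
next
  case x0: False
  let ?n = "CARD('n)" and ?K = "blowup \<delta>"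
  let ?e = "\<delta> - real ?n"
  have K: "1 \<le> ?K" using \<delta>(1) by (rule blowup_ge_1)
  have n: "1 \<le> ?n" by (simp add: Suc_leI)
  then have e: "?e \<le> 0" using \<delta>(2) by linarith
  obtain a h where Qdef: "Q = cbox a (\<chi> i. a $ i + h)" and h: "0 < h"
    using Q by (auto simp: cubes_def)
  have close: "\<bar>infnorm y - infnorm x\<bar> \<le> h" if "y \<in> Q" for y
  proof -
    have "infnorm (y - x) \<le> h"
      unfolding infnorm_le_iff
    proof
      fix i
      have "a $ i \<le> y $ i" "y $ i \<le> a $ i + h" "a $ i \<le> x $ i" "x $ i \<le> a $ i + h"
        using that x unfolding Qdef cbox_cube by auto
      then show "\<bar>(y - x) $ i\<bar> \<le> h" by simp
    qed
    then show ?thesis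
      using absdiff_infnorm[of y x] by linarith
  qed
  show ?thesis
  proof (cases "2 * h \<le> infnorm x")
    \<comment> \<open>Far from the origin the weight is almost constant on the cube.\<close>
    case True
    have r: "0 < infnorm x" using True h by linarith
    have "average Q (power_weight \<delta>) \<le> ennreal (2 ^ ?n) * power_weight \<delta> x"
    proof (rule average_le_const[OF Q])
      fix y assume "y \<in> Q"
      then have y: "infnorm x / 2 \<le> infnorm y" using close[of y] True by linarith
      then have "infnorm y powr ?e \<le> (infnorm x / 2) powr ?e"
        using r e by (intro powr_mono2') auto
      also have "\<dots> = 2 powr (real ?n - \<delta>) * infnorm x powr ?e"
        using r by (simp add: powr_divide powr_diff)
      also have "\<dots> \<le> 2 powr (real ?n) * infnorm x powr ?e"
        using \<delta> by (intro mult_right_mono powr_mono) auto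
      finally have "infnorm y powr ?e \<le> 2 ^ ?n * infnorm x powr ?e"
        by (simp add: powr_realpow)
      then have "ennreal (infnorm y powr ?e) \<le> ennreal (2 ^ ?n) * ennreal (infnorm x powr ?e)"
        by (subst ennreal_mult[symmetric]) (auto intro: ennreal_leI)
      moreover have "0 < infnorm y" using y r by linarith
      ultimately show "power_weight \<delta> y \<le> ennreal (2 ^ ?n) * power_weight \<delta> x"
        using r by (simp add: power_weight_def epowr_ennreal)
    qed
    also have "\<dots> \<le> ennreal (24 ^ ?n * ?K) * power_weight \<delta> x"
    proof -
      have "(2::real) ^ ?n \<le> 24 ^ ?n" by (intro power_mono) auto
      then have "(2::real) ^ ?n * 1 \<le> 24 ^ ?n * ?K" using K by (intro mult_mono) auto
      then show ?thesis by (intro mult_right_mono ennreal_leI) auto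
    qed
    finally show ?thesis .
  next
    \<comment> \<open>Near the origin the cube is comparable to a centred one.\<close>
    case False
    have "Q \<subseteq> centered_cube (3 * h)"
    proof
      fix y assume "y \<in> Q"
      then show "y \<in> centered_cube (3 * h)"
        using close[of y] False by (simp add: centered_cube_def)
    qed
    then have "(\<integral>\<^sup>+y\<in>Q. power_weight \<delta> y \<partial>lebesgue) \<le> (\<integral>\<^sup>+y\<in>centered_cube (3 * h). power_weight \<delta> (y :: real^'n) \<partial>lebesgue)"
      by (intro nn_integral_mono) (auto simp: indicator_def)
    also have "\<dots> \<le> ennreal (2 ^ ?n * ((2 ^ ?n - 1) * ?K * (3 * h) powr \<delta>))"
      using h \<delta> by (intro power_weight_integral) auto
    also have "\<dots> \<le> ennreal (24 ^ ?n * ?K * (2 * h) powr ?e * h ^ ?n)"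
    proof (rule ennreal_leI)
      have "(2::real) powr ?n * (2 powr ?n - 1) * ?K * (3 powr \<delta> * h powr \<delta>) \<le> 2 powr ?n * 2 powr ?n * ?K * (3 powr ?n * h powr \<delta>)"
      proof (rule mult_mono)
        show "(2::real) powr ?n * (2 powr ?n - 1) * ?K \<le> 2 powr ?n * 2 powr ?n * ?K"
          using K by (intro mult_right_mono mult_left_mono) auto
        have "\<delta> \<le> real ?n"
          using \<delta>(2) e by linarith
        then have "(3::real) powr \<delta> \<le> 3 powr ?n"
          by (intro powr_mono) auto
        then show "3 powr \<delta> * h powr \<delta> \<le> 3 powr ?n * h powr \<delta>"
          by (intro mult_right_mono) auto
      qed (use K in auto)
      also have "\<dots> = (2 powr ?n * 2 powr ?n * 3 powr ?n) * ?K * h powr \<delta>"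
        by simp
      also have "2 powr real ?n * 2 powr real ?n * 3 powr real ?n = (12::real) powr ?n"
        by (simp flip: powr_mult)
      also have "12 powr ?n * ?K * h powr \<delta> \<le> (12 powr ?n * (2 powr ?n * 2 powr ?e)) * ?K * h powr \<delta>"
      proof -
        have "1 \<le> (2::real) powr \<delta>" using \<delta> by (intro ge_one_powr_ge_zero) auto
        then have "1 \<le> 2 powr real ?n * (2::real) powr ?e" by (simp flip: powr_add)
        then have "12 powr real ?n * 1 \<le> 12 powr real ?n * (2 powr real ?n * (2::real) powr ?e)"
          by (rule mult_left_mono) simp
        then show ?thesis using K by (intro mult_right_mono) auto
      qed
      also have "12 powr ?n * (2 powr ?n * 2 powr ?e) * ?K * h powr \<delta> = 24 powr ?n * ?K * (2 powr ?e * h powr ?e) * h powr ?n"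
      proof -
        have "12 powr real ?n * 2 powr real ?n = (24::real) powr ?n"
          by (simp flip: powr_mult)
        moreover have "h powr \<delta> = h powr ?e * h powr ?n"
          using h by (simp flip: powr_add)
        ultimately show ?thesis
          by (simp only: mult_ac flip: \<open>12 powr real ?n * 2 powr real ?n = (24::real) powr ?n\<close>)
      qed
      finally show "2 ^ ?n * ((2 ^ ?n - 1) * ?K * (3 * h) powr \<delta>) \<le> 24 ^ ?n * ?K * (2 * h) powr ?e * h ^ ?n"
        using h by (simp add: powr_mult powr_realpow mult.assoc)
    qed
    also have "\<dots> = ennreal (24 ^ ?n * ?K) * ennreal ((2 * h) powr ?e) * emeasure lebesgue Q"
      unfolding Qdef using h K by (subst emeasure_cbox_cube) (auto simp flip: ennreal_mult)
    also have "\<dots> \<le> ennreal (24 ^ ?n * ?K) * power_weight \<delta> x * emeasure lebesgue Q"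
    proof (intro mult_right_mono mult_left_mono)
      show "ennreal ((2 * h) powr ?e) \<le> power_weight \<delta> x"
      proof -
        have "ennreal ((2 * h) powr ?e) = ennreal (2 * h) epowr ?e"
          using h by (simp add: epowr_ennreal)
        also have "\<dots> \<le> power_weight \<delta> x"
          unfolding power_weight_def using False e by (intro epowr_mono_neg ennreal_leI) auto
        finally show ?thesis .
      qed
    qed auto
    finally show ?thesis
      unfolding average_def by (rule divide_le_ennreal_of_le_mult)
  qed
qed

text \<open>The centred cube through \<open>x\<close> shows that the \<open>A\<^sub>1\<close> estimate is attained, up to a dimensional constant, at every point.\<close>

lemma power_weight_reverse:
  fixes x :: "real^'n"
  assumes \<delta>: "0 < \<delta>" "\<delta> \<le> 1" and x: "x \<noteq> 0"
  shows "ennreal (blowup \<delta> / 2) * power_weight \<delta> x \<le> average (centered_cube (infnorm x)) (power_weight \<delta> :: real^'n \<Rightarrow> ennreal)"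
proof -
  let ?r = "infnorm x" and ?n = "CARD('n)" and ?K = "blowup \<delta>"
  have r: "0 < ?r" using x by (simp add: infnorm_pos_lt)
  have K: "1 \<le> ?K" using \<delta>(1) by (rule blowup_ge_1)
  have "2 ^ 1 \<le> (2::real) ^ ?n"
    by (intro power_increasing) (auto simp: Suc_leI)
  then have "2 ^ ?n / 2 \<le> (2::real) ^ ?n - 1" by simp
  then have "2 ^ ?n / 2 * (?K * ?r powr \<delta>) \<le> (2 ^ ?n - 1) * (?K * ?r powr \<delta>)"
    using K by (intro mult_right_mono) auto
  moreover have "?K / 2 * ?r powr (\<delta> - real ?n) * (2 * ?r) ^ ?n = 2 ^ ?n / 2 * (?K * ?r powr \<delta>)"
    using r by (simp add: powr_diff powr_realpow power_mult_distrib)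
  ultimately have "?K / 2 * ?r powr (\<delta> - real ?n) * (2 * ?r) ^ ?n \<le> (2 ^ ?n - 1) * ?K * ?r powr \<delta>"
    by (simp only: mult.assoc)
  then have "ennreal (?K / 2 * ?r powr (\<delta> - real ?n) * (2 * ?r) ^ ?n)
      \<le> (\<integral>\<^sup>+y\<in>centered_cube ?r. power_weight \<delta> (y :: real^'n) \<partial>lebesgue)"
    using power_weight_integral(1)[OF r \<delta>, where 'n = 'n] by (rule order_trans[OF ennreal_leI])
  moreover have "ennreal (?K / 2 * ?r powr (\<delta> - real ?n) * (2 * ?r) ^ ?n)
      = ennreal (?K / 2) * power_weight \<delta> x * emeasure lebesgue (centered_cube ?r :: (real^'n) set)"
    using r K by (subst emeasure_centered_cube) (auto simp: power_weight_def epowr_ennreal simp flip: ennreal_mult)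
  ultimately have "ennreal (?K / 2) * power_weight \<delta> x * emeasure lebesgue (centered_cube ?r :: (real^'n) set)
        / emeasure lebesgue (centered_cube ?r :: (real^'n) set)
      \<le> average (centered_cube ?r) (power_weight \<delta> :: real^'n \<Rightarrow> ennreal)"
    unfolding average_def by (intro divide_right_mono_ennreal) simp
  then show ?thesis
    using r cube_emeasure_pos[OF centered_cube_in_cubes[OF r, where 'n = 'n]]
      cube_emeasure_finite[OF centered_cube_in_cubes[OF r, where 'n = 'n]]
    by (subst (asm) mult_divide_eq_ennreal) auto
qed

lemma blowup_surj:
  assumes "2 \<le> K"
  obtains \<delta> where "0 < \<delta>" and "\<delta> \<le> 1" and "blowup \<delta> = K"
proof -
  define \<delta> where "\<delta> = - log 2 (1 - 1 / K)"
  have *: "1 / 2 \<le> 1 - 1 / K" "1 - 1 / K < 1"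
    using assms by (auto simp: field_simps)
  have "2 powr - \<delta> = 1 - 1 / K"
    using * by (simp add: \<delta>_def)
  then have "blowup \<delta> = K"
    by (simp add: blowup_def)
  moreover have "0 < \<delta>"
    using * by (simp add: \<delta>_def log_less_zero_cancel_iff)
  moreover have "\<delta> \<le> 1"
  proof -
    have "log 2 (1 / 2) \<le> log 2 (1 - 1 / K)"
      using * by (intro log_mono) auto
    then show ?thesis by (simp add: \<delta>_def log_divide)
  qed
  ultimately show thesis using that by blast
qed

section \<open>Sharpness of the exponents\<close>

context Hoelder_exponents
begin

text \<open>On the power weight with blow-up \<open>K\<close> the inequality gives \<open>K\<^sup>m \<le> D K\<^sup>E\<close> with \<open>E = (m p - 1) a\<^sup>+ + (b\<^sub>1\<^sup>+ + \<dots> + b\<^sub>m\<^sup>+)\<close>. For the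
exponents \<open>1 / p\<close> and \<open>1 / P i\<close> this \<open>E\<close> would be exactly \<open>m\<close>; if one of them is decreased then \<open>E < m\<close>, as
all coefficients are positive, and \<open>K \<rightarrow> \<infinity>\<close> gives a contradiction.\<close>

theorem exponents_sharp:
  fixes a :: real and b :: "nat \<Rightarrow> real"
  assumes a: "a \<le> 1 / p" and b: "\<And>i. i \<in> {1..m} \<Longrightarrow> b i \<le> 1 / P i"
    and strict: "a < 1 / p \<or> (\<exists>i\<in>{1..m}. b i < 1 / P i)"
    and bound: "\<And>(w :: nat \<Rightarrow> real^'n \<Rightarrow> ennreal) f. w \<in> A_P m p P \<Longrightarrow>
        (\<And>i. i \<in> {1..m} \<Longrightarrow> f i \<in> borel_measurable lebesgue) \<Longrightarrow>
        weighted_norm p (nu_weight m p P w) (multi_maximal m f)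
          \<le> ennreal C * A_P_const m p P w epowr a
            * (\<Prod>i\<in>{1..m}. A_inf_const (sigma_weight (P i) (w i)) epowr b i)
            * (\<Prod>i\<in>{1..m}. weighted_norm (P i) (w i) (\<lambda>x. ennreal \<bar>f i x\<bar>))"
  shows False
proof -
  define E where "E = (m * p - 1) * max a 0 + (\<Sum>i\<in>{1..m}. max (b i) 0)"
  have pm: "0 < m * p - 1" using mp_gt_1 by simp
  have a': "max a 0 \<le> 1 / p" using a p_pos by simp
  have b': "max (b i) 0 \<le> 1 / P i" if "i \<in> {1..m}" for i
    using b[OF that] P_pos[OF that] by simp
  have total: "(m * p - 1) * (1 / p) + (\<Sum>i\<in>{1..m}. 1 / P i) = m"
    unfolding p_def[symmetric] using p_pos by (simp add: field_simps)
  have E: "E < m"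
  proof (cases "a < 1 / p")
    case True
    then have "max a 0 < 1 / p" using p_pos by simp
    then have "(m * p - 1) * max a 0 < (m * p - 1) * (1 / p)"
      using pm by (intro mult_strict_left_mono)
    moreover have "(\<Sum>i\<in>{1..m}. max (b i) 0) \<le> (\<Sum>i\<in>{1..m}. 1 / P i)"
      using b' by (rule sum_mono)
    ultimately show ?thesis unfolding E_def using total by linarith
  next
    case False
    then obtain j where j: "j \<in> {1..m}" "b j < 1 / P j" using strict by auto
    have "(\<Sum>i\<in>{1..m}. max (b i) 0) < (\<Sum>i\<in>{1..m}. 1 / P i)"
      using b' j P_pos[OF j(1)] by (intro sum_strict_mono_ex1) (auto intro!: bexI[of _ j])
    moreover have "(m * p - 1) * max a 0 \<le> (m * p - 1) * (1 / p)"
      using pm a' by (intro mult_left_mono) auto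
    ultimately show ?thesis unfolding E_def using total by linarith
  qed
  \<comment> \<open>\<open>K\<close> is chosen so large that \<open>K powr (m - E)\<close> exceeds the resulting constant \<open>D\<close>.\<close>
  define D where "D = 2 ^ m * max C 0 * (24 ^ CARD('n)) powr E"
  have D: "0 \<le> D" by (simp add: D_def)
  define K where "K = max 2 ((D + 1) powr (1 / (m - E)))"
  have K: "2 \<le> K" "(D + 1) powr (1 / (m - E)) \<le> K" by (auto simp: K_def)
  obtain \<delta> where \<delta>: "0 < \<delta>" "\<delta> \<le> 1" "blowup \<delta> = K"
    using blowup_surj[OF K(1)] by metis
  let ?s = "power_weight \<delta> :: real^'n \<Rightarrow> ennreal"
  have "(K / 2) ^ m \<le> max C 0 * (24 ^ CARD('n) * K) powr E"
    unfolding E_def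
  proof (rule exponents_necessary[where s = ?s and B = "centered_cube 1"])
    show "1 \<le> 24 ^ CARD('n) * K"
    proof -
      have "1 * 1 \<le> 24 ^ CARD('n) * K"
        using K(1) by (intro mult_mono) auto
      then show ?thesis by simp
    qed
    show "(\<integral>\<^sup>+x\<in>centered_cube 1. ?s x \<partial>lebesgue) < \<infinity>"
      using power_weight_integral(2)[of 1 \<delta>, where 'n = 'n] \<delta> by (auto elim: le_less_trans)
    have "{0 :: real^'n} \<in> null_sets lebesgue"
      by (auto intro: null_sets_completionI)
    from AE_not_in[OF this]
    show "AE x in lebesgue. x \<in> (centered_cube 1 :: (real^'n) set) \<longrightarrow>
      (\<exists>Q\<in>cubes. x \<in> Q \<and> Q \<subseteq> centered_cube 1 \<and> ennreal (K / 2) * ?s x \<le> average Q ?s)"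
    proof eventually_elim
      case (elim x)
      show ?case
      proof
        assume x: "x \<in> centered_cube 1"
        show "\<exists>Q\<in>cubes. x \<in> Q \<and> Q \<subseteq> centered_cube 1 \<and> ennreal (K / 2) * ?s x \<le> average Q ?s"
        proof (intro bexI[of _ "centered_cube (infnorm x)"] conjI)
          show "ennreal (K / 2) * ?s x \<le> average (centered_cube (infnorm x)) ?s"
            using power_weight_reverse[of \<delta> x] \<delta> elim by simp
          show "centered_cube (infnorm x) \<in> cubes"
            using elim by (intro centered_cube_in_cubes) (simp add: infnorm_pos_lt)
        qed (use x in \<open>auto simp: centered_cube_def\<close>)
      qed
    qed
    show "average Q ?s \<le> ennreal (24 ^ CARD('n) * K) * ?s x" if "Q \<in> cubes" "x \<in> Q" for Q x
      using power_weight_A1[OF \<delta>(1,2) that] \<delta>(3) by simp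
    show "(centered_cube 1 :: (real^'n) set) \<in> cubes"
      by (rule centered_cube_in_cubes) simp
    show "0 < K / 2"
      using K(1) by simp
  qed (fact weight_power_weight bound)+
  then have "K ^ m \<le> 2 ^ m * (max C 0 * (24 ^ CARD('n) * K) powr E)"
    by (simp add: power_divide field_simps)
  also have "\<dots> = D * K powr E"
    using K(1) by (simp add: D_def powr_mult)
  finally have "K powr m \<le> D * K powr E"
    using K(1) by (simp add: powr_realpow)
  then have "K powr (m - E) \<le> D"
    using K(1) by (simp add: powr_diff field_simps)
  moreover have "D + 1 \<le> K powr (m - E)"
  proof -
    have "D + 1 = ((D + 1) powr (1 / (m - E))) powr (m - E)"
      using D E by (simp add: powr_powr)
    also have "\<dots> \<le> K powr (m - E)"
      using K(2) E by (intro powr_mono2) auto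
    finally show ?thesis .
  qed
  ultimately show False by linarith
qed

end

theorem theorem1p1:
  fixes m :: nat and p :: real and P :: "nat \<Rightarrow> real"
  assumes "1 \<le> m"
    and "\<forall>i\<in>{1..m}. 1 < P i"
    and "1 / p = (\<Sum>i\<in>{1..m}. 1 / P i)"
  shows
    "(\<exists>C::real. \<forall>(w :: nat \<Rightarrow> real^'n \<Rightarrow> ennreal) (f :: nat \<Rightarrow> real^'n \<Rightarrow> real).
        w \<in> A_P m p P \<longrightarrow> (\<forall>i\<in>{1..m}. f i \<in> borel_measurable lebesgue) \<longrightarrow>
        weighted_norm p (nu_weight m p P w) (multi_maximal m f)
          \<le> ennreal C * A_P_const m p P w epowr (1 / p)
            * (\<Prod>i\<in>{1..m}. A_inf_const (sigma_weight (P i) (w i)) epowr (1 / P i))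
            * (\<Prod>i\<in>{1..m}. weighted_norm (P i) (w i) (\<lambda>x. ennreal \<bar>f i x\<bar>)))
     \<and> (\<forall>(a::real) (b :: nat \<Rightarrow> real).
        a \<le> 1 / p \<longrightarrow> (\<forall>i\<in>{1..m}. b i \<le> 1 / P i) \<longrightarrow>
        (a < 1 / p \<or> (\<exists>i\<in>{1..m}. b i < 1 / P i)) \<longrightarrow>
        \<not> (\<exists>C::real. \<forall>(w :: nat \<Rightarrow> real^'n \<Rightarrow> ennreal) (f :: nat \<Rightarrow> real^'n \<Rightarrow> real).
            w \<in> A_P m p P \<longrightarrow> (\<forall>i\<in>{1..m}. f i \<in> borel_measurable lebesgue) \<longrightarrow>
            weighted_norm p (nu_weight m p P w) (multi_maximal m f)
              \<le> ennreal C * A_P_const m p P w epowr a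
                * (\<Prod>i\<in>{1..m}. A_inf_const (sigma_weight (P i) (w i)) epowr b i)
                * (\<Prod>i\<in>{1..m}. weighted_norm (P i) (w i) (\<lambda>x. ennreal \<bar>f i x\<bar>))))"
proof -
  interpret Hoelder_exponents m p P
    using assms by unfold_locales auto
  show ?thesis
  proof (intro conjI allI impI notI)
    show "\<exists>C::real. \<forall>(w :: nat \<Rightarrow> real^'n \<Rightarrow> ennreal) (f :: nat \<Rightarrow> real^'n \<Rightarrow> real).
        w \<in> A_P m p P \<longrightarrow> (\<forall>i\<in>{1..m}. f i \<in> borel_measurable lebesgue) \<longrightarrow>
        weighted_norm p (nu_weight m p P w) (multi_maximal m f)
          \<le> ennreal C * A_P_const m p P w epowr (1 / p)
            * (\<Prod>i\<in>{1..m}. A_inf_const (sigma_weight (P i) (w i)) epowr (1 / P i))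
            * (\<Prod>i\<in>{1..m}. weighted_norm (P i) (w i) (\<lambda>x. ennreal \<bar>f i x\<bar>))"
    proof (intro exI[of _ "maximal_const CARD('n)"] allI impI)
      fix w :: "nat \<Rightarrow> real^'n \<Rightarrow> ennreal" and f :: "nat \<Rightarrow> real^'n \<Rightarrow> real"
      assume w: "w \<in> A_P m p P" and f: "\<forall>i\<in>{1..m}. f i \<in> borel_measurable lebesgue"
      interpret A_P_tuple m p P w
        using w by unfold_locales
      show "weighted_norm p (nu_weight m p P w) (multi_maximal m f)
          \<le> ennreal (maximal_const CARD('n)) * A_P_const m p P w epowr (1 / p)
            * (\<Prod>i\<in>{1..m}. A_inf_const (sigma_weight (P i) (w i)) epowr (1 / P i))
            * (\<Prod>i\<in>{1..m}. weighted_norm (P i) (w i) (\<lambda>x. ennreal \<bar>f i x\<bar>))"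
        using f by (intro maximal_bound) auto
    qed
  next
    fix a :: real and b :: "nat \<Rightarrow> real"
    assume "a \<le> 1 / p" "\<forall>i\<in>{1..m}. b i \<le> 1 / P i" "a < 1 / p \<or> (\<exists>i\<in>{1..m}. b i < 1 / P i)"
      and "\<exists>C::real. \<forall>(w :: nat \<Rightarrow> real^'n \<Rightarrow> ennreal) (f :: nat \<Rightarrow> real^'n \<Rightarrow> real).
            w \<in> A_P m p P \<longrightarrow> (\<forall>i\<in>{1..m}. f i \<in> borel_measurable lebesgue) \<longrightarrow>
            weighted_norm p (nu_weight m p P w) (multi_maximal m f)
              \<le> ennreal C * A_P_const m p P w epowr a
                * (\<Prod>i\<in>{1..m}. A_inf_const (sigma_weight (P i) (w i)) epowr b i)
                * (\<Prod>i\<in>{1..m}. weighted_norm (P i) (w i) (\<lambda>x. ennreal \<bar>f i x\<bar>))"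
    then show False
      using exponents_sharp[where 'n = 'n, of a b] by blast
  qed
qed

end
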